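(* Let $\{\mathfrak{a}_1,\dots,\mathfrak{a}_d\}$ be a basis of $\mathbb{R}^d$ and $\Gamma=(V,E)$ a locally finite infinite graph with vertex set $V\subset\mathbb{R}^d$, invariant under the translations by each $\mathfrak{a}_i$. Let $\mathbb{Z}^d_{\mathfrak{a}}=\{\sum n_i\mathfrak{a}_i:n\in\mathbb{Z}^d\}$, $\mathcal{C}_{\mathfrak{a}}=\{\sum x_i\mathfrak{a}_i:x_i\in[0,1)\}$, $V_f=V\cap\mathcal{C}_{\mathfrak{a}}=\{v_1,\dots,v_\nu\}$, so that every $v\in V$ is uniquely $v=\lfloor v\rfloor_{\mathfrak{a}}+\{v\}_{\mathfrak{a}}$ with $\lfloor v\rfloor_{\mathfrak{a}}\in\mathbb{Z}^d_{\mathfrak{a}}$, $\{v\}_{\mathfrak{a}}\in V_f$. Let $\mathfrak{b}_j$ be the dual basis ($\mathfrak{a}_i\cdot\mathfrak{b}_j=2\pi\delta_{ij}$), $\mathbb{T}^d_\ast=[0,1)^d$, $\theta_{\mathfrak{b}}=\sum_i\theta_i\mathfrak{b}_i$. Let $H=\mathcal{A}+Q$ on $\ell^2(\Gamma)$ with $\mathcal{A}$ the adjacency matrix and $Q$ real with $Q(v+\mathfrak{a}_i)=Q(v)$. Define $(U\psi)_{\theta_{\mathfrak{b}}}(v_n)=\sum_{k_{\mathfrak{a}}\in\mathbb{Z}^d_{\mathfrak{a}}}e^{-\mathrm{i}\theta_{\mathfrak{b}}\cdot(v_n+k_{\mathfrak{a}})}\psi(v_n+k_{\mathfrak{a}})$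 and the $\nu\times\nu$ matrices $[H(\theta_{\mathfrak{b}})f](v_n)=\sum_{u\sim v_n}e^{\mathrm{i}\theta_{\mathfrak{b}}\cdot(u-v_n)}f(\{u\}_{\mathfrak{a}})+Q(v_n)f(v_n)$, with eigen-decomposition $H(\theta_{\mathfrak{b}})=\sum_{n=1}^\nu E_n(\theta_{\mathfrak{b}})P_n(\theta_{\mathfrak{b}})$ (eigenvalues increasing, counted with multiplicity). Let $\psi\in\ell^2(\Gamma)$ with $\|\psi\|=1$. Let $\Omega=\mathbb{T}^d_\ast\times\{1,\dots,\nu\}$, let $\mu^\psi$ be the probability measure on $\Omega$ with $\int_\Omega f\,\mathrm{d}\mu^\psi=\int_{\mathbb{T}^d_\ast}\sum_{n=1}^\nu f(\theta,n)\|P_n(\theta_{\mathfrak{b}})(U\psi)_{\theta_{\mathfrak{b}}}\|^2\,\mathrm{d}\theta$, let $h\colon\Omega\to\mathbb{R}^d$, $h(\theta,n)=\frac{1}{2\pi}\sum_{i=1}^d\mathfrak{a}_i\partial_{\theta_i}E_n(\theta_{\mathfrak{b}})$, and let $\nu_\infty^\psi=h_\star\mu^\psi$ be the image measure. Let $X_t$ be a random vector in $\mathbb{R}^d$ with distribution $\mathbb{P}(X_t=v)=|e^{-\mathrm{i}tH}\psi(v)|^2$, $v\in V$. Then $X_t/t$ converges in distribution, as $t\to+\infty$, to a random vector $Y$ with distribution $\nu_\infty^\psi$.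
   Context: The functions $E_n$ are differentiable for a.e. $\theta$, so $h$ is defined $\mu^\psi$-a.e. *)

theory Defs
  imports "HOL-Analysis.Analysis"
begin

definition lattice :: "('d::finite \<Rightarrow> real^'d) \<Rightarrow> (real^'d) set" where
  "lattice a = {(\<Sum>i\<in>UNIV. of_int (n i) *\<^sub>R a i) | n :: 'd \<Rightarrow> int. True}"

definition cell :: "('d::finite \<Rightarrow> real^'d) \<Rightarrow> (real^'d) set" where
  "cell a = {(\<Sum>i\<in>UNIV. x i *\<^sub>R a i) | x :: 'd \<Rightarrow> real. \<forall>i. 0 \<le> x i \<and> x i < 1}"

definition fracpart :: "('d::finite \<Rightarrow> real^'d) \<Rightarrow> real^'d \<Rightarrow> real^'d" where
  "fracpart a u = (THE w. w \<in> cell a \<and> u - w \<in> lattice a)"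

definition schr_op :: "(real^'d \<Rightarrow> real^'d \<Rightarrow> bool) \<Rightarrow> (real^'d \<Rightarrow> real)
    \<Rightarrow> (real^'d \<Rightarrow> complex) \<Rightarrow> real^'d \<Rightarrow> complex" where
  "schr_op adj Q f v = (\<Sum>u\<in>{u. adj v u}. f u) + complex_of_real (Q v) * f v"

text \<open>e^{-itH} f for the bounded operator H, via its norm-convergent power series,
  evaluated pointwise.\<close>
definition schr_evol :: "(real^'d \<Rightarrow> real^'d \<Rightarrow> bool) \<Rightarrow> (real^'d \<Rightarrow> real) \<Rightarrow> real
    \<Rightarrow> (real^'d \<Rightarrow> complex) \<Rightarrow> real^'d \<Rightarrow> complex" where
  "schr_evol adj Q t f v =
     (\<Sum>k. ((- \<i> * complex_of_real t) ^ k / of_nat (fact k)) * ((schr_op adj Q ^^ k) f) v)"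

definition bloch_op :: "('d::finite \<Rightarrow> real^'d) \<Rightarrow> (real^'d \<Rightarrow> real^'d \<Rightarrow> bool)
    \<Rightarrow> (real^'d \<Rightarrow> real) \<Rightarrow> real^'d \<Rightarrow> (real^'d \<Rightarrow> complex) \<Rightarrow> real^'d \<Rightarrow> complex" where
  "bloch_op a adj Q \<theta>b g v =
     (\<Sum>u\<in>{u. adj v u}. exp (\<i> * complex_of_real (\<theta>b \<bullet> (u - v))) * g (fracpart a u))
     + complex_of_real (Q v) * g v"

definition torus :: "(real^'d::finite) set" where
  "torus = {\<theta>. \<forall>i. 0 \<le> \<theta> $ i \<and> \<theta> $ i < 1}"

definition theta_b :: "('d::finite \<Rightarrow> real^'d) \<Rightarrow> real^'d \<Rightarrow> real^'d" where
  "theta_b b \<theta> = (\<Sum>i\<in>UNIV. (\<theta> $ i) *\<^sub>R b i)"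

definition band_partial :: "(real^'d::finite \<Rightarrow> nat \<Rightarrow> real) \<Rightarrow> nat \<Rightarrow> real^'d \<Rightarrow> 'd \<Rightarrow> real" where
  "band_partial Ev n \<theta> i = deriv (\<lambda>s. Ev (\<theta> + s *\<^sub>R axis i 1) n) 0"

definition group_vel :: "('d::finite \<Rightarrow> real^'d) \<Rightarrow> (real^'d \<Rightarrow> nat \<Rightarrow> real) \<Rightarrow> (real^'d) \<times> nat \<Rightarrow> real^'d" where
  "group_vel a Ev = (\<lambda>(\<theta>, n). (1 / (2 * pi)) *\<^sub>R (\<Sum>i\<in>UNIV. band_partial Ev n \<theta> i *\<^sub>R a i))"

text \<open>|| P_n(theta_b) (U psi)_theta ||^2 where P_n is the rank-one projection on phi theta n.\<close>
definition spec_weight :: "(real^'d) set \<Rightarrow> (real^'d \<Rightarrow> nat \<Rightarrow> real^'d \<Rightarrow> complex)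
    \<Rightarrow> (real^'d \<Rightarrow> real^'d \<Rightarrow> complex) \<Rightarrow> (real^'d) \<times> nat \<Rightarrow> real" where
  "spec_weight Vf \<phi> g = (\<lambda>(\<theta>, n). (cmod (\<Sum>v\<in>Vf. cnj (\<phi> \<theta> n v) * g \<theta> v))\<^sup>2)"

definition spec_measure :: "nat \<Rightarrow> (real^'d::finite) set \<Rightarrow> (real^'d \<Rightarrow> nat \<Rightarrow> real^'d \<Rightarrow> complex)
    \<Rightarrow> (real^'d \<Rightarrow> real^'d \<Rightarrow> complex) \<Rightarrow> ((real^'d) \<times> nat) measure" where
  "spec_measure \<nu> Vf \<phi> g =
     density (restrict_space lebesgue torus \<Otimes>\<^sub>M count_space {..<\<nu>})
             (\<lambda>x. ennreal (spec_weight Vf \<phi> g x))"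

definition limit_measure :: "('d::finite \<Rightarrow> real^'d) \<Rightarrow> nat \<Rightarrow> (real^'d) set
    \<Rightarrow> (real^'d \<Rightarrow> nat \<Rightarrow> real) \<Rightarrow> (real^'d \<Rightarrow> nat \<Rightarrow> real^'d \<Rightarrow> complex)
    \<Rightarrow> (real^'d \<Rightarrow> real^'d \<Rightarrow> complex) \<Rightarrow> (real^'d) measure" where
  "limit_measure a \<nu> Vf Ev \<phi> g = distr (spec_measure \<nu> Vf \<phi> g) borel (group_vel a Ev)"

text \<open>E[f(X_t/t)] where P(X_t = v) = |e^{-itH} psi (v)|^2.\<close>
definition expect_scaled :: "(real^'d \<Rightarrow> real^'d \<Rightarrow> bool) \<Rightarrow> (real^'d \<Rightarrow> real) \<Rightarrow> (real^'d) set
    \<Rightarrow> (real^'d \<Rightarrow> complex) \<Rightarrow> (real^'d \<Rightarrow> real) \<Rightarrow> real \<Rightarrow> real" where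
  "expect_scaled adj Q V \<psi> f t =
     (\<Sum>\<^sub>\<infinity>v\<in>V. (cmod (schr_evol adj Q t \<psi> v))\<^sup>2 * f ((1 / t) *\<^sub>R v))"

end

theory Submission
  imports Defs "HOL-Probability.Probability"
begin

text \<open>
  By the Levy continuity theorem it is enough to follow the characteristic functions
  \<open>\<langle>exp(-itH)\<psi>, exp(i\<eta>x) exp(-itH)\<psi>\<rangle>\<close> with \<open>\<eta> = \<xi>/t\<close>. Conjugating \<open>H\<close> by the phase \<open>exp(i\<eta>x)\<close>
  translates its Floquet fibres, and the phase acting on \<open>\<psi>\<close> itself can be dropped in the limit. Hence
  the characteristic function is asymptotically the integral over the torus of
  \<open>\<langle>exp(-itH(\<theta>)) g, exp(-itH(\<theta>-\<eta>)) g\<rangle>\<close>. At a point where all band functions are differentiable, the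
  overlaps between different eigenspaces vanish, bands that touch have equal derivatives, and the phases
  \<open>t (E\<^sub>n(\<theta>) - E\<^sub>n(\<theta>-\<eta>))\<close> converge to directional derivatives of the bands. Almost every point is of this
  kind: by Ky Fan's principle the sum of the lowest bands is an infimum of functions with uniformly
  bounded second derivatives, so a quadratic function minus this sum is convex.
\<close>

subsection \<open>Weak convergence from characteristic functions\<close>

text \<open>The eigenvectors \<open>\<phi> \<theta> n\<close> are an arbitrary family, merely
  measurable in \<theta>: they may jump, and at a degenerate eigenvalue they may be rotated freely.
  So they are never differentiated. Whatever involves two quasimomenta is phrased by overlaps
  between the eigenbases at \<theta> and at \<theta> - \<zeta>/t, which are bounded by 1 for every
  choice of phases; only eigenvalues get differentiated. A second obstacle is that
  \<open>schr_evol\<close> is a pointwise power series, with no operator calculus behind it. Local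
  finiteness and periodicity make it converge, and the comparison with the fibres passes through
  partial sums, with errors uniform over the torus because one number bounds all fibres. Dropping
  the phase on the state costs only the norm of (1 - exp(-i\<xi>x/t))\<psi>, by contractivity of the
  evolution; dominated convergence sends it to 0. The limit law has bounded support because all
  bands share a Lipschitz constant; this is what reduces the continuity theorem in several
  dimensions to the coordinates.\<close>

inductive trig_poly :: "('a::euclidean_space \<Rightarrow> complex) \<Rightarrow> bool" where
  trig_mono: "trig_poly (\<lambda>x. c * iexp (\<xi> \<bullet> x))"
| trig_add: "trig_poly p \<Longrightarrow> trig_poly q \<Longrightarrow> trig_poly (\<lambda>x. p x + q x)"

lemma trig_poly_mult_mono:
  assumes "trig_poly q"
  shows "trig_poly (\<lambda>x. c * iexp (\<xi> \<bullet> x) * q x)"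
  using assms
proof induction
  case (trig_mono d \<zeta>)
  have "(\<lambda>x. c * iexp (\<xi> \<bullet> x) * (d * iexp (\<zeta> \<bullet> x))) = (\<lambda>x. (c * d) * iexp ((\<xi> + \<zeta>) \<bullet> x))"
    by (auto simp: inner_add_left exp_add algebra_simps)
  then show ?case by (metis trig_poly.trig_mono)
next
  case (trig_add p q)
  then show ?case using trig_poly.trig_add by (fastforce simp: distrib_left)
qed

lemma trig_poly_mult:
  assumes "trig_poly p" "trig_poly q"
  shows "trig_poly (\<lambda>x. p x * q x)"
  using assms(1)
proof induction
  case (trig_mono c \<xi>)
  then show ?case using trig_poly_mult_mono[OF assms(2)] by simp
next
  case (trig_add p p')
  then show ?case using trig_poly.trig_add by (fastforce simp: distrib_right)
qed

lemma trig_poly_const: "trig_poly (\<lambda>_. c)"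
  using trig_mono[of c 0] by simp

lemma trig_poly_continuous: "trig_poly p \<Longrightarrow> continuous_on UNIV p"
  by (induction rule: trig_poly.induct) (auto intro!: continuous_intros)

lemma trig_poly_bounded: "trig_poly p \<Longrightarrow> \<exists>B. \<forall>x. cmod (p x) \<le> B"
proof (induction rule: trig_poly.induct)
  case (trig_mono c \<xi>)
  then show ?case by (intro exI[of _ "cmod c"]) (auto simp: norm_mult)
next
  case (trig_add p q)
  then show ?case by (meson norm_triangle_mono)
qed

lemma trig_poly_integral_tendsto:
  fixes M :: "nat \<Rightarrow> 'a::euclidean_space measure"
  assumes "\<And>n. prob_space (M n)" "\<And>n. sets (M n) = sets borel"
    and "prob_space M'" "sets M' = sets borel"
    and char: "\<And>\<xi>. (\<lambda>n. CLINT x|M n. iexp (\<xi> \<bullet> x)) \<longlonglongrightarrow> (CLINT x|M'. iexp (\<xi> \<bullet> x))"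
    and "trig_poly p"
  shows "(\<lambda>n. integral\<^sup>L (M n) p) \<longlonglongrightarrow> integral\<^sup>L M' p"
proof -
  have int: "integrable N q" if N: "prob_space N" "sets N = sets borel" and q: "trig_poly q"
    for N :: "'a measure" and q :: "'a \<Rightarrow> complex"
  proof -
    obtain B where "\<forall>x. cmod (q x) \<le> B" using trig_poly_bounded[OF q] by auto
    moreover have "q \<in> borel_measurable N"
      unfolding measurable_cong_sets[OF N(2) refl]
      using trig_poly_continuous[OF q] by (rule borel_measurable_continuous_onI)
    ultimately show ?thesis
      using N(1) by (intro finite_measure.integrable_const_bound[where B=B])
        (auto simp: prob_space_def)
  qed
  show ?thesis
    using assms(6)
  proof induction
    case (trig_mono c \<xi>)
    then show ?case by (simp add: char tendsto_mult_left)
  next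
    case (trig_add p q)
    then show ?case using int[OF assms(1,2)] int[OF assms(3,4)] by (auto intro!: tendsto_add)
  qed
qed

text \<open>The real functions that become trigonometric polynomials in the complex numbers form a
  ring with constants that separates points, so Stone-Weierstrass applies. Sine and cosine together
  are needed to separate.\<close>

lemma trig_poly_dense:
  fixes f :: "'a::euclidean_space \<Rightarrow> real"
  assumes "compact K" "continuous_on K f" "e > 0"
  obtains p where "trig_poly (\<lambda>x. complex_of_real (p x))" "\<And>x. x \<in> K \<Longrightarrow> \<bar>f x - p x\<bar> < e"
proof -
  define R where "R = {p. trig_poly (\<lambda>x::'a. complex_of_real (p x))}"
  have sincos: "(\<lambda>x. cos (\<xi> \<bullet> x)) \<in> R" "(\<lambda>x. sin (\<xi> \<bullet> x)) \<in> R" for \<xi> :: 'a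
  proof -
    have "(\<lambda>x. complex_of_real (cos (\<xi> \<bullet> x))) =
        (\<lambda>x. (1/2) * iexp (\<xi> \<bullet> x) + (1/2) * iexp ((-\<xi>) \<bullet> x))"
      by (auto simp: cos_exp_eq cos_of_real[symmetric])
    then show "(\<lambda>x. cos (\<xi> \<bullet> x)) \<in> R"
      unfolding R_def by (simp only: mem_Collect_eq) (intro trig_add trig_mono)
    have "(\<lambda>x. complex_of_real (sin (\<xi> \<bullet> x))) =
        (\<lambda>x. (1/(2*\<i>)) * iexp (\<xi> \<bullet> x) + (-1/(2*\<i>)) * iexp ((-\<xi>) \<bullet> x))"
      by (auto simp: sin_exp_eq sin_of_real[symmetric] field_simps)
    then show "(\<lambda>x. sin (\<xi> \<bullet> x)) \<in> R"
      unfolding R_def by (simp only: mem_Collect_eq) (intro trig_add trig_mono)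
  qed
  interpret function_ring_on R K
  proof
    fix p assume "p \<in> R"
    then have "continuous_on K (\<lambda>x. Re (complex_of_real (p x)))"
      unfolding R_def using trig_poly_continuous continuous_on_subset
      by (intro continuous_on_Re) blast
    then show "continuous_on K p" by simp
  next
    fix x y :: 'a assume "x \<noteq> y"
    \<comment> \<open>Normalised so that the two phases differ by exactly 1, an angle strictly
      between 0 and pi, whose cosine is therefore not 1.\<close>
    define \<xi> where "\<xi> = (1 / ((x - y) \<bullet> (x - y))) *\<^sub>R (x - y)"
    have d: "\<xi> \<bullet> x = \<xi> \<bullet> y + 1"
    proof -
      have "\<xi> \<bullet> (x - y) = 1" using \<open>x \<noteq> y\<close> by (simp add: \<xi>_def)
      then show ?thesis by (simp add: inner_diff_right)
    qed
    show "\<exists>f\<in>R. f x \<noteq> f y"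
    proof (rule ccontr)
      assume "\<not> ?thesis"
      then have "cos (\<xi> \<bullet> x) = cos (\<xi> \<bullet> y)" "sin (\<xi> \<bullet> x) = sin (\<xi> \<bullet> y)"
        using sincos[of \<xi>] by (auto dest: bspec)
      then have "cos (\<xi> \<bullet> x - \<xi> \<bullet> y) = 1"
        using sin_cos_squared_add3[of "\<xi> \<bullet> y"] by (simp add: cos_diff)
      then have "cos (1::real) = 1" using d by simp
      then show False using cos_monotone_0_pi[of 0 1] pi_gt3 by simp
    qed
  qed (use assms in \<open>auto simp: R_def intro: trig_add trig_poly_mult trig_poly_const\<close>)
  show ?thesis using Stone_Weierstrass_basic[OF assms(2,3)] that unfolding R_def by auto
qed

text \<open>Since the limit has bounded support, the one-dimensional Levy theorem for the coordinates
  shows that the mass outside a fixed cube vanishes, so uniform approximation by trigonometric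
  polynomials on that single cube suffices.\<close>

theorem levy_continuity_bounded:
  fixes M :: "nat \<Rightarrow> 'a::euclidean_space measure" and f :: "'a \<Rightarrow> real"
  assumes M: "\<And>n. prob_space (M n)" "\<And>n. sets (M n) = sets borel"
    and M': "prob_space M'" "sets M' = sets borel"
    and char: "\<And>\<xi>. (\<lambda>n. CLINT x|M n. iexp (\<xi> \<bullet> x)) \<longlonglongrightarrow> (CLINT x|M'. iexp (\<xi> \<bullet> x))"
    and bdd: "AE x in M'. norm x \<le> R"
    and f: "continuous_on UNIV f" "bounded (range f)"
  shows "(\<lambda>n. integral\<^sup>L (M n) f) \<longlonglongrightarrow> integral\<^sup>L M' f"
proof -
  interpret M: prob_space "M n" for n by fact
  interpret M': prob_space M' by fact
  note [measurable_cong] = M(2) M'(2)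
  \<comment> \<open>A continuous cutoff, 0 on [-R, R] and 1 outside [-R-1, R+1]. Applied to a
    coordinate it integrates to 0 under the limit, and weak convergence of the coordinate laws makes
    its integrals under \<open>M n\<close> tend to 0.\<close>
  define F where "F x = min 1 (max 0 (\<bar>x\<bar> - R))" for x :: real
  have F_meas [measurable]: "F \<in> borel_measurable borel" unfolding F_def by measurable
  have F01: "0 \<le> F x" "F x \<le> 1" for x by (auto simp: F_def)
  have F_cont: "isCont F x" for x unfolding F_def by (intro continuous_intros)
  have M'0: "(LINT x|M'. F (x \<bullet> b)) = 0" if b: "b \<in> Basis" for b
  proof -
    have "AE x in M'. F (x \<bullet> b) = 0"
      using bdd
    proof eventually_elim
      case (elim x)
      have "\<bar>x \<bullet> b\<bar> \<le> R" using Basis_le_norm[OF b, of x] elim by simp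
      then show ?case by (simp add: F_def)
    qed
    then show ?thesis by (simp add: integral_eq_zero_AE)
  qed
  have tail: "(\<lambda>n. LINT x|M n. F (x \<bullet> b)) \<longlonglongrightarrow> 0" if b: "b \<in> Basis" for b
  proof -
    \<comment> \<open>The law of one coordinate; its characteristic function is that of
      \<open>N\<close> restricted to multiples of \<open>b\<close>.\<close>
    define D where "D N = distr N borel (\<lambda>x. x \<bullet> b)" for N :: "'a measure"
    have rd: "real_distribution (D N)" if "prob_space N" "sets N = sets borel" for N :: "'a measure"
    proof -
      have "(\<lambda>x. x \<bullet> b) \<in> borel_measurable N"
        unfolding measurable_cong_sets[OF that(2) refl] by measurable
      then show ?thesis unfolding D_def
        by (intro real_distribution.intro prob_space.prob_space_distr that(1) real_distribution_axioms.intro)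
          auto
    qed
    have ch: "char (D N) s = (CLINT x|N. iexp ((s *\<^sub>R b) \<bullet> x))" if [measurable_cong]: "sets N = sets borel"
      for N s unfolding char_def D_def
      by (subst integral_distr) (auto simp: inner_commute)
    have w: "weak_conv_m (\<lambda>n. D (M n)) (D M')"
      by (rule levy_continuity) (use M M' rd in \<open>simp_all only: ch[OF M(2)] ch[OF M'(2)] char\<close>)
    have "(\<lambda>n. integral\<^sup>L (D (M n)) F) \<longlonglongrightarrow> integral\<^sup>L (D M') F"
      using rd[OF M] rd[OF M'] w
      by (rule weak_conv_imp_integral_bdd_continuous_conv[where B=1]) (use F01 F_cont in auto)
    moreover have "integral\<^sup>L (D (M n)) F = (LINT x|M n. F (x \<bullet> b))" for n
      unfolding D_def by (rule integral_distr) auto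
    moreover have "integral\<^sup>L (D M') F = (LINT x|M'. F (x \<bullet> b))"
      unfolding D_def by (rule integral_distr) auto
    ultimately show ?thesis using M'0[OF b] by simp
  qed
  obtain B where B: "\<And>x. \<bar>f x\<bar> \<le> B" using f(2) by (auto simp: bounded_iff)
  have f_meas [measurable]: "f \<in> borel_measurable borel"
    using f(1) by (rule borel_measurable_continuous_onI)
  \<comment> \<open>Side length chosen so that outside \<open>K\<close> at least one of the cutoffs
    \<open>F (x \<bullet> b)\<close> equals 1.\<close>
  define K :: "'a set" where "K = cbox (- (R+1) *\<^sub>R One) ((R+1) *\<^sub>R One)"
  have bound: "\<forall>\<^sub>F n in sequentially. \<bar>integral\<^sup>L (M n) f - integral\<^sup>L M' f\<bar> < e" if "e > 0" for e
  proof -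
    obtain p where p: "trig_poly (\<lambda>x. complex_of_real (p x))" "\<And>x. x \<in> K \<Longrightarrow> \<bar>f x - p x\<bar> < e/4"
    proof -
      have "compact K" "continuous_on K f" "0 < e/4"
        using f(1) continuous_on_subset \<open>e > 0\<close> by (auto simp: K_def)
      then show ?thesis by (rule trig_poly_dense) (rule that)
    qed
    obtain C where C: "\<And>x. \<bar>p x\<bar> \<le> C" using trig_poly_bounded[OF p(1)] by auto
    have "continuous_on UNIV (\<lambda>x. Re (complex_of_real (p x)))"
      using trig_poly_continuous[OF p(1)] by (rule continuous_on_Re)
    then have p_meas [measurable]: "p \<in> borel_measurable borel"
      by (intro borel_measurable_continuous_onI) simp
    \<comment> \<open>The polynomial \<open>p\<close> is close to \<open>f\<close> only on
      \<open>K\<close>. Elsewhere the crude bound \<open>B + C\<close> is charged to the cutoffs,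
      which gives an estimate on the whole space that can be integrated.\<close>
    have pw: "\<bar>f x - p x\<bar> \<le> e/4 + (B + C) * (\<Sum>b\<in>Basis. F (x \<bullet> b))" for x
    proof (cases "x \<in> K")
      case True
      have "0 \<le> (B + C) * (\<Sum>b\<in>Basis. F (x \<bullet> b))"
        using B[of x] C[of x] F01 by (intro mult_nonneg_nonneg sum_nonneg) auto
      then show ?thesis using p(2)[OF True] by simp
    next
      case False
      then obtain b where b: "b \<in> Basis" "\<not> (- (R+1) \<le> x \<bullet> b \<and> x \<bullet> b \<le> R + 1)"
        unfolding K_def by (auto simp: mem_box algebra_simps)
      then have "F (x \<bullet> b) = 1" by (auto simp: F_def)
      then have "1 \<le> (\<Sum>b\<in>Basis. F (x \<bullet> b))"
        using member_le_sum[of b Basis "\<lambda>b. F (x \<bullet> b)"] b F01 by auto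
      then have "(B + C) * 1 \<le> (B + C) * (\<Sum>b\<in>Basis. F (x \<bullet> b))"
        using B[of x] C[of x] by (intro mult_left_mono) auto
      then have "B + C \<le> (B + C) * (\<Sum>b\<in>Basis. F (x \<bullet> b))" by simp
      then show ?thesis using B[of x] C[of x] \<open>e > 0\<close> by linarith
    qed
    have est: "\<bar>integral\<^sup>L N f - integral\<^sup>L N p\<bar> \<le> e/4 + (B + C) * (\<Sum>b\<in>Basis. LINT x|N. F (x \<bullet> b))"
      if N: "prob_space N" and [measurable_cong]: "sets N = sets borel" for N
    proof -
      interpret N: prob_space N by fact
      have i: "integrable N f" "integrable N p" "integrable N (\<lambda>x. F (x \<bullet> b))" for b
        using B C F01
        by (auto intro: N.integrable_const_bound[where B=B] N.integrable_const_bound[where B=C]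
            N.integrable_const_bound[where B=1])
      have "\<bar>integral\<^sup>L N f - integral\<^sup>L N p\<bar> = \<bar>LINT x|N. f x - p x\<bar>" using i by simp
      also have "\<dots> \<le> (LINT x|N. \<bar>f x - p x\<bar>)" by (rule integral_abs_bound)
      also have "\<dots> \<le> (LINT x|N. e/4 + (B + C) * (\<Sum>b\<in>Basis. F (x \<bullet> b)))"
        using i by (intro integral_mono pw) auto
      also have "\<dots> = e/4 + (B + C) * (\<Sum>b\<in>Basis. LINT x|N. F (x \<bullet> b))"
        using i by (simp add: N.prob_space)
      finally show ?thesis .
    qed
    have lim: "(\<lambda>n. e/4 + (B + C) * (\<Sum>b\<in>Basis. LINT x|M n. F (x \<bullet> b)))
        \<longlonglongrightarrow> e/4 + (B + C) * (\<Sum>b\<in>(Basis::'a set). 0)"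
      by (intro tendsto_intros tail)
    have lim0: "e/4 + (B + C) * (\<Sum>b\<in>(Basis::'a set). 0) < e/2" using \<open>e > 0\<close> by simp
    have ev1: "\<forall>\<^sub>F n in sequentially. e/4 + (B + C) * (\<Sum>b\<in>Basis. LINT x|M n. F (x \<bullet> b)) < e/2"
      using order_tendstoD(2)[OF lim lim0] .
    have e': "\<bar>integral\<^sup>L M' f - integral\<^sup>L M' p\<bar> \<le> e/4" using est[OF M'] M'0 by simp
    have "(\<lambda>n. Re (CLINT x|M n. complex_of_real (p x))) \<longlonglongrightarrow> Re (CLINT x|M'. complex_of_real (p x))"
      by (rule tendsto_Re[OF trig_poly_integral_tendsto[OF M M' char p(1)]])
    then have lim_p: "(\<lambda>n. integral\<^sup>L (M n) p) \<longlonglongrightarrow> integral\<^sup>L M' p" by simp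
    have ev2: "\<forall>\<^sub>F n in sequentially. \<bar>integral\<^sup>L (M n) p - integral\<^sup>L M' p\<bar> < e/4"
      using tendstoD[OF lim_p, of "e/4"] \<open>e > 0\<close> unfolding dist_real_def by linarith
    show ?thesis
      using ev1 ev2
    proof eventually_elim
      case (elim n)
      then show ?case using e' est[OF M, of n] by linarith
    qed
  qed
  then show ?thesis unfolding tendsto_iff dist_real_def by blast
qed

subsection \<open>Differentiability of convex functions\<close>

text \<open>Translation invariance lets the measure of \<open>N\<close> be averaged over its
  translates by \<open>s *\<^sub>R b\<close> with \<open>s\<close> in the unit interval. Tonelli
  turns the average into integrals along the lines in direction \<open>b\<close>, and these vanish
  since countable sets are null.\<close>

lemma null_set_lines:
  fixes N :: "'a::euclidean_space set" and b :: 'a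
  assumes [measurable]: "N \<in> sets borel" and ctble: "\<And>x. countable {s::real. x + s *\<^sub>R b \<in> N}"
  shows "N \<in> null_sets lborel"
proof -
  have "emeasure lborel N = (\<integral>\<^sup>+x. indicator N x \<partial>lborel)" by simp
  also have "\<dots> = (\<integral>\<^sup>+s. indicator {0..1::real} s * (\<integral>\<^sup>+x. indicator N x \<partial>lborel) \<partial>lborel)"
    by (simp add: nn_integral_multc)
  also have "\<dots> = (\<integral>\<^sup>+s. (\<integral>\<^sup>+x. indicator {0..1::real} s * indicator N (x + s
      *\<^sub>R b) \<partial>lborel) \<partial>lborel)"
  proof (intro nn_integral_cong)
    fix s :: real
    have "(\<integral>\<^sup>+x. indicator N x \<partial>lborel) = (\<integral>\<^sup>+x. indicator N (x + s
        *\<^sub>R b) \<partial>(lborel::'a measure))"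
      by (subst lborel_distr_plus[of "s *\<^sub>R b", symmetric], subst nn_integral_distr) (auto simp: add.commute)
    then show "indicator {0..1::real} s * (\<integral>\<^sup>+x. indicator N x \<partial>lborel) =
       (\<integral>\<^sup>+x. indicator {0..1::real} s * indicator N (x + s *\<^sub>R b) \<partial>(lborel::'a measure))"
      by (simp add: nn_integral_cmult)
  qed
  also have "\<dots> = (\<integral>\<^sup>+x. (\<integral>\<^sup>+s. indicator {0..1::real} s * indicator N (x + s
      *\<^sub>R b) \<partial>lborel) \<partial>(lborel::'a measure))"
    by (rule lborel_pair.Fubini') measurable
  also have "\<dots> = (\<integral>\<^sup>+x. 0 \<partial>(lborel::'a measure))"
  proof (intro nn_integral_cong)
    fix x :: 'a
    have "AE s in lborel. x + s *\<^sub>R b \<notin> N"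
      by (rule AE_I'[OF countable_imp_null_set_lborel[OF ctble[of x]]]) auto
    then show "(\<integral>\<^sup>+s. indicator {0..1::real} s * indicator N (x + s *\<^sub>R b) \<partial>lborel) = 0"
      by (subst nn_integral_0_iff_AE) (measurable, auto elim!: eventually_mono)
  qed
  finally show ?thesis by (intro null_setsI) simp_all
qed

text \<open>The subgradient inequalities based at the intermediate point \<open>z\<close> are added
  with weights \<open>1 - t\<close> and \<open>t\<close>; the linear terms cancel.\<close>

lemma subgradient_imp_convex_on:
  fixes f :: "'a::real_inner \<Rightarrow> real"
  assumes sub: "\<And>x y. f y \<ge> f x + p x \<bullet> (y - x)"
  shows "convex_on UNIV f"
proof (rule convex_onI)
  fix t :: real and x y :: 'a assume t: "0 < t" "t < 1"
  define z where "z = (1 - t) *\<^sub>R x + t *\<^sub>R y"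
  have "(1 - t) * (f z + p z \<bullet> (x - z)) + t * (f z + p z \<bullet> (y - z)) \<le> (1 - t) * f x + t * f y"
    using t by (intro add_mono mult_left_mono sub) auto
  moreover have "(1 - t) * (p z \<bullet> (x - z)) + t * (p z \<bullet> (y - z)) = 0"
  proof -
    have "(1 - t) *\<^sub>R (x - z) + t *\<^sub>R (y - z) = 0" by (simp add: z_def algebra_simps)
    then have "p z \<bullet> ((1 - t) *\<^sub>R (x - z) + t *\<^sub>R (y - z)) = 0" by simp
    then show ?thesis by (simp add: inner_add_right)
  qed
  ultimately show "f ((1 - t) *\<^sub>R x + t *\<^sub>R y) \<le> (1 - t) * f x + t * f y"
    unfolding z_def[symmetric] by (simp add: algebra_simps)
qed simp

text \<open>A subgradient selection is monotone along lines, hence has countably many discontinuities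
  there, and at its continuity points the symmetric second difference quotients vanish. For convex
  functions the latter condition in all coordinate directions gives total differentiability.\<close>

lemma convex_AE_differentiable:
  fixes f :: "'a::euclidean_space \<Rightarrow> real"
  assumes sub: "\<And>x y. f y \<ge> f x + p x \<bullet> (y - x)"
  shows "AE x in lborel. f differentiable (at x)"
proof -
  have conv: "convex_on UNIV f" using subgradient_imp_convex_on[OF sub] .
  then have cont: "continuous_on UNIV f" by (intro convex_on_continuous) auto
  \<comment> \<open>The symmetric second difference with step 1/(k+1), divided by the step only
    once. For a convex function its limit is the jump between the one-sided derivatives along
    \<open>b\<close>, so \<open>Z b\<close> is the set of kinks in that direction.\<close>
  define D where "D b k x = real (Suc k) * (f (x + (1 / real (Suc k)) *\<^sub>R b) + f (x - (1 / real (Suc k)) *\<^sub>R b) - 2 * f x)"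
    for b k x
  define Z where "Z b = {x. \<not> (\<lambda>k. D b k x) \<longlonglongrightarrow> 0}" for b
  have f_meas [measurable]: "f \<in> borel_measurable borel" using cont by (rule borel_measurable_continuous_onI)
  have D_meas [measurable]: "D b k \<in> borel_measurable borel" for b k unfolding D_def by measurable
  have Z_meas: "Z b \<in> sets borel" for b
  proof -
    \<comment> \<open>Convergence is restated with countable quantifiers, which makes the set
      \<open>Z b\<close> Borel.\<close>
    have "(\<lambda>k. D b k x) \<longlonglongrightarrow> 0 \<longleftrightarrow> (\<forall>j. \<exists>N.
        \<forall>k\<ge>N. \<bar>D b k x\<bar> < inverse (real (Suc j)))" for x
    proof
      assume "(\<lambda>k. D b k x) \<longlonglongrightarrow> 0"
      then show "\<forall>j. \<exists>N. \<forall>k\<ge>N. \<bar>D b k x\<bar> < inverse (real (Suc j))"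
        unfolding LIMSEQ_def dist_real_def by (auto dest!: spec[of _ "inverse (real (Suc _))"])
    next
      assume *: "\<forall>j. \<exists>N. \<forall>k\<ge>N. \<bar>D b k x\<bar> < inverse (real (Suc j))"
      show "(\<lambda>k. D b k x) \<longlonglongrightarrow> 0" unfolding LIMSEQ_def dist_real_def
        using * reals_Archimedean by (metis diff_zero order_less_trans)
    qed
    then have "Measurable.pred borel (\<lambda>x. \<not> (\<lambda>k. D b k x) \<longlonglongrightarrow> 0)" by simp measurable
    then show ?thesis unfolding Z_def by (simp add: pred_def)
  qed
  have Z_null: "Z b \<in> null_sets lborel" for b
  proof (rule null_set_lines[OF Z_meas, of _ b])
    fix x :: 'a
    define q where "q s = p (x + s *\<^sub>R b) \<bullet> b" for s
    have subq: "f (x + s' *\<^sub>R b) \<ge> f (x + s *\<^sub>R b) + (s' - s) * q s" for s s'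
      using sub[of "x + s *\<^sub>R b" "x + s' *\<^sub>R b"] by (simp add: q_def algebra_simps inner_diff_right)
    have "mono q"
    proof (rule monoI)
      fix s s' :: real assume "s \<le> s'"
      have "(s' - s) * q s \<le> (s' - s) * q s'" using subq[of s s'] subq[of s' s] by (simp add: algebra_simps)
      then show "q s \<le> q s'" using \<open>s \<le> s'\<close> by (cases "s = s'") auto
    qed
    then have "countable {s. \<not> isCont q s}" by (rule mono_ctble_discont)
    moreover have "x + s *\<^sub>R b \<notin> Z b" if "isCont q s" for s
    proof -
      have h: "(\<lambda>k. 1 / real (Suc k)) \<longlonglongrightarrow> 0" by (rule LIMSEQ_inverse_real_of_nat[unfolded inverse_eq_divide])
      have "(\<lambda>k. q (s + 1 / real (Suc k)) - q (s - 1 / real (Suc k))) \<longlonglongrightarrow> q s - q s"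
      proof (intro tendsto_diff isCont_tendsto_compose[OF that])
        show "(\<lambda>k. s + 1 / real (Suc k)) \<longlonglongrightarrow> s" using tendsto_add[OF tendsto_const h, of s] by simp
        show "(\<lambda>k. s - 1 / real (Suc k)) \<longlonglongrightarrow> s" using tendsto_diff[OF tendsto_const h, of s] by simp
      qed
      then have u: "(\<lambda>k. q (s + 1 / real (Suc k)) - q (s - 1 / real (Suc k))) \<longlonglongrightarrow> 0" by simp
      have Ds: "D b k (x + s *\<^sub>R b) = real (Suc k) * (f (x + (s + 1 / real (Suc k)) *\<^sub>R b)
          + f (x + (s - 1 / real (Suc k)) *\<^sub>R b) - 2 * f (x + s *\<^sub>R b))" for k
        unfolding D_def by (simp add: scaleR_left_distrib scaleR_left_diff_distrib add.assoc add_diff_eq del: of_nat_Suc)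
      have "(\<lambda>k. D b k (x + s *\<^sub>R b)) \<longlonglongrightarrow> 0"
      proof (rule tendsto_sandwich[OF _ _ tendsto_const u])
        show "\<forall>\<^sub>F k in sequentially. 0 \<le> D b k (x + s *\<^sub>R b)"
        proof (intro always_eventually allI)
          fix k
          let ?h = "1 / real (Suc k)"
          have "0 \<le> f (x + (s + ?h) *\<^sub>R b) + f (x + (s - ?h) *\<^sub>R b) - 2 * f (x + s *\<^sub>R b)"
            using subq[of s "s + ?h"] subq[of s "s - ?h"] by simp
          then show "0 \<le> D b k (x + s *\<^sub>R b)" unfolding Ds by (intro mult_nonneg_nonneg) auto
        qed
        show "\<forall>\<^sub>F k in sequentially. D b k (x + s *\<^sub>R b) \<le> q (s + 1 / real (Suc k)) - q (s - 1 / real (Suc k))"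
        proof (intro always_eventually allI)
          fix k
          let ?h = "1 / real (Suc k)"
          have "f (x + (s + ?h) *\<^sub>R b) + f (x + (s - ?h) *\<^sub>R b) - 2 * f (x + s *\<^sub>R b) \<le> ?h * (q (s + ?h) - q (s - ?h))"
            using subq[of "s + ?h" s] subq[of "s - ?h" s] by (simp add: algebra_simps)
          then have "real (Suc k) * (f (x + (s + ?h) *\<^sub>R b) + f (x + (s - ?h) *\<^sub>R b) - 2 * f (x + s *\<^sub>R b))
            \<le> real (Suc k) * (?h * (q (s + ?h) - q (s - ?h)))" by (intro mult_left_mono) auto
          moreover have "real (Suc k) * (?h * (q (s + ?h) - q (s - ?h))) = q (s + ?h) - q (s - ?h)"
            by (simp del: of_nat_Suc)
          ultimately show "D b k (x + s *\<^sub>R b) \<le> q (s + 1 / real (Suc k)) - q (s - 1 / real (Suc k))"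
            unfolding Ds by linarith
        qed
      qed
      then show ?thesis by (simp add: Z_def)
    qed
    ultimately show "countable {s. x + s *\<^sub>R b \<in> Z b}" by (rule_tac countable_subset) auto
  qed
  have diff: "f differentiable (at x)" if nz: "\<And>b. b \<in> Basis \<Longrightarrow> x \<notin> Z b" for x
  proof -
    \<comment> \<open>The remainder over the supporting affine function at \<open>x\<close>: convex,
      nonnegative and 0 at the origin. Second differences ignore affine terms, so those of
      \<open>r\<close> at 0 are still \<open>D b k x\<close>.\<close>
    define r where "r y = f (x + y) - f x - p x \<bullet> y" for y
    have r0: "r y \<ge> 0" for y using sub[of x "x + y"] by (simp add: r_def)
    have r_conv: "convex_on UNIV r"
    proof (rule convex_onI)
      fix t :: real and y y' :: 'a assume "0 < t" "t < 1"
      then have "f ((1 - t) *\<^sub>R (x + y) + t *\<^sub>R (x + y')) \<le> (1 - t) * f (x + y) + t * f (x + y')"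
        using convex_onD[OF conv, of t] by auto
      moreover have "(1 - t) *\<^sub>R (x + y) + t *\<^sub>R (x + y') = x + ((1 - t) *\<^sub>R y + t *\<^sub>R y')"
        by (simp add: algebra_simps)
      ultimately show "r ((1 - t) *\<^sub>R y + t *\<^sub>R y') \<le> (1 - t) * r y + t * r y'"
        unfolding r_def by (simp add: algebra_simps inner_add_right)
    qed simp
    let ?d = "real DIM('a)"
    \<comment> \<open>Since \<open>r 0 = 0\<close>, convexity gives
      \<open>r (e *\<^sub>R y) \<le> e * r y\<close> for \<open>e\<close> in [0, 1]; this scales
      down from the step 1/(k+1). As \<open>r\<close> is nonnegative, either sign of
      \<open>c\<close> is covered by the sum of both values in \<open>D\<close>.\<close>
    have line: "r (c *\<^sub>R b) \<le> \<bar>c\<bar> * D b k x" if c: "\<bar>c\<bar> * real (Suc k) \<le> 1" for c b k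
    proof -
      let ?h = "1 / real (Suc k)"
      have Dr: "D b k x = real (Suc k) * (r (?h *\<^sub>R b) + r (- ?h *\<^sub>R b))"
        unfolding D_def r_def by simp
      have "r 0 = 0" by (simp add: r_def)
      then have sc: "r (e *\<^sub>R y) \<le> e * r y" if "0 \<le> e" "e \<le> 1" for e y
        using convex_onD[OF r_conv that, of 0 y] by simp
      define e where "e = \<bar>c\<bar> * real (Suc k)"
      have e: "0 \<le> e" "e \<le> 1" using c by (auto simp: e_def)
      have eh: "e * ?h = \<bar>c\<bar>" by (simp add: e_def)
      have "r (c *\<^sub>R b) \<le> e * (r (?h *\<^sub>R b) + r (- ?h *\<^sub>R b))"
      proof (cases "c \<ge> 0")
        case True
        then have "c *\<^sub>R b = e *\<^sub>R (?h *\<^sub>R b)" using eh by simp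
        then have "r (c *\<^sub>R b) \<le> e * r (?h *\<^sub>R b)" using sc[OF e] by metis
        also have "\<dots> \<le> e * (r (?h *\<^sub>R b) + r (- ?h *\<^sub>R b))" using e r0 by (intro mult_left_mono) auto
        finally show ?thesis .
      next
        case False
        then have "c *\<^sub>R b = e *\<^sub>R (- ?h *\<^sub>R b)" using eh by simp
        then have "r (c *\<^sub>R b) \<le> e * r (- ?h *\<^sub>R b)" using sc[OF e] by metis
        also have "\<dots> \<le> e * (r (?h *\<^sub>R b) + r (- ?h *\<^sub>R b))" using e r0 by (intro mult_left_mono) auto
        finally show ?thesis .
      qed
      then show ?thesis unfolding Dr e_def by (simp add: algebra_simps)
    qed
    \<comment> \<open>The point \<open>y\<close> is the mean of the points
      \<open>(?d * (y \<bullet> b)) *\<^sub>R b\<close> on the axes, so Jensen reduces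
      \<open>r y\<close> to axis values. The stretching by the dimension is the reason for the
      factor \<open>?d\<close> in the admissible radius.\<close>
    have key: "r y \<le> norm y * (\<Sum>b\<in>Basis. D b k x)" if y: "norm y * (?d * real (Suc k)) \<le> 1" for y k
    proof -
      have D0: "D b k x \<ge> 0" for b
        using sub[of x "x + (1 / real (Suc k)) *\<^sub>R b"] sub[of x "x - (1 / real (Suc k)) *\<^sub>R b"]
        unfolding D_def by (intro mult_nonneg_nonneg) auto
      have ys: "y = (\<Sum>b\<in>Basis. (1 / ?d) *\<^sub>R ((?d * (y \<bullet> b)) *\<^sub>R b))"
        by (simp add: euclidean_representation)
      have "r y \<le> (\<Sum>b\<in>Basis. (1 / ?d) * r ((?d * (y \<bullet> b)) *\<^sub>R b))"
        by (subst ys, rule convex_on_sum[OF _ _ r_conv]) auto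
      also have "\<dots> \<le> (\<Sum>b\<in>Basis. (1 / ?d) * ((?d * norm y) * D b k x))"
      proof (intro sum_mono mult_left_mono)
        fix b :: 'a assume b: "b \<in> Basis"
        have yb: "\<bar>y \<bullet> b\<bar> \<le> norm y" using Basis_le_norm[OF b] .
        have "\<bar>?d * (y \<bullet> b)\<bar> * real (Suc k) \<le> norm y * (?d * real (Suc k))"
          using mult_right_mono[OF yb, of "?d * real (Suc k)"] by (simp add: abs_mult algebra_simps)
        then have "r ((?d * (y \<bullet> b)) *\<^sub>R b) \<le> \<bar>?d * (y \<bullet> b)\<bar> * D b k x" using y by (intro line) linarith
        also have "\<dots> \<le> (?d * norm y) * D b k x"
          using yb by (intro mult_right_mono D0) (simp add: abs_mult)
        finally show "r ((?d * (y \<bullet> b)) *\<^sub>R b) \<le> (?d * norm y) * D b k x" .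
      qed auto
      finally show ?thesis by (simp add: sum_distrib_left mult.assoc)
    qed
    have "(\<lambda>k. \<Sum>b\<in>Basis. D b k x) \<longlonglongrightarrow> (\<Sum>b\<in>(Basis::'a set). 0)"
      using nz by (intro tendsto_sum) (auto simp: Z_def)
    then have lim: "(\<lambda>k. \<Sum>b\<in>Basis. D b k x) \<longlonglongrightarrow> 0" by simp
    have "(f has_derivative (\<lambda>y. p x \<bullet> y)) (at x)"
      unfolding has_derivative_at_alt
    proof (intro conjI allI impI)
      show "bounded_linear ((\<bullet>) (p x))" by (rule bounded_linear_inner_right)
      fix e :: real assume "e > 0"
      then obtain k where k: "(\<Sum>b\<in>Basis. D b k x) < e"
        using order_tendstoD(2)[OF lim, of e] by (auto simp: eventually_sequentially)
      show "\<exists>d>0. \<forall>y. norm (y - x) < d \<longrightarrow> norm (f y - f x - p x \<bullet> (y - x)) \<le> e * norm (y - x)"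
      proof (intro exI[of _ "1 / (?d * real (Suc k))"] conjI allI impI)
        show "0 < 1 / (?d * real (Suc k))" by (simp add: DIM_positive)
        fix y assume "norm (y - x) < 1 / (?d * real (Suc k))"
        then have "norm (y - x) * (?d * real (Suc k)) \<le> 1"
          using DIM_positive by (simp add: pos_less_divide_eq del: of_nat_Suc) 
        then have "r (y - x) \<le> norm (y - x) * (\<Sum>b\<in>Basis. D b k x)" by (rule key)
        also have "\<dots> \<le> norm (y - x) * e" using k by (intro mult_left_mono) auto
        finally show "norm (f y - f x - p x \<bullet> (y - x)) \<le> e * norm (y - x)"
          using r0[of "y - x"] unfolding r_def by (simp add: mult.commute)
      qed
    qed
    then show ?thesis by (auto simp: differentiable_def)
  qed
  have "AE x in lborel. \<forall>b\<in>Basis. x \<notin> Z b"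
    using Z_null by (subst AE_finite_all) (auto intro: AE_not_in)
  then show ?thesis by eventually_elim (use diff in auto)
qed

lemma borel_measurable_cis [measurable]: "cis \<in> borel_measurable borel"
  by (intro borel_measurable_continuous_onI continuous_intros)

subsection \<open>Lattice and torus\<close>

locale dual_bases =
  fixes a b :: "'d::finite \<Rightarrow> real^'d"
  assumes span_a: "span (range a) = UNIV"
    and dual: "\<And>i j. a i \<bullet> b j = (if i = j then 2 * pi else 0)"
begin

abbreviation "\<tau> \<equiv> theta_b b"
abbreviation "\<Lambda> \<equiv> lattice a"
abbreviation "fr \<equiv> fracpart a"

definition coord :: "real^'d \<Rightarrow> 'd \<Rightarrow> real" where "coord x i = (x \<bullet> b i) / (2 * pi)"

lemma coord_add: "coord (x + y) i = coord x i + coord y i"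
  and coord_diff: "coord (x - y) i = coord x i - coord y i"
  and coord_uminus: "coord (- x) i = - coord x i"
  and coord_zero [simp]: "coord 0 i = 0"
  by (auto simp: coord_def inner_add_left inner_diff_left add_divide_distrib diff_divide_distrib)

lemma coord_sum [simp]: "coord (\<Sum>i\<in>UNIV. x i *\<^sub>R a i) j = x j"
  by (simp add: coord_def inner_sum_left dual if_distrib[of "(*) _"] cong: if_cong)

lemma expand_a: "x = (\<Sum>i\<in>UNIV. coord x i *\<^sub>R a i)"
proof -
  have "x \<in> span (range a)" by (simp add: span_a)
  then show ?thesis
  proof (induction rule: span_induct)
    case base
    show ?case
    proof (intro subspaceI CollectI)
      show "0 = (\<Sum>i\<in>UNIV. coord 0 i *\<^sub>R a i)" by simp
    next
      fix x y assume "x \<in> {x. x = (\<Sum>i\<in>UNIV. coord x i *\<^sub>R a i)}" "y \<in> {x. x = (\<Sum>i\<in>UNIV. coord x i *\<^sub>R a i)}"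
      then show "x + y = (\<Sum>i\<in>UNIV. coord (x + y) i *\<^sub>R a i)"
        by (simp add: coord_add scaleR_left_distrib sum.distrib)
    next
      fix c x assume "x \<in> {x. x = (\<Sum>i\<in>UNIV. coord x i *\<^sub>R a i)}"
      then have "c *\<^sub>R x = c *\<^sub>R (\<Sum>i\<in>UNIV. coord x i *\<^sub>R a i)" by simp
      also have "\<dots> = (\<Sum>i\<in>UNIV. coord (c *\<^sub>R x) i *\<^sub>R a i)"
        by (simp add: coord_def scaleR_right.sum)
      finally show "c *\<^sub>R x = (\<Sum>i\<in>UNIV. coord (c *\<^sub>R x) i *\<^sub>R a i)" .
    qed
  next
    case (step x)
    then obtain j where j: "x = a j" by auto
    have "(\<Sum>i\<in>UNIV. coord (a j) i *\<^sub>R a i) = (\<Sum>i\<in>UNIV. if i = j then a j else 0)"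
      by (intro sum.cong) (auto simp: coord_def dual)
    then show ?case by (simp add: j)
  qed
qed

lemma coord_eqI: "(\<And>i. coord x i = coord y i) \<Longrightarrow> x = y"
  using expand_a[of x] expand_a[of y] by simp

lemma theta_b_add: "\<tau> (x + y) = \<tau> x + \<tau> y"
  and theta_b_diff: "\<tau> (x - y) = \<tau> x - \<tau> y"
  and theta_b_scaleR: "\<tau> (c *\<^sub>R x) = c *\<^sub>R \<tau> x"
  and theta_b_zero [simp]: "\<tau> 0 = 0"
  by (auto simp: theta_b_def scaleR_left_distrib scaleR_left_diff_distrib sum.distrib sum_subtractf scaleR_right.sum)

lemma linear_theta_b: "linear \<tau>"
  by (intro linearI theta_b_add theta_b_scaleR)

lemma theta_b_inner_a: "\<tau> \<theta> \<bullet> a i = 2 * pi * \<theta> $ i"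
proof -
  have "\<tau> \<theta> \<bullet> a i = (\<Sum>j\<in>UNIV. \<theta> $ j * (if i = j then 2 * pi else 0))"
    unfolding theta_b_def inner_sum_left by (intro sum.cong) (auto simp: inner_commute[of _ "a i"] dual)
  also have "\<dots> = (\<Sum>j\<in>UNIV. if i = j then \<theta> $ j * (2 * pi) else 0)" by (intro sum.cong) auto
  finally show ?thesis by simp
qed

lemma theta_b_inner: "\<tau> \<theta> \<bullet> x = (\<Sum>i\<in>UNIV. 2 * pi * \<theta> $ i * coord x i)"
proof -
  have "\<tau> \<theta> \<bullet> x = \<tau> \<theta> \<bullet> (\<Sum>i\<in>UNIV. coord x i *\<^sub>R a i)" using expand_a[of x] by simp
  then show ?thesis by (simp add: inner_sum_right theta_b_inner_a mult.commute)
qed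

text \<open>What remains of \<open>x\<close> after subtracting the candidate is orthogonal to every
  \<open>a i\<close>, hence 0. It turns a phase with arbitrary frequency into a translation of the
  torus variable.\<close>

lemma theta_b_surj: obtains \<theta> where "\<tau> \<theta> = x"
proof -
  define \<theta> where "\<theta> = (\<chi> i. (x \<bullet> a i) / (2 * pi))"
  define y where "y = \<tau> \<theta> - x"
  have "y \<bullet> a i = 0" for i by (simp add: y_def inner_diff_left theta_b_inner_a \<theta>_def)
  then have "y \<bullet> (\<Sum>i\<in>UNIV. coord y i *\<^sub>R a i) = 0" by (simp add: inner_sum_right)
  then have "y = 0" using expand_a[of y] by simp
  then show ?thesis using that[of \<theta>] by (simp add: y_def)
qed

lemma borel_measurable_theta_b [measurable]: "\<tau> \<in> borel_measurable borel"
  by (intro borel_measurable_continuous_onI linear_continuous_on linear_conv_bounded_linear[THEN iffD1] linear_theta_b)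

lemma lattice_iff: "k \<in> \<Lambda> \<longleftrightarrow> (\<forall>i. coord k i \<in> \<int>)"
proof
  assume "\<forall>i. coord k i \<in> \<int>"
  then have "\<forall>i. \<exists>n. coord k i = of_int n" by (auto elim: Ints_cases)
  then obtain n where n: "\<And>i. coord k i = of_int (n i)" by metis
  have "k = (\<Sum>i\<in>UNIV. of_int (n i) *\<^sub>R a i)" using expand_a[of k] by (simp add: n)
  then show "k \<in> \<Lambda>" by (auto simp: lattice_def)
qed (auto simp: lattice_def)

lemma lattice_zero [simp]: "0 \<in> \<Lambda>"
  and lattice_add: "k \<in> \<Lambda> \<Longrightarrow> k' \<in> \<Lambda> \<Longrightarrow> k + k' \<in> \<Lambda>"
  and lattice_diff: "k \<in> \<Lambda> \<Longrightarrow> k' \<in> \<Lambda> \<Longrightarrow> k - k' \<in> \<Lambda>"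
  by (auto simp: lattice_iff coord_add coord_diff coord_uminus)

lemma cell_iff: "w \<in> cell a \<longleftrightarrow> (\<forall>i. 0 \<le> coord w i \<and> coord w i < 1)"
proof
  assume *: "\<forall>i. 0 \<le> coord w i \<and> coord w i < 1"
  show "w \<in> cell a" unfolding cell_def
    by (intro CollectI exI[of _ "coord w"] conjI expand_a *)
qed (auto simp: cell_def)

lemma fracpart_eqI:
  assumes "w \<in> cell a" "u - w \<in> \<Lambda>"
  shows "fr u = w"
  unfolding fracpart_def
proof (rule the_equality)
  fix w' assume w': "w' \<in> cell a \<and> u - w' \<in> \<Lambda>"
  show "w' = w"
  proof (rule coord_eqI)
    fix i
    have "coord (u - w) i - coord (u - w') i \<in> \<int>" using w' assms by (auto simp: lattice_iff)
    then have "coord w' i - coord w i \<in> \<int>" by (simp add: coord_diff)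
    moreover have "\<bar>coord w' i - coord w i\<bar> < 1"
      using w' assms(1) unfolding cell_iff by (smt (verit))
    ultimately show "coord w' i = coord w i" using Ints_nonzero_abs_less1 by force
  qed
qed (use assms in auto)

lemma fracpart_decomp: "fr u \<in> cell a" "u - fr u \<in> \<Lambda>"
proof -
  define w where "w = (\<Sum>i\<in>UNIV. frac (coord u i) *\<^sub>R a i)"
  have w: "w \<in> cell a" "u - w \<in> \<Lambda>"
    by (auto simp: cell_iff lattice_iff w_def coord_diff frac_lt_1) (simp add: frac_def)
  then have "fr u = w" by (rule fracpart_eqI)
  then show "fr u \<in> cell a" "u - fr u \<in> \<Lambda>" using w by auto
qed

lemma fracpart_add_lattice: "k \<in> \<Lambda> \<Longrightarrow> fr (u + k) = fr u"
  using fracpart_decomp[of u] lattice_add[of "u - fr u" k]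
  by (intro fracpart_eqI) (auto simp: algebra_simps)

lemma fracpart_cell: "w \<in> cell a \<Longrightarrow> fr w = w"
  by (intro fracpart_eqI) auto

text \<open>Periodicity of \<open>V\<close>, \<open>adj\<close> and \<open>Q\<close> is given for
  the single generators only; this carries it to all of the lattice.\<close>

lemma lattice_induct [consumes 1]:
  assumes "k \<in> \<Lambda>" and z: "P 0"
    and up: "\<And>k i. P k \<Longrightarrow> P (k + a i)" and down: "\<And>k i. P k \<Longrightarrow> P (k - a i)"
  shows "P k"
proof -
  obtain n where k: "k = (\<Sum>i\<in>UNIV. of_int (n i) *\<^sub>R a i)" using assms(1) by (auto simp: lattice_def)
  have "P (\<Sum>i\<in>S. of_int (n i) *\<^sub>R a i)" if "finite S" for S
    using that
  proof induction
    case (insert j S)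
    have "P ((\<Sum>i\<in>S. of_int (n i) *\<^sub>R a i) + of_int m *\<^sub>R a j)" for m
    proof (induction m rule: int_induct[where k=0])
      case (step1 i)
      then show ?case using up[OF step1(2), of j] by (simp add: algebra_simps)
    next
      case (step2 i)
      then show ?case using down[OF step2(2), of j] by (simp add: algebra_simps)
    qed (use insert in simp)
    then show ?case using insert by (simp add: add.commute)
  qed (use z in simp)
  then show ?thesis unfolding k by simp
qed

end

section \<open>Translation of periodic functions and lattice characters on the unit torus\<close>

abbreviation torus_measure where "torus_measure \<equiv> lebesgue_on (torus :: (real^'d::finite) set)"

lemma torus_borel [measurable]: "(torus :: (real^'d::finite) set) \<in> sets borel"
proof -
  have "(torus :: (real^'d) set) = (\<Inter>i. {\<theta>. 0 \<le> \<theta> $ i} \<inter> {\<theta>. \<theta> $ i < 1})" by (auto simp: torus_def)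
  also have "\<dots> \<in> sets borel"
    by (intro sets.countable_INT'' sets.Int borel_closed borel_open closed_halfspace_component_ge_cart
      open_halfspace_component_lt_cart) auto
  finally show ?thesis .
qed

lemma torus_lebesgue: "(torus :: (real^'d::finite) set) \<in> sets lebesgue"
  using torus_borel by simp

lemma emeasure_torus: "emeasure lborel (torus :: (real^'d::finite) set) = 1"
proof (rule antisym)
  let ?o = "(\<chi> i. 1) :: real^'d"
  have p: "prod ((\<bullet>) ?o) Basis = 1" by (rule prod.neutral) (auto simp: Basis_vec_def inner_axis)
  have n: "\<And>b. b \<in> Basis \<Longrightarrow> 0 \<bullet> b \<le> ?o \<bullet> b" by (auto simp: Basis_vec_def inner_axis)
  have "emeasure lborel (torus :: (real^'d) set) \<le> emeasure lborel (cbox 0 ?o)"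
    by (intro emeasure_mono subsetI) (auto simp: torus_def mem_box_cart order.strict_implies_order)
  then show "emeasure lborel (torus :: (real^'d) set) \<le> 1" by (simp add: emeasure_lborel_cbox[OF n] p)
  have "emeasure lborel (box 0 ?o) \<le> emeasure lborel (torus :: (real^'d) set)"
    by (intro emeasure_mono) (auto simp: torus_def mem_box_cart intro: less_imp_le)
  then show "1 \<le> emeasure lborel (torus :: (real^'d) set)" by (simp add: emeasure_lborel_box[OF n] p)
qed

lemma prob_space_torus: "prob_space (torus_measure :: (real^'d::finite) measure)"
  by (intro prob_spaceI) (simp add: emeasure_restrict_space torus_lebesgue emeasure_torus)

text \<open>The torus carries completed Lebesgue measure, because the Floquet data are only Lebesgue
  measurable, whereas translations and Tonelli are applied on \<open>lborel\<close>.\<close>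

lemma integral_torus:
  fixes F :: "real^'d::finite \<Rightarrow> complex"
  assumes "F \<in> borel_measurable borel"
  shows "integral\<^sup>L torus_measure F = (LINT x|lborel. indicator torus x *\<^sub>R F x)"
proof -
  have "integral\<^sup>L torus_measure F = (LINT x|lebesgue. indicator torus x *\<^sub>R F x)"
    by (rule integral_restrict_space) (simp add: torus_lebesgue)
  also have "\<dots> = (LINT x|lborel. indicator torus x *\<^sub>R F x)"
    by (rule integral_completion) (use assms in measurable)
  finally show ?thesis .
qed

lemma integrable_torus:
  fixes F :: "real^'d::finite \<Rightarrow> complex"
  assumes "F \<in> borel_measurable borel" "\<And>x. cmod (F x) \<le> B" "S \<in> sets borel" "S \<subseteq> torus"
  shows "integrable lborel (\<lambda>x. indicator S x *\<^sub>R F x)"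
proof -
  have "emeasure lborel S \<le> 1" using emeasure_mono[OF assms(4), of lborel] by (simp add: emeasure_torus)
  then have "integrable lborel (\<lambda>x. indicator S x *\<^sub>R B)"
    using assms(3) by (intro integrable_scaleR_left integrable_real_indicator) (auto simp: order_le_less_trans)
  moreover have "cmod (F x) \<le> \<bar>B\<bar>" for x using assms(2)[of x] by linarith
  ultimately show ?thesis using assms(1,3)
    by (elim Bochner_Integration.integrable_bound) (auto simp: indicator_def)
qed

lemma integral_lborel_shift:
  fixes F :: "real^'d::finite \<Rightarrow> complex"
  assumes "F \<in> borel_measurable borel"
  shows "(LINT x|lborel. F (x + c)) = integral\<^sup>L lborel F"
proof -
  have "integral\<^sup>L lborel F = integral\<^sup>L (distr lborel borel ((+) c)) F" by (simp add: lborel_distr_plus)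
  also have "\<dots> = (LINT x|lborel. F (c + x))" by (rule integral_distr) (use assms in auto)
  finally show ?thesis by (simp add: add.commute)
qed

text \<open>The shifted cube consists of the slab \<open>T1\<close> and of the slab
  \<open>T2\<close> moved by one period in direction \<open>i\<close>. Periodicity moves the second
  piece back, and the two slabs make up the cube again.\<close>

lemma integral_torus_shift_periodic:
  fixes F :: "real^'d::finite \<Rightarrow> complex"
  assumes F [measurable]: "F \<in> borel_measurable borel" and bd: "\<And>x. cmod (F x) \<le> B"
    and per: "\<And>x. F (x + axis i 1) = F x" and s: "0 \<le> s" "s \<le> 1"
  shows "(LINT x|torus_measure. F (x + s *\<^sub>R axis i 1)) = integral\<^sup>L torus_measure F"
proof -
  define T1 T2 :: "(real^'d) set" where "T1 = torus \<inter> {x. s \<le> x $ i}" and "T2 = torus \<inter> {x. x $ i < s}"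
  have [measurable]: "T1 \<in> sets borel" "T2 \<in> sets borel" unfolding T1_def T2_def
    by (auto intro!: sets.Int borel_closed borel_open closed_halfspace_component_ge_cart open_halfspace_component_lt_cart)
  have i: "integrable lborel (\<lambda>x. indicator T1 x *\<^sub>R F x)" "integrable lborel (\<lambda>x. indicator T2 x *\<^sub>R F x)"
    using F bd by (auto intro!: integrable_torus simp: T1_def T2_def)
  have i2: "integrable lborel (\<lambda>x. indicator T2 (x - axis i 1) *\<^sub>R F x)"
  proof -
    have "integrable (distr lborel borel ((+) (axis i 1))) (\<lambda>x. indicator T2 (x - axis i 1) *\<^sub>R F x)"
      by (subst integrable_distr_eq) (use i(2) per in \<open>auto simp: add.commute[of "axis i 1"]\<close>)
    then show ?thesis by (simp add: lborel_distr_plus)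
  qed
  have ind: "(indicator torus (x - s *\<^sub>R axis i 1) :: real) = indicator T1 x + indicator T2 (x - axis i 1)" for x :: "real^'d"
  proof -
    have A: "x - s *\<^sub>R axis i 1 \<in> torus \<longleftrightarrow> (\<forall>j. j \<noteq> i
        \<longrightarrow> 0 \<le> x $ j \<and> x $ j < 1) \<and> s \<le> x $ i \<and> x $ i < 1 + s"
      unfolding torus_def by (auto simp: axis_def algebra_simps split: if_splits)
    have B: "x \<in> T1 \<longleftrightarrow> (\<forall>j. j \<noteq> i \<longrightarrow> 0 \<le> x $ j \<and> x $
        j < 1) \<and> s \<le> x $ i \<and> x $ i < 1"
      using s unfolding T1_def torus_def by simp (metis order_trans)
    have C: "x - axis i 1 \<in> T2 \<longleftrightarrow> (\<forall>j. j \<noteq> i \<longrightarrow> 0 \<le> x $ j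
        \<and> x $ j < 1) \<and> 1 \<le> x $ i \<and> x $ i < 1 + s"
      using s unfolding T2_def torus_def by (auto simp: axis_def algebra_simps split: if_splits)
    show ?thesis unfolding indicator_def A B C using s by auto
  qed
  have "(LINT x|torus_measure. F (x + s *\<^sub>R axis i 1)) = (LINT x|lborel. indicator torus x *\<^sub>R F (x + s *\<^sub>R axis i 1))"
    by (rule integral_torus) measurable
  also have "\<dots> = (LINT x|lborel. indicator torus (x - s *\<^sub>R axis i 1) *\<^sub>R F x)"
    by (subst integral_lborel_shift[where c="s *\<^sub>R axis i 1", symmetric]) auto
  also have "\<dots> = (LINT x|lborel. indicator T1 x *\<^sub>R F x + indicator T2 (x - axis i 1) *\<^sub>R F x)"
    by (simp add: ind scaleR_left_distrib)
  also have "\<dots> = (LINT x|lborel. indicator T1 x *\<^sub>R F x) + (LINT x|lborel. indicator T2 (x - axis i 1) *\<^sub>R F x)"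
    by (rule Bochner_Integration.integral_add[OF i(1) i2])
  also have "(LINT x|lborel. indicator T2 (x - axis i 1) *\<^sub>R F x) = (LINT x|lborel. indicator T2 x *\<^sub>R F x)"
    by (subst integral_lborel_shift[where c="axis i 1", symmetric]) (auto simp: per)
  also have "(LINT x|lborel. indicator T1 x *\<^sub>R F x) + (LINT x|lborel. indicator T2 x *\<^sub>R F x)
      = (LINT x|lborel. indicator T1 x *\<^sub>R F x + indicator T2 x *\<^sub>R F x)"
    by (rule Bochner_Integration.integral_add[OF i, symmetric])
  also have "\<dots> = (LINT x|lborel. indicator torus x *\<^sub>R F x)"
    by (intro Bochner_Integration.integral_cong) (auto simp: T1_def T2_def indicator_def)
  also have "\<dots> = integral\<^sup>L torus_measure F" by (rule integral_torus[symmetric]) measurable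
  finally show ?thesis .
qed

context dual_bases
begin

text \<open>Translation by half a wavelength in a coordinate where \<open>k\<close> does not vanish
  flips the sign of the character but preserves its integral.\<close>

lemma integral_character:
  assumes "k \<in> \<Lambda>"
  shows "(LINT \<theta>|torus_measure. cis (\<tau> \<theta> \<bullet> k)) = (if k = 0 then 1 else 0)"
proof (cases "k = 0")
  case True
  interpret prob_space "torus_measure :: (real^'d) measure" by (rule prob_space_torus)
  show ?thesis using prob_space by (simp add: True)
next
  case False
  then obtain i where i: "coord k i \<noteq> 0" using coord_eqI[of k 0] by auto
  define m where "m = coord k i"
  have "m \<in> \<int>" using assms by (auto simp: m_def lattice_iff)
  then have m1: "1 \<le> \<bar>m\<bar>" using i Ints_nonzero_abs_ge1 by (auto simp: m_def)
  define F where "F \<theta> = cis (\<tau> \<theta> \<bullet> k)" for \<theta>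
  have sh: "F (\<theta> + s *\<^sub>R axis i 1) = cis (2 * pi * s * m) * F \<theta>" for \<theta> s
  proof -
    have "\<tau> (s *\<^sub>R axis i 1) \<bullet> k = (\<Sum>j\<in>UNIV. if j = i then 2 * pi * s * m else 0)"
      unfolding theta_b_inner by (intro sum.cong) (auto simp: axis_def m_def)
    then show ?thesis by (simp add: F_def theta_b_add inner_add_left cis_mult add.commute)
  qed
  \<comment> \<open>Half a wavelength in coordinate \<open>i\<close>; it lies in [0, 1] because the
    nonzero integer \<open>m\<close> has modulus at least 1.\<close>
  define s where "s = 1 / (2 * \<bar>m\<bar>)"
  have "(LINT x|torus_measure. F (x + s *\<^sub>R axis i 1)) = integral\<^sup>L torus_measure F"
  proof (rule integral_torus_shift_periodic[where B=1])
    show "F \<in> borel_measurable borel" unfolding F_def by measurable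
    show "cmod (F x) \<le> 1" for x by (simp add: F_def)
    show "F (x + axis i 1) = F x" for x
      using sh[of x 1] \<open>m \<in> \<int>\<close> by (auto elim!: Ints_cases simp: cis_multiple_2pi)
    show "0 \<le> s" "s \<le> 1" using m1 by (auto simp: s_def divide_simps)
  qed
  moreover have "cis (2 * pi * s * m) = -1"
  proof -
    have "2 * pi * s * m = pi * sgn m" using m1 by (auto simp: s_def sgn_if abs_if divide_simps)
    moreover have "sgn m = 1 \<or> sgn m = -1" using m1 by (auto simp: sgn_if)
    ultimately have "2 * pi * s * m = pi \<or> 2 * pi * s * m = - pi"
      by (metis mult.right_neutral mult_minus1_right)
    then show ?thesis by (elim disjE) (simp_all only: cis.code cos_minus sin_minus cos_pi sin_pi, simp_all add: complex_eq_iff)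
  qed
  ultimately have "- integral\<^sup>L torus_measure F = integral\<^sup>L torus_measure F" by (simp add: sh)
  then show ?thesis using False by (simp add: F_def[abs_def])
qed

end

subsection \<open>Square integrable functions\<close>

text \<open>A predicate on functions rather than a space of classes, since the fibres are evaluated
  at individual quasimomenta.\<close>

definition L2 :: "'a measure \<Rightarrow> ('a \<Rightarrow> complex) \<Rightarrow> bool" where
  "L2 M h \<longleftrightarrow> h \<in> borel_measurable M \<and> integrable M (\<lambda>x. (cmod (h x))\<^sup>2)"

definition norm_sq :: "'a measure \<Rightarrow> ('a \<Rightarrow> complex) \<Rightarrow> real" where
  "norm_sq M h = (LINT x|M. (cmod (h x))\<^sup>2)"

lemma L2_measurable: "L2 M h \<Longrightarrow> h \<in> borel_measurable M"
  and L2_integrable_sq: "L2 M h \<Longrightarrow> integrable M (\<lambda>x. (cmod (h x))\<^sup>2)"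
  by (auto simp: L2_def)

lemma norm_sq_nonneg [simp]: "0 \<le> norm_sq M h"
  by (simp add: norm_sq_def)

lemma cmod_add_sq_le: "(cmod (x + y))\<^sup>2 \<le> 2 * (cmod x)\<^sup>2 + 2 * (cmod y)\<^sup>2"
proof -
  have "(cmod (x + y))\<^sup>2 \<le> (cmod x + cmod y)\<^sup>2" by (intro power_mono norm_triangle_ineq) auto
  also have "\<dots> \<le> 2 * (cmod x)\<^sup>2 + 2 * (cmod y)\<^sup>2"
    using sum_squares_bound[of "cmod x" "cmod y"] by (simp add: power2_sum)
  finally show ?thesis .
qed

lemma L2_add:
  assumes "L2 M h" "L2 M k"
  shows "L2 M (\<lambda>x. h x + k x)"
  unfolding L2_def
proof
  show m: "(\<lambda>x. h x + k x) \<in> borel_measurable M" using assms by (auto simp: L2_def)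
  have "integrable M (\<lambda>x. 2 * (cmod (h x))\<^sup>2 + 2 * (cmod (k x))\<^sup>2)" using assms by (auto simp: L2_def)
  then show "integrable M (\<lambda>x. (cmod (h x + k x))\<^sup>2)"
  proof (rule Bochner_Integration.integrable_bound)
    show "(\<lambda>x. (cmod (h x + k x))\<^sup>2) \<in> borel_measurable M" using m by measurable
    show "AE x in M. norm ((cmod (h x + k x))\<^sup>2) \<le> norm (2 * (cmod (h x))\<^sup>2 + 2 * (cmod (k x))\<^sup>2)"
      using cmod_add_sq_le by (auto intro!: AE_I2)
  qed
qed

lemma norm_sq_add_le:
  assumes "L2 M h" "L2 M k"
  shows "norm_sq M (\<lambda>x. h x + k x) \<le> 2 * norm_sq M h + 2 * norm_sq M k"
proof -
  have "norm_sq M (\<lambda>x. h x + k x) \<le> (LINT x|M. 2 * (cmod (h x))\<^sup>2 + 2 * (cmod (k x))\<^sup>2)"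
    unfolding norm_sq_def using assms L2_add[OF assms]
    by (intro integral_mono cmod_add_sq_le) (auto simp: L2_def)
  also have "\<dots> = 2 * norm_sq M h + 2 * norm_sq M k" using assms by (simp add: L2_def norm_sq_def)
  finally show ?thesis .
qed

lemma L2_mult_bounded:
  assumes "L2 M h" "u \<in> borel_measurable M" "\<And>x. cmod (u x) \<le> B"
  shows "L2 M (\<lambda>x. u x * h x)"
  unfolding L2_def
proof
  show m: "(\<lambda>x. u x * h x) \<in> borel_measurable M" using assms by (auto simp: L2_def)
  have "integrable M (\<lambda>x. B\<^sup>2 * (cmod (h x))\<^sup>2)" using assms by (auto simp: L2_def)
  then show "integrable M (\<lambda>x. (cmod (u x * h x))\<^sup>2)"
  proof (rule Bochner_Integration.integrable_bound)
    show "(\<lambda>x. (cmod (u x * h x))\<^sup>2) \<in> borel_measurable M" using m by measurable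
    show "AE x in M. norm ((cmod (u x * h x))\<^sup>2) \<le> norm (B\<^sup>2 * (cmod (h x))\<^sup>2)"
      by (auto intro!: AE_I2 mult_right_mono power_mono assms simp: norm_mult power_mult_distrib)
  qed
qed

lemma L2_cmult: "L2 M h \<Longrightarrow> L2 M (\<lambda>x. c * h x)"
  by (rule L2_mult_bounded[where B="cmod c"]) auto

lemma norm_sq_cmult: "norm_sq M (\<lambda>x. c * h x) = (cmod c)\<^sup>2 * norm_sq M h"
  by (simp add: norm_sq_def norm_mult power_mult_distrib)

lemma L2_diff: "L2 M h \<Longrightarrow> L2 M k \<Longrightarrow> L2 M (\<lambda>x. h x - k x)"
  using L2_add[of M h "\<lambda>x. (-1) * k x"] L2_cmult[of M k "-1"] by simp

lemma L2_zero: "L2 M (\<lambda>_. 0)"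
  by (simp add: L2_def)

lemma L2_sum: "(\<And>i. i \<in> I \<Longrightarrow> L2 M (h i)) \<Longrightarrow> L2 M (\<lambda>x. \<Sum>i\<in>I. h i x)"
  by (induction I rule: infinite_finite_induct) (auto intro: L2_zero L2_add)

lemma L2_bounded:
  assumes "finite_measure M" "h \<in> borel_measurable M" "\<And>x. cmod (h x) \<le> B"
  shows "L2 M h"
  unfolding L2_def using assms
  by (auto intro!: finite_measure.integrable_const_bound[where B="B\<^sup>2"] AE_I2 power_mono)

lemma L2_mult_integrable:
  assumes "L2 M h" "L2 M k"
  shows "integrable M (\<lambda>x. h x * k x)"
proof (rule Bochner_Integration.integrable_bound)
  show "integrable M (\<lambda>x. (cmod (h x))\<^sup>2 + (cmod (k x))\<^sup>2)" using assms by (auto simp: L2_def)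
  show "(\<lambda>x. h x * k x) \<in> borel_measurable M" using assms by (auto simp: L2_def)
  have "cmod x * cmod y \<le> (cmod x)\<^sup>2 + (cmod y)\<^sup>2" for x y
  proof -
    have "0 \<le> cmod x * cmod y" by simp
    then show ?thesis using sum_squares_bound[of "cmod x" "cmod y"] by linarith
  qed
  then show "AE x in M. norm (h x * k x) \<le> norm ((cmod (h x))\<^sup>2 + (cmod (k x))\<^sup>2)"
    by (auto intro!: AE_I2 simp: norm_mult)
qed

lemma borel_measurable_cnj [measurable]: "cnj \<in> borel_measurable borel"
  by (intro borel_measurable_continuous_onI continuous_intros)

lemma L2_cnj: "L2 M h \<Longrightarrow> L2 M (\<lambda>x. cnj (h x))"
  by (auto simp: L2_def intro: measurable_compose[OF _ borel_measurable_cnj])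

lemma L2_integrable:
  assumes "finite_measure M" "L2 M h"
  shows "integrable M h"
  using L2_mult_integrable[OF L2_bounded[OF assms(1), of "\<lambda>_. 1" 1] assms(2)] by simp

text \<open>The limit defining the Floquet transform is stated with nonnegative integrals, which
  presuppose no integrability; this converts a small value into square integrability and a small
  norm.\<close>

lemma norm_sq_of_nn_integral:
  assumes "h \<in> borel_measurable M" "(\<integral>\<^sup>+x. ennreal ((cmod (h x))\<^sup>2) \<partial>M) < ennreal e"
  shows "L2 M h" "norm_sq M h < e"
proof -
  show 1: "L2 M h" unfolding L2_def using assms
    by (auto intro!: integrableI_bounded simp: order_less_trans[OF _ ennreal_less_top])
  have "ennreal (norm_sq M h) < ennreal e"
    using assms(2) nn_integral_eq_integral[OF L2_integrable_sq[OF 1]] by (simp add: norm_sq_def)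
  then show "norm_sq M h < e" by (simp add: ennreal_less_iff)
qed

subsection \<open>Fourier series on the torus\<close>

context dual_bases
begin

abbreviation "mT \<equiv> (torus_measure :: (real^'d) measure)"

lemma finite_mT: "finite_measure mT"
  using prob_space_torus by (rule prob_space.finite_measure)

text \<open>The exponent has the sign of the Floquet transform, so that the coefficients are values
  of the transformed function. Accordingly \<open>fcoeff\<close> pairs with the conjugate
  character.\<close>

definition tpol :: "(real^'d) set \<Rightarrow> (real^'d \<Rightarrow> complex) \<Rightarrow> real^'d \<Rightarrow> complex" where
  "tpol F c \<theta> = (\<Sum>k\<in>F. c k * cis (- (\<tau> \<theta> \<bullet> k)))"

definition fcoeff :: "(real^'d \<Rightarrow> complex) \<Rightarrow> real^'d \<Rightarrow> complex" where
  "fcoeff h k = (LINT \<theta>|mT. cis (\<tau> \<theta> \<bullet> k) * h \<theta>)"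

lemma measurable_mT [measurable]: "(\<lambda>\<theta>. cis (\<tau> \<theta> \<bullet> k)) \<in> borel_measurable mT"
  by (rule measurable_restrict_space1, rule measurable_completion) measurable

lemma L2_cis: "L2 mT h \<Longrightarrow> L2 mT (\<lambda>\<theta>. cis (\<tau> \<theta> \<bullet> k) * h \<theta>)"
  by (rule L2_mult_bounded[where B=1]) auto

lemma L2_tpol: "L2 mT (tpol F c)"
proof -
  have "L2 mT (\<lambda>\<theta>. cis (\<tau> \<theta> \<bullet> (- k)))" for k
    using measurable_mT[of "- k"] by (rule L2_bounded[OF finite_mT, where B=1]) simp
  then have "L2 mT (\<lambda>\<theta>. \<Sum>k\<in>F. c k * cis (\<tau> \<theta> \<bullet> (- k)))" by (intro L2_sum L2_cmult)
  then show ?thesis by (simp add: tpol_def[abs_def])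
qed

lemma fcoeff_add: "L2 mT h \<Longrightarrow> L2 mT h' \<Longrightarrow> fcoeff (\<lambda>\<theta>. h \<theta> + h'
    \<theta>) k = fcoeff h k + fcoeff h' k"
  unfolding fcoeff_def distrib_left
  by (intro Bochner_Integration.integral_add L2_integrable[OF finite_mT] L2_cis)

lemma fcoeff_diff: "L2 mT h \<Longrightarrow> L2 mT h' \<Longrightarrow> fcoeff (\<lambda>\<theta>. h \<theta> -
    h' \<theta>) k = fcoeff h k - fcoeff h' k"
  unfolding fcoeff_def right_diff_distrib
  by (intro Bochner_Integration.integral_diff L2_integrable[OF finite_mT] L2_cis)

lemma fcoeff_cmult: "fcoeff (\<lambda>\<theta>. c * h \<theta>) k = c * fcoeff h k"
  unfolding fcoeff_def by (simp add: mult.left_commute)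

lemma fcoeff_sum: "(\<And>i. i \<in> I \<Longrightarrow> L2 mT (h i)) \<Longrightarrow> fcoeff (\<lambda>\<theta>.
    \<Sum>i\<in>I. h i \<theta>) k = (\<Sum>i\<in>I. fcoeff (h i) k)"
  by (induction I rule: infinite_finite_induct) (auto simp: fcoeff_add L2_sum, auto simp: fcoeff_def)

lemma fcoeff_shift: "fcoeff (\<lambda>\<theta>. cis (\<tau> \<theta> \<bullet> k') * h \<theta>) k = fcoeff h (k + k')"
  by (simp add: fcoeff_def mult.assoc[symmetric] cis_mult inner_add_right)

lemma fcoeff_tpol:
  assumes "finite F" "F \<subseteq> \<Lambda>" "k \<in> \<Lambda>"
  shows "fcoeff (tpol F c) k = (if k \<in> F then c k else 0)"
proof -
  have *: "integrable mT (\<lambda>\<theta>. cis (\<tau> \<theta> \<bullet> k'))" for k'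
    using L2_bounded[OF finite_mT, of "\<lambda>\<theta>. cis (\<tau> \<theta> \<bullet> k')" 1] by (intro L2_integrable[OF finite_mT]) auto
  have "fcoeff (tpol F c) k = (LINT \<theta>|mT. (\<Sum>j\<in>F. c j * cis (\<tau> \<theta> \<bullet> (k - j))))"
    unfolding fcoeff_def tpol_def sum_distrib_left
    by (intro Bochner_Integration.integral_cong refl sum.cong)
      (simp add: mult.left_commute[of _ "c _"] cis_mult inner_diff_right)
  also have "\<dots> = (\<Sum>j\<in>F. c j * (LINT \<theta>|mT. cis (\<tau> \<theta> \<bullet> (k - j))))"
    by (simp add: *)
  also have "\<dots> = (\<Sum>j\<in>F. if j = k then c k else 0)"
    using assms by (intro sum.cong) (auto simp: integral_character lattice_diff subset_iff)
  finally show ?thesis using assms by simp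
qed

lemma integral_cnj_tpol:
  assumes "finite F" "L2 mT h"
  shows "(LINT \<theta>|mT. cnj (tpol F c \<theta>) * h \<theta>) = (\<Sum>k\<in>F. cnj (c k) * fcoeff h k)"
proof -
  have "(LINT \<theta>|mT. cnj (tpol F c \<theta>) * h \<theta>) = (LINT \<theta>|mT. (\<Sum>k\<in>F. cnj (c k) *
      (cis (\<tau> \<theta> \<bullet> k) * h \<theta>)))"
    unfolding tpol_def by (simp add: sum_distrib_right mult.assoc cis_cnj)
  also have "\<dots> = (\<Sum>k\<in>F. cnj (c k) * fcoeff h k)"
    unfolding fcoeff_def using assms by (simp add: L2_integrable[OF finite_mT] L2_cis)
  finally show ?thesis .
qed

text \<open>Expand the square and complete it in \<open>c\<close>. The last sum shows that the
  Fourier coefficients are the best choice on \<open>F\<close>, which yields both Bessel's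
  inequality and, on the closure of the polynomials, Parseval's identity.\<close>

lemma bessel_identity:
  assumes F: "finite F" "F \<subseteq> \<Lambda>" and h: "L2 mT h"
  shows "norm_sq mT (\<lambda>\<theta>. h \<theta> - tpol F c \<theta>) = norm_sq mT h - (\<Sum>k\<in>F. (cmod
      (fcoeff h k))\<^sup>2) + (\<Sum>k\<in>F. (cmod (c k - fcoeff h k))\<^sup>2)"
proof -
  have pp: "norm_sq mT (tpol F c) = (\<Sum>k\<in>F. (cmod (c k))\<^sup>2)"
  proof -
    have "complex_of_real (norm_sq mT (tpol F c)) = (LINT \<theta>|mT. cnj (tpol F c \<theta>) * tpol F c \<theta>)"
      unfolding norm_sq_def by (simp add: complex_norm_square mult.commute flip: integral_complex_of_real del: of_real_power)
    also have "\<dots> = (\<Sum>k\<in>F. cnj (c k) * c k)"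
      unfolding integral_cnj_tpol[OF F(1) L2_tpol] using F by (intro sum.cong refl) (simp add: fcoeff_tpol subsetD)
    also have "\<dots> = complex_of_real (\<Sum>k\<in>F. (cmod (c k))\<^sup>2)" by (simp add: complex_norm_square mult.commute del: of_real_power)
    finally show ?thesis using of_real_eq_iff by blast
  qed
  have sq: "(cmod (x - y))\<^sup>2 = (cmod x)\<^sup>2 + (cmod y)\<^sup>2 - 2 * Re (cnj y * x)" for x y
    by (simp add: cmod_power2 power2_diff algebra_simps)
  have i: "integrable mT (\<lambda>\<theta>. cnj (tpol F c \<theta>) * h \<theta>)"
    by (intro L2_mult_integrable L2_cnj L2_tpol h)
  have "norm_sq mT (\<lambda>\<theta>. h \<theta> - tpol F c \<theta>) = (LINT \<theta>|mT. (cmod (h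
      \<theta>))\<^sup>2 + (cmod (tpol F c \<theta>))\<^sup>2 - 2 * Re (cnj (tpol F c \<theta>) * h \<theta>))"
    unfolding norm_sq_def sq by simp
  also have "\<dots> = norm_sq mT h + norm_sq mT (tpol F c) - 2 * Re (LINT \<theta>|mT. cnj (tpol F c \<theta>) * h \<theta>)"
    unfolding norm_sq_def
    using i L2_integrable_sq[OF h] L2_integrable_sq[OF L2_tpol[of F c]] integrable_Re[OF i]
    by (simp only: Bochner_Integration.integral_add Bochner_Integration.integral_diff
      Bochner_Integration.integrable_add integrable_mult_right integral_mult_right_zero integral_Re)
  also have "\<dots> = norm_sq mT h + (\<Sum>k\<in>F. (cmod (c k))\<^sup>2 - 2 * Re (cnj (c k) * fcoeff h k))"
    unfolding pp integral_cnj_tpol[OF F(1) h] by (simp add: sum_subtractf sum_distrib_left)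
  also have "\<dots> = norm_sq mT h + (\<Sum>k\<in>F. (cmod (c k - fcoeff h k))\<^sup>2 - (cmod (fcoeff h k))\<^sup>2)"
    by (intro arg_cong2[where f="(+)"] refl sum.cong) (simp add: cmod_power2 power2_diff algebra_simps)
  finally show ?thesis by (simp add: sum_subtractf)
qed

lemma bessel:
  assumes "finite F" "F \<subseteq> \<Lambda>" "L2 mT h"
  shows "(\<Sum>k\<in>F. (cmod (fcoeff h k))\<^sup>2) \<le> norm_sq mT h"
  using bessel_identity[OF assms, of "fcoeff h"] norm_sq_nonneg[of mT "\<lambda>\<theta>. h \<theta> - tpol F (fcoeff h) \<theta>"] by simp

lemma fcoeff_bound: "k \<in> \<Lambda> \<Longrightarrow> L2 mT h \<Longrightarrow> (cmod (fcoeff h k))\<^sup>2 \<le> norm_sq mT h"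
  using bessel[of "{k}" h] by simp

lemma fcoeff_tendsto:
  assumes "k \<in> \<Lambda>" "\<And>n. L2 mT (h n)" "L2 mT h'" "(\<lambda>n. norm_sq mT (\<lambda>\<theta>. h n
      \<theta> - h' \<theta>)) \<longlonglongrightarrow> 0"
  shows "(\<lambda>n. fcoeff (h n) k) \<longlonglongrightarrow> fcoeff h' k"
proof -
  have "(\<lambda>n. (cmod (fcoeff (h n) k - fcoeff h' k))\<^sup>2) \<longlonglongrightarrow> 0"
  proof (rule tendsto_sandwich[OF _ _ tendsto_const assms(4)])
    show "\<forall>\<^sub>F n in sequentially. (cmod (fcoeff (h n) k - fcoeff h' k))\<^sup>2 \<le> norm_sq mT
        (\<lambda>\<theta>. h n \<theta> - h' \<theta>)"
      using fcoeff_bound[OF assms(1) L2_diff[OF assms(2,3)]] by (simp add: fcoeff_diff assms)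
  qed simp
  then have "(\<lambda>n. cmod (fcoeff (h n) k - fcoeff h' k)) \<longlonglongrightarrow> 0" using tendsto_real_sqrt by fastforce
  then show ?thesis using Lim_null tendsto_norm_zero_iff by blast
qed

text \<open>Restricting to the closure of the trigonometric polynomials gives Parseval's identity without
  the completeness of the trigonometric system.\<close>

definition trig_approx :: "(real^'d \<Rightarrow> complex) \<Rightarrow> bool" where
  "trig_approx h \<longleftrightarrow> L2 mT h \<and>
     (\<forall>e>0. \<exists>F c. finite F \<and> F \<subseteq> \<Lambda> \<and> norm_sq mT (\<lambda>\<theta>. h \<theta> - tpol F c \<theta>) < e)"

lemma trig_approxE:
  assumes "trig_approx h" "e > 0"
  obtains F c where "finite F" "F \<subseteq> \<Lambda>" "norm_sq mT (\<lambda>\<theta>. h \<theta> - tpol F c \<theta>) < e"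
  using assms unfolding trig_approx_def by blast

lemma trig_approx_L2: "trig_approx h \<Longrightarrow> L2 mT h"
  by (simp add: trig_approx_def)

lemma tpol_add:
  assumes "finite F" "finite F'"
  shows "tpol F c \<theta> + tpol F' c' \<theta> = tpol (F \<union> F') (\<lambda>k. (if k \<in> F then c k else
      0) + (if k \<in> F' then c' k else 0)) \<theta>"
proof -
  have "tpol F c \<theta> = (\<Sum>k\<in>F \<union> F'. (if k \<in> F then c k else 0) * cis (- (\<tau> \<theta> \<bullet> k)))"
    unfolding tpol_def using assms by (intro sum.mono_neutral_cong_left) auto
  moreover have "tpol F' c' \<theta> = (\<Sum>k\<in>F \<union> F'. (if k \<in> F' then c' k else 0) * cis (- (\<tau> \<theta> \<bullet> k)))"
    unfolding tpol_def using assms by (intro sum.mono_neutral_cong_left) auto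
  ultimately show ?thesis by (simp add: tpol_def distrib_right sum.distrib)
qed

lemma trig_approx_add:
  assumes "trig_approx h" "trig_approx h'"
  shows "trig_approx (\<lambda>\<theta>. h \<theta> + h' \<theta>)"
  unfolding trig_approx_def
proof (intro conjI allI impI)
  show "L2 mT (\<lambda>\<theta>. h \<theta> + h' \<theta>)" using assms by (auto intro: L2_add trig_approx_L2)
  fix e :: real assume "e > 0"
  then have e4: "e / 4 > 0" by simp
  obtain F c where F: "finite F" "F \<subseteq> \<Lambda>" "norm_sq mT (\<lambda>\<theta>. h \<theta> - tpol F c \<theta>) < e/4"
    using trig_approxE[OF assms(1) e4] .
  obtain F' c' where F': "finite F'" "F' \<subseteq> \<Lambda>" "norm_sq mT (\<lambda>\<theta>. h' \<theta> - tpol F' c' \<theta>) < e/4"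
    using trig_approxE[OF assms(2) e4] .
  have "norm_sq mT (\<lambda>\<theta>. (h \<theta> - tpol F c \<theta>) + (h' \<theta> - tpol F' c' \<theta>)) \<le>
     2 * norm_sq mT (\<lambda>\<theta>. h \<theta> - tpol F c \<theta>) + 2 * norm_sq mT (\<lambda>\<theta>. h' \<theta> - tpol F' c' \<theta>)"
    using assms by (intro norm_sq_add_le L2_diff L2_tpol trig_approx_L2)
  also have "\<dots> < e" using F(3) F'(3) by simp
  also have "(\<lambda>\<theta>. (h \<theta> - tpol F c \<theta>) + (h' \<theta> - tpol F' c' \<theta>)) =
      (\<lambda>\<theta>. h \<theta> + h' \<theta> - (tpol F c \<theta> + tpol F' c' \<theta>))"
    by (simp add: algebra_simps)
  finally show "\<exists>F c. finite F \<and> F \<subseteq> \<Lambda> \<and> norm_sq mT (\<lambda>\<theta>. h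
      \<theta> + h' \<theta> - tpol F c \<theta>) < e"
    unfolding tpol_add[OF F(1) F'(1)] using F(1,2) F'(1,2)
    by (intro exI[of _ "F \<union> F'"] exI conjI) (simp, simp, assumption)
qed

lemma trig_approx_cmult:
  assumes "trig_approx h"
  shows "trig_approx (\<lambda>\<theta>. z * h \<theta>)"
  unfolding trig_approx_def
proof (intro conjI allI impI)
  show "L2 mT (\<lambda>\<theta>. z * h \<theta>)" using assms by (auto intro: L2_cmult trig_approx_L2)
  fix e :: real assume "e > 0"
  then have "e / ((cmod z)\<^sup>2 + 1) > 0" by (simp add: add_nonneg_pos)
  then obtain F c where F: "finite F" "F \<subseteq> \<Lambda>" "norm_sq mT (\<lambda>\<theta>. h \<theta> - tpol
      F c \<theta>) < e / ((cmod z)\<^sup>2 + 1)"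
    using trig_approxE[OF assms] by blast
  have "norm_sq mT (\<lambda>\<theta>. z * h \<theta> - tpol F (\<lambda>k. z * c k) \<theta>) = norm_sq mT
      (\<lambda>\<theta>. z * (h \<theta> - tpol F c \<theta>))"
    by (simp add: tpol_def sum_distrib_left right_diff_distrib mult.assoc)
  also have "\<dots> = (cmod z)\<^sup>2 * norm_sq mT (\<lambda>\<theta>. h \<theta> - tpol F c \<theta>)" by (rule norm_sq_cmult)
  also have "\<dots> \<le> ((cmod z)\<^sup>2 + 1) * norm_sq mT (\<lambda>\<theta>. h \<theta> - tpol F c \<theta>)" by (simp add: algebra_simps)
  also have "\<dots> < e" using F(3) by (simp add: pos_less_divide_eq add_nonneg_pos mult.commute)
  finally show "\<exists>F c. finite F \<and> F \<subseteq> \<Lambda> \<and> norm_sq mT (\<lambda>\<theta>. z * h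
      \<theta> - tpol F c \<theta>) < e" using F by blast
qed

lemma trig_approx_shift:
  assumes "trig_approx h" "k \<in> \<Lambda>"
  shows "trig_approx (\<lambda>\<theta>. cis (\<tau> \<theta> \<bullet> k) * h \<theta>)"
  unfolding trig_approx_def
proof (intro conjI allI impI)
  show "L2 mT (\<lambda>\<theta>. cis (\<tau> \<theta> \<bullet> k) * h \<theta>)" using assms by (auto intro: L2_cis trig_approx_L2)
  fix e :: real assume "e > 0"
  then obtain F c where F: "finite F" "F \<subseteq> \<Lambda>" "norm_sq mT (\<lambda>\<theta>. h \<theta> - tpol F c \<theta>) < e"
    using trig_approxE[OF assms(1)] by blast
  have p: "tpol ((\<lambda>j. j - k) ` F) (\<lambda>j. c (j + k)) \<theta> = cis (\<tau> \<theta> \<bullet> k) * tpol F c \<theta>" for \<theta>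
    unfolding tpol_def sum_distrib_left
    by (subst sum.reindex) (auto simp: inj_on_def inner_diff_right mult.left_commute cis_mult intro!: sum.cong)
  have "norm_sq mT (\<lambda>\<theta>. cis (\<tau> \<theta> \<bullet> k) * h \<theta> - cis (\<tau> \<theta>
      \<bullet> k) * tpol F c \<theta>) = norm_sq mT (\<lambda>\<theta>. h \<theta> - tpol F c \<theta>)"
    unfolding norm_sq_def by (simp add: norm_mult flip: right_diff_distrib)
  then have "norm_sq mT (\<lambda>\<theta>. cis (\<tau> \<theta> \<bullet> k) * h \<theta> - tpol ((\<lambda>j. j
      - k) ` F) (\<lambda>j. c (j + k)) \<theta>) < e"
    using F(3) by (simp add: p)
  moreover have "finite ((\<lambda>j. j - k) ` F)" "(\<lambda>j. j - k) ` F \<subseteq> \<Lambda>" using F assms(2) by (auto intro: lattice_diff)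
  ultimately show "\<exists>F c. finite F \<and> F \<subseteq> \<Lambda> \<and> norm_sq mT (\<lambda>\<theta>. cis
      (\<tau> \<theta> \<bullet> k) * h \<theta> - tpol F c \<theta>) < e" by blast
qed

lemma trig_approx_zero: "trig_approx (\<lambda>_. 0)"
  unfolding trig_approx_def by (auto simp: L2_zero norm_sq_def tpol_def intro!: exI[of _ "{}"])

lemma trig_approx_sum: "(\<And>i. i \<in> I \<Longrightarrow> trig_approx (h i)) \<Longrightarrow> trig_approx
    (\<lambda>\<theta>. \<Sum>i\<in>I. h i \<theta>)"
  by (induction I rule: infinite_finite_induct) (auto intro: trig_approx_zero trig_approx_add)

lemma trig_approx_limit:
  assumes "L2 mT h" and appr: "\<And>n::nat. trig_approx (hn n)" and lim: "(\<lambda>n. norm_sq mT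
      (\<lambda>\<theta>. hn n \<theta> - h \<theta>)) \<longlonglongrightarrow> 0"
  shows "trig_approx h"
  unfolding trig_approx_def
proof (intro conjI allI impI assms(1))
  fix e :: real assume "e > 0"
  then have e4: "e / 4 > 0" by simp
  then obtain n where n: "norm_sq mT (\<lambda>\<theta>. hn n \<theta> - h \<theta>) < e/4"
    using order_tendstoD(2)[OF lim e4] by (auto simp: eventually_sequentially)
  obtain F c where F: "finite F" "F \<subseteq> \<Lambda>" "norm_sq mT (\<lambda>\<theta>. hn n \<theta> - tpol F c \<theta>) < e/4"
    using trig_approxE[OF appr e4] .
  have "norm_sq mT (\<lambda>\<theta>. (-1) * (hn n \<theta> - h \<theta>) + (hn n \<theta> - tpol F c \<theta>))
     \<le> 2 * norm_sq mT (\<lambda>\<theta>. (-1) * (hn n \<theta> - h \<theta>)) + 2 * norm_sq mT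
         (\<lambda>\<theta>. hn n \<theta> - tpol F c \<theta>)"
    by (intro norm_sq_add_le L2_cmult L2_diff L2_tpol assms(1) trig_approx_L2[OF appr])
  also have "norm_sq mT (\<lambda>\<theta>. (-1) * (hn n \<theta> - h \<theta>)) = norm_sq mT (\<lambda>\<theta>.
      hn n \<theta> - h \<theta>)" by (subst norm_sq_cmult) simp
  finally have "norm_sq mT (\<lambda>\<theta>. h \<theta> - tpol F c \<theta>) < e" using n F(3) by simp
  then show "\<exists>F c. finite F \<and> F \<subseteq> \<Lambda> \<and> norm_sq mT (\<lambda>\<theta>. h
      \<theta> - tpol F c \<theta>) < e" using F by blast
qed

text \<open>Any polynomial on \<open>F\<close> within \<open>e\<close> of \<open>h\<close> can be
  replaced by the one with the Fourier coefficients, whose error is the norm minus the partial sum.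
  Larger index sets only improve it, up to Bessel's bound.\<close>

lemma parseval_norm:
  assumes "trig_approx h"
  shows "((\<lambda>k. (cmod (fcoeff h k))\<^sup>2) has_sum norm_sq mT h) \<Lambda>"
  unfolding has_sum_def tendsto_iff
proof (intro allI impI)
  fix e :: real assume "e > 0"
  then obtain F c where F: "finite F" "F \<subseteq> \<Lambda>" "norm_sq mT (\<lambda>\<theta>. h \<theta> - tpol F c \<theta>) < e"
    using trig_approxE[OF assms] by blast
  have hL: "L2 mT h" using assms by (rule trig_approx_L2)
  have "norm_sq mT h - (\<Sum>k\<in>F. (cmod (fcoeff h k))\<^sup>2) < e"
    using F(3) bessel_identity[OF F(1,2) hL, of c] sum_nonneg[of F "\<lambda>k. (cmod (c k - fcoeff h k))\<^sup>2"] by simp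
  then show "\<forall>\<^sub>F F in finite_subsets_at_top \<Lambda>. dist (\<Sum>k\<in>F. (cmod (fcoeff h k))\<^sup>2) (norm_sq mT h) < e"
    unfolding eventually_finite_subsets_at_top
  proof (intro exI[of _ F] conjI F allI impI)
    fix F' assume F': "finite F' \<and> F \<subseteq> F' \<and> F' \<subseteq> \<Lambda>"
    have "(\<Sum>k\<in>F. (cmod (fcoeff h k))\<^sup>2) \<le> (\<Sum>k\<in>F'. (cmod (fcoeff h k))\<^sup>2)" using F' by (intro sum_mono2) auto
    moreover have "(\<Sum>k\<in>F'. (cmod (fcoeff h k))\<^sup>2) \<le> norm_sq mT h" using F' hL by (intro bessel) auto
    ultimately show "dist (\<Sum>k\<in>F'. (cmod (fcoeff h k))\<^sup>2) (norm_sq mT h) < e"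
      using \<open>norm_sq mT h - (\<Sum>k\<in>F. (cmod (fcoeff h k))\<^sup>2) < e\<close> by (simp add: dist_real_def)
  qed
qed

text \<open>The signs are written as factors so that all four terms have the form
  \<open>x + z * y\<close> with a fourth root of unity \<open>z\<close>.\<close>

lemma polarization:
  "cnj x * y = (1/4) * (complex_of_real ((cmod (x + y))\<^sup>2) + (-1) * complex_of_real ((cmod (x + (-1) * y))\<^sup>2)
     + (-\<i>) * complex_of_real ((cmod (x + \<i> * y))\<^sup>2) + \<i> * complex_of_real ((cmod (x + (-\<i>) * y))\<^sup>2))"
  unfolding cmod_power2 by (auto simp: complex_eq_iff power2_eq_square algebra_simps)

text \<open>The closure of the trigonometric polynomials is a linear space, so the norm identity
  holds for \<open>h + z * h'\<close> and can be polarised.\<close>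

lemma parseval:
  assumes h: "trig_approx h" "trig_approx h'"
  shows "((\<lambda>k. cnj (fcoeff h k) * fcoeff h' k) has_sum (LINT \<theta>|mT. cnj (h \<theta>) * h' \<theta>)) \<Lambda>"
proof -
  have L: "L2 mT h" "L2 mT h'" using h by (auto intro: trig_approx_L2)
  define u where "u z \<theta> = h \<theta> + z * h' \<theta>" for z \<theta>
  have u: "trig_approx (u z)" for z unfolding u_def using h by (intro trig_approx_add trig_approx_cmult)
  have fu: "fcoeff (u z) k = fcoeff h k + z * fcoeff h' k" for z k
    unfolding u_def using L by (simp add: fcoeff_add fcoeff_cmult L2_cmult)
  have iu: "integrable mT (\<lambda>\<theta>. complex_of_real ((cmod (u z \<theta>))\<^sup>2))" for z
    using L2_integrable_sq[OF trig_approx_L2[OF u]] by (rule integrable_of_real)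
  have U: "((\<lambda>k. complex_of_real ((cmod (fcoeff h k + z * fcoeff h' k))\<^sup>2)) has_sum (LINT
      \<theta>|mT. complex_of_real ((cmod (u z \<theta>))\<^sup>2))) \<Lambda>" for z
    using has_sum_of_real[OF parseval_norm[OF u[of z]]] by (simp only: fu norm_sq_def integral_complex_of_real)
  have "(LINT \<theta>|mT. cnj (h \<theta>) * h' \<theta>) = (LINT \<theta>|mT. (1/4) * (complex_of_real ((cmod (u
      1 \<theta>))\<^sup>2) + (-1) * complex_of_real ((cmod (u (-1) \<theta>))\<^sup>2)
     + (-\<i>) * complex_of_real ((cmod (u \<i> \<theta>))\<^sup>2) + \<i> * complex_of_real ((cmod (u (-\<i>) \<theta>))\<^sup>2)))"
    unfolding polarization u_def by simp
  also have "\<dots> = (1/4) * ((LINT \<theta>|mT. complex_of_real ((cmod (u 1 \<theta>))\<^sup>2)) + (-1) * (LINT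
      \<theta>|mT. complex_of_real ((cmod (u (-1) \<theta>))\<^sup>2))
     + (-\<i>) * (LINT \<theta>|mT. complex_of_real ((cmod (u \<i> \<theta>))\<^sup>2)) + \<i> * (LINT
         \<theta>|mT. complex_of_real ((cmod (u (-\<i>) \<theta>))\<^sup>2)))"
    by (simp only: iu Bochner_Integration.integral_add Bochner_Integration.integrable_add integrable_mult_right integral_mult_right_zero)
  finally have I: "(LINT \<theta>|mT. cnj (h \<theta>) * h' \<theta>) = \<dots>" .
  show ?thesis unfolding I
    unfolding polarization using U[of 1] by (intro has_sum_cmult_right has_sum_add U) simp
qed

text \<open>If the coefficient at \<open>k\<close> differed from \<open>c k\<close>, then by
  Bessel's inequality every partial sum whose index set contains \<open>k\<close> would stay at
  least that far from \<open>h\<close>.\<close>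

lemma trig_approx_of_lattice_sums:
  assumes m: "h \<in> borel_measurable mT"
    and lim: "((\<lambda>F. \<integral>\<^sup>+\<theta>. ennreal ((cmod (h \<theta> - tpol F c \<theta>))\<^sup>2)
        \<partial>mT) \<longlongrightarrow> 0) (finite_subsets_at_top \<Lambda>)"
  shows "trig_approx h" and "k \<in> \<Lambda> \<Longrightarrow> fcoeff h k = c k"
proof -
  have pm: "tpol F c \<in> borel_measurable mT" for F using L2_tpol by (rule L2_measurable)
  \<comment> \<open>The set \<open>K\<close> forces a prescribed index into \<open>F\<close>; for an
    index outside \<open>F\<close> the coefficient of \<open>tpol F c\<close> would be 0 instead of
    \<open>c k\<close>.\<close>
  have ex: "\<exists>F. finite F \<and> F \<subseteq> \<Lambda> \<and> K \<subseteq> F \<and> L2 mT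
      (\<lambda>\<theta>. h \<theta> - tpol F c \<theta>) \<and> norm_sq mT (\<lambda>\<theta>. h \<theta> - tpol F c \<theta>) < e"
    if "e > 0" "finite K" "K \<subseteq> \<Lambda>" for e K
  proof -
    have "\<forall>\<^sub>F F in finite_subsets_at_top \<Lambda>. (\<integral>\<^sup>+\<theta>. ennreal ((cmod (h
        \<theta> - tpol F c \<theta>))\<^sup>2) \<partial>mT) < ennreal e"
      using order_tendstoD(2)[OF lim, of "ennreal e"] \<open>e > 0\<close> by simp
    moreover have "\<forall>\<^sub>F F in finite_subsets_at_top \<Lambda>. finite F \<and> K \<subseteq> F \<and> F \<subseteq> \<Lambda>"
      unfolding eventually_finite_subsets_at_top using that by (intro exI[of _ K]) simp
    ultimately obtain F where F: "(\<integral>\<^sup>+\<theta>. ennreal ((cmod (h \<theta> - tpol F c \<theta>))\<^sup>2) \<partial>mT) < ennreal e"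
      "finite F" "K \<subseteq> F" "F \<subseteq> \<Lambda>"
      using eventually_happens'[OF finite_subsets_at_top_neq_bot eventually_conj] by (metis (no_types, lifting))
    have "(\<lambda>\<theta>. h \<theta> - tpol F c \<theta>) \<in> borel_measurable mT" using m pm by (rule borel_measurable_diff)
    from norm_sq_of_nn_integral[OF this F(1)] F show ?thesis by blast
  qed
  have hL: "L2 mT h"
  proof -
    obtain F where "L2 mT (\<lambda>\<theta>. h \<theta> - tpol F c \<theta>)" using ex[of 1 "{}"] by auto
    from L2_add[OF this L2_tpol[of F c]] show ?thesis by simp
  qed
  show ta: "trig_approx h" unfolding trig_approx_def
  proof (intro conjI allI impI hL)
    fix e :: real assume "e > 0"
    from ex[OF this, of "{}"] obtain F where "finite F" "F \<subseteq> \<Lambda>" "norm_sq mT (\<lambda>\<theta>.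
        h \<theta> - tpol F c \<theta>) < e" by auto
    then show "\<exists>F c. finite F \<and> F \<subseteq> \<Lambda> \<and> norm_sq mT (\<lambda>\<theta>. h
        \<theta> - tpol F c \<theta>) < e" by blast
  qed
  assume k: "k \<in> \<Lambda>"
  show "fcoeff h k = c k"
  proof (rule ccontr)
    assume "fcoeff h k \<noteq> c k"
    then have "(cmod (fcoeff h k - c k))\<^sup>2 > 0" by simp
    from ex[OF this, of "{k}"] k obtain F where F: "finite F" "F \<subseteq> \<Lambda>" "k \<in> F"
      "norm_sq mT (\<lambda>\<theta>. h \<theta> - tpol F c \<theta>) < (cmod (fcoeff h k - c k))\<^sup>2" by auto
    have "(cmod (fcoeff (\<lambda>\<theta>. h \<theta> - tpol F c \<theta>) k))\<^sup>2 \<le> norm_sq mT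
        (\<lambda>\<theta>. h \<theta> - tpol F c \<theta>)"
      by (intro fcoeff_bound k L2_diff hL L2_tpol)
    then show False using F k by (simp add: fcoeff_diff hL L2_tpol fcoeff_tpol)
  qed
qed

end

subsection \<open>Finite-dimensional spectral calculus\<close>

text \<open>Termwise domination of the complex tail by the real one. The bound depends on
  \<open>r\<close> alone, hence serves all eigenvalues of all fibres at once.\<close>

lemma exp_partial_sum_error:
  fixes z :: complex
  assumes "cmod z \<le> r"
  shows "cmod (exp z - (\<Sum>j<N. z ^ j / of_nat (fact j))) \<le> exp r - (\<Sum>j<N. r ^ j / fact j)"
proof -
  have sz: "(\<lambda>j. z ^ j / of_nat (fact j)) sums exp z"
    using exp_converges[of z] by (simp add: scaleR_conv_of_real field_simps)
  have sr: "(\<lambda>j. r ^ j / fact j) sums exp r"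
    using exp_converges[of r] by (simp add: field_simps)
  have tz: "exp z - (\<Sum>j<N. z ^ j / of_nat (fact j)) = (\<Sum>j. z ^ (j + N) / of_nat (fact (j + N)))"
    using suminf_minus_initial_segment[OF sums_summable[OF sz], of N] sums_unique[OF sz] by simp
  have tr: "exp r - (\<Sum>j<N. r ^ j / fact j) = (\<Sum>j. r ^ (j + N) / fact (j + N))"
    using suminf_minus_initial_segment[OF sums_summable[OF sr], of N] sums_unique[OF sr] by simp
  have le: "cmod (z ^ (j + N) / of_nat (fact (j + N))) \<le> r ^ (j + N) / fact (j + N)" for j
    using power_mono[OF assms, of "j + N"] by (simp add: norm_divide norm_power divide_right_mono)
  have sm: "summable (\<lambda>j. r ^ (j + N) / fact (j + N))"
    using summable_ignore_initial_segment[OF sums_summable[OF sr]] .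
  show ?thesis unfolding tz tr by (rule norm_suminf_le[OF le sm])
qed

definition ip :: "'v set \<Rightarrow> ('v \<Rightarrow> complex) \<Rightarrow> ('v \<Rightarrow> complex) \<Rightarrow> complex" where
  "ip X x y = (\<Sum>v\<in>X. cnj (x v) * y v)"

lemma ip_cnj: "cnj (ip X x y) = ip X y x"
  by (simp add: ip_def mult.commute)

lemma ip_self: "ip X x x = complex_of_real (\<Sum>v\<in>X. (cmod (x v))\<^sup>2)"
  by (simp add: ip_def complex_norm_square mult.commute del: of_real_power)

lemma ip_bound: "cmod (ip X x y) \<le> ((\<Sum>v\<in>X. (cmod (x v))\<^sup>2) + (\<Sum>v\<in>X. (cmod (y v))\<^sup>2)) / 2"
proof -
  have "cmod (ip X x y) \<le> (\<Sum>v\<in>X. cmod (x v) * cmod (y v))"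
    unfolding ip_def by (intro order_trans[OF norm_sum] sum_mono) (simp add: norm_mult)
  also have "\<dots> \<le> (\<Sum>v\<in>X. ((cmod (x v))\<^sup>2 + (cmod (y v))\<^sup>2) / 2)"
  proof (rule sum_mono)
    show "cmod (x v) * cmod (y v) \<le> ((cmod (x v))\<^sup>2 + (cmod (y v))\<^sup>2) / 2" for v
      using sum_squares_bound[of "cmod (x v)" "cmod (y v)"] by simp
  qed
  finally show ?thesis by (simp add: sum.distrib flip: sum_divide_distrib)
qed

lemma ip_cauchy_schwarz:
  "cmod (ip X x y) \<le> sqrt (\<Sum>v\<in>X. (cmod (x v))\<^sup>2) * sqrt (\<Sum>v\<in>X. (cmod (y v))\<^sup>2)"
proof -
  have "cmod (ip X x y) \<le> (\<Sum>v\<in>X. \<bar>cmod (x v)\<bar> * \<bar>cmod (y v)\<bar>)"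
    unfolding ip_def by (intro order_trans[OF norm_sum] sum_mono) (simp add: norm_mult)
  also have "\<dots> \<le> L2_set (\<lambda>v. cmod (x v)) X * L2_set (\<lambda>v. cmod (y v)) X" by (rule L2_set_mult_ineq)
  finally show ?thesis by (simp add: L2_set_def)
qed

locale orthonormal_basis =
  fixes X :: "'v set" and \<phi> :: "nat \<Rightarrow> 'v \<Rightarrow> complex"
  assumes fin: "finite X"
    and orth: "n < card X \<Longrightarrow> m < card X \<Longrightarrow> ip X (\<phi> n) (\<phi> m) = (if n = m then 1 else 0)"
begin

lemma norm_phi: "n < card X \<Longrightarrow> (\<Sum>v\<in>X. (cmod (\<phi> n v))\<^sup>2) = 1"
  using orth[of n n] unfolding ip_self by (metis of_real_eq_1_iff)

lemma phi_le_1: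
  assumes "n < card X" "v \<in> X"
  shows "cmod (\<phi> n v) \<le> 1"
proof -
  have "(cmod (\<phi> n v))\<^sup>2 \<le> 1"
    using member_le_sum[OF assms(2), of "\<lambda>v. (cmod (\<phi> n v))\<^sup>2"] fin norm_phi[OF assms(1)] by simp
  then show ?thesis by (simp add: abs_square_le_1)
qed

text \<open>The residuals of the delta functions have nonnegative squared norms, which sum to
  the number of points minus the number of vectors, that is, to 0.\<close>

lemma complete:
  assumes "v \<in> X" "w \<in> X"
  shows "(\<Sum>n<card X. cnj (\<phi> n v) * \<phi> n w) = (if v = w then 1 else 0)"
proof -
  define r where "r v w = (if v = w then 1 else 0) - (\<Sum>n<card X. cnj (\<phi> n v) * \<phi> n w)" for v w
  \<comment> \<open>\<open>?s\<close> is the projection of the delta at \<open>v\<close> onto the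
    span of the \<open>\<phi> n\<close>. By orthonormality its squared norm is its own value at
    \<open>v\<close>, which leaves 1 minus that value for the residual.\<close>
  have rr: "(\<Sum>w\<in>X. (cmod (r v w))\<^sup>2) = 1 - (\<Sum>n<card X. (cmod (\<phi> n v))\<^sup>2)" if v: "v \<in> X" for v
  proof -
    let ?d = "\<lambda>w. if v = w then 1 else 0 :: complex"
    let ?s = "\<lambda>w. \<Sum>n<card X. cnj (\<phi> n v) * \<phi> n w"
    have d: "(\<Sum>w\<in>X. ?d w * f w) = f v" for f
    proof -
      have "(\<Sum>w\<in>X. ?d w * f w) = (\<Sum>w\<in>X. if v = w then f v else 0)" by (intro sum.cong) auto
      then show ?thesis using fin v by simp
    qed
    have 1: "(\<Sum>w\<in>X. ?d w * ?d w) = ?d v" "(\<Sum>w\<in>X. ?d w * ?s w) = ?s v" "(\<Sum>w\<in>X. ?d w * cnj (?s w)) = cnj (?s v)"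
      by (rule d)+
    have "(\<Sum>w\<in>X. cnj (?s w) * ?s w) = (\<Sum>w\<in>X. \<Sum>n<card X. \<Sum>m<card X. \<phi> n v * cnj
        (\<phi> m v) * (cnj (\<phi> n w) * \<phi> m w))"
      unfolding cnj_sum sum_product by (intro sum.cong refl) (simp add: mult_ac)
    also have "\<dots> = (\<Sum>n<card X. \<Sum>w\<in>X. \<Sum>m<card X. \<phi> n v * cnj (\<phi> m v) * (cnj (\<phi> n w) * \<phi> m w))"
      by (rule sum.swap)
    also have "\<dots> = (\<Sum>n<card X. \<Sum>m<card X. \<Sum>w\<in>X. \<phi> n v * cnj (\<phi> m v) * (cnj (\<phi> n w) * \<phi> m w))"
      by (intro sum.cong refl sum.swap)
    also have "\<dots> = (\<Sum>n<card X. \<Sum>m<card X. \<phi> n v * cnj (\<phi> m v) * ip X (\<phi> n) (\<phi> m))"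
      by (simp add: ip_def sum_distrib_left)
    also have "\<dots> = (\<Sum>n<card X. \<Sum>m<card X. if m = n then \<phi> n v * cnj (\<phi> n v) else 0)"
      by (intro sum.cong refl) (auto simp: orth)
    also have "\<dots> = ?s v" by (simp add: mult.commute)
    finally have 2: "(\<Sum>w\<in>X. cnj (?s w) * ?s w) = ?s v" .
    have 3: "cnj (?s v) = ?s v" by (simp add: cnj_sum mult.commute)
    have "complex_of_real (\<Sum>w\<in>X. (cmod (r v w))\<^sup>2) = (\<Sum>w\<in>X. cnj (r v w) * r v w)"
      by (simp add: complex_norm_square mult.commute del: of_real_power)
    also have "\<dots> = (\<Sum>w\<in>X. ?d w * ?d w - ?d w * ?s w - ?d w * cnj (?s w) + cnj (?s w) * ?s w)"
      unfolding r_def by (intro sum.cong refl) (simp add: algebra_simps)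
    also have "\<dots> = 1 - ?s v" by (simp only: sum.distrib sum_subtractf 1 2 3 refl if_True) simp
    also have "?s v = complex_of_real (\<Sum>n<card X. (cmod (\<phi> n v))\<^sup>2)"
      by (simp add: complex_norm_square mult.commute del: of_real_power)
    finally show ?thesis by (metis of_real_1 of_real_diff of_real_eq_iff)
  qed
  have nn: "0 \<le> 1 - (\<Sum>n<card X. (cmod (\<phi> n v))\<^sup>2)" if "v \<in> X" for v
    using rr[OF that] sum_nonneg[of X "\<lambda>w. (cmod (r v w))\<^sup>2"] by simp
  have "(\<Sum>v\<in>X. 1 - (\<Sum>n<card X. (cmod (\<phi> n v))\<^sup>2)) = real (card X) - (\<Sum>n<card X.
      \<Sum>v\<in>X. (cmod (\<phi> n v))\<^sup>2)"
    by (simp add: sum_subtractf sum.swap[of _ X])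
  also have "\<dots> = 0" by (simp add: norm_phi)
  finally have "\<forall>v\<in>X. 1 - (\<Sum>n<card X. (cmod (\<phi> n v))\<^sup>2) = 0"
    by (simp only: sum_nonneg_eq_0_iff[OF fin nn])
  then have "(\<Sum>w\<in>X. (cmod (r v w))\<^sup>2) = 0" using rr assms(1) by simp
  then have "r v w = 0" using assms(2) fin by (simp add: sum_nonneg_eq_0_iff)
  then show ?thesis by (simp add: r_def)
qed

lemma expand:
  assumes "v \<in> X"
  shows "x v = (\<Sum>n<card X. ip X (\<phi> n) x * \<phi> n v)"
proof -
  have "(\<Sum>n<card X. ip X (\<phi> n) x * \<phi> n v) = (\<Sum>n<card X. \<Sum>w\<in>X. x w * (cnj (\<phi> n w) * \<phi> n v))"
    by (simp add: ip_def sum_distrib_right sum_distrib_left mult_ac)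
  also have "\<dots> = (\<Sum>w\<in>X. x w * (\<Sum>n<card X. cnj (\<phi> n w) * \<phi> n v))"
    by (subst sum.swap) (simp add: sum_distrib_left)
  also have "\<dots> = (\<Sum>w\<in>X. if w = v then x v else 0)"
    by (intro sum.cong refl) (simp add: complete assms)
  finally show ?thesis using fin assms by simp
qed

lemma ip_sum_right: "ip X y (\<lambda>v. \<Sum>n<card X. c n * \<phi> n v) = (\<Sum>n<card X. c n * ip X y (\<phi> n))"
  unfolding ip_def by (simp add: sum_distrib_left mult_ac sum.swap[of _ X])

lemma ip_phi_sum: "n < card X \<Longrightarrow> ip X (\<phi> n) (\<lambda>v. \<Sum>m<card X. c m * \<phi> m v) = c n"
  unfolding ip_sum_right by (simp add: orth if_distrib[of "(*) _"] cong: if_cong)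

lemma ip_expand: "ip X y x = (\<Sum>n<card X. ip X (\<phi> n) x * ip X y (\<phi> n))"
proof -
  have "ip X y x = ip X y (\<lambda>v. \<Sum>n<card X. ip X (\<phi> n) x * \<phi> n v)"
    unfolding ip_def[of X y] by (intro sum.cong refl) (simp flip: expand)
  then show ?thesis by (simp only: ip_sum_right)
qed

lemma norm_expand: "(\<Sum>v\<in>X. (cmod (x v))\<^sup>2) = (\<Sum>n<card X. (cmod (ip X (\<phi> n) x))\<^sup>2)"
proof -
  have "complex_of_real (\<Sum>v\<in>X. (cmod (x v))\<^sup>2) = (\<Sum>n<card X. ip X (\<phi> n) x * cnj (ip X (\<phi> n) x))"
    unfolding ip_self[symmetric] ip_cnj by (rule ip_expand)
  also have "\<dots> = complex_of_real (\<Sum>n<card X. (cmod (ip X (\<phi> n) x))\<^sup>2)"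
    by (simp add: complex_norm_square del: of_real_power)
  finally show ?thesis using of_real_eq_iff by blast
qed

lemma norm_sum_phi: "(\<Sum>v\<in>X. (cmod (\<Sum>n<card X. c n * \<phi> n v))\<^sup>2) = (\<Sum>n<card X. (cmod (c n))\<^sup>2)"
  by (subst norm_expand) (simp add: ip_phi_sum)

end

locale eigenbasis = orthonormal_basis X \<phi> for X :: "'v set" and \<phi> +
  fixes K :: "'v \<Rightarrow> 'v \<Rightarrow> complex" and E :: "nat \<Rightarrow> real"
  assumes eig: "n < card X \<Longrightarrow> v \<in> X \<Longrightarrow> (\<Sum>w\<in>X. K v w * \<phi> n w) = complex_of_real (E n) * \<phi> n v"
begin

lemma apply_expand:
  assumes "v \<in> X"
  shows "(\<Sum>w\<in>X. K v w * x w) = (\<Sum>n<card X. complex_of_real (E n) * ip X (\<phi> n) x * \<phi> n v)"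
proof -
  have "(\<Sum>w\<in>X. K v w * x w) = (\<Sum>w\<in>X. K v w * (\<Sum>n<card X. ip X (\<phi> n) x * \<phi> n w))"
    by (intro sum.cong refl) (simp flip: expand)
  also have "\<dots> = (\<Sum>n<card X. ip X (\<phi> n) x * (\<Sum>w\<in>X. K v w * \<phi> n w))"
    by (simp add: sum_distrib_left mult_ac sum.swap[of _ X])
  finally show ?thesis by (simp add: eig assms mult_ac)
qed

lemma ip_apply:
  assumes "n < card X"
  shows "ip X (\<phi> n) (\<lambda>v. \<Sum>w\<in>X. K v w * x w) = complex_of_real (E n) * ip X (\<phi> n) x"
proof -
  have "ip X (\<phi> n) (\<lambda>v. \<Sum>w\<in>X. K v w * x w) = ip X (\<phi> n) (\<lambda>v. \<Sum>n<card X.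
      (complex_of_real (E n) * ip X (\<phi> n) x) * \<phi> n v)"
    unfolding ip_def[of X "\<phi> n"] by (intro sum.cong refl) (simp add: apply_expand)
  then show ?thesis using assms by (simp only: ip_phi_sum)
qed

text \<open>Read the eigenvalue equation at a point where the eigenvector has maximal modulus. A
  bound by row sums is used because these can be controlled uniformly in the quasimomentum.\<close>

lemma eigenvalue_bound:
  assumes K: "\<And>v. v \<in> X \<Longrightarrow> (\<Sum>w\<in>X. cmod (K v w)) \<le> M" and n: "n < card X"
  shows "\<bar>E n\<bar> \<le> M"
proof -
  have "X \<noteq> {}" using n by auto
  then have "Max ((\<lambda>v. cmod (\<phi> n v)) ` X) \<in> (\<lambda>v. cmod (\<phi> n v)) ` X" using fin by (intro Max_in) auto
  then obtain v where v0: "v \<in> X" "Max ((\<lambda>v. cmod (\<phi> n v)) ` X) = cmod (\<phi> n v)" by auto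
  have v: "v \<in> X" "\<And>w. w \<in> X \<Longrightarrow> cmod (\<phi> n w) \<le> cmod (\<phi> n v)"
    unfolding v0(2)[symmetric] using v0(1) fin by auto
  have pos: "cmod (\<phi> n v) > 0"
  proof (rule ccontr)
    assume "\<not> cmod (\<phi> n v) > 0"
    then have "\<And>w. w \<in> X \<Longrightarrow> cmod (\<phi> n w) = 0" using v(2) by (smt (verit) norm_ge_zero)
    then show False using norm_phi[OF n] by simp
  qed
  have "\<bar>E n\<bar> * cmod (\<phi> n v) = cmod (\<Sum>w\<in>X. K v w * \<phi> n w)" using eig[OF n v(1)] by (simp add: norm_mult)
  also have "\<dots> \<le> (\<Sum>w\<in>X. cmod (K v w) * cmod (\<phi> n v))"
    using v(2) by (intro order_trans[OF norm_sum] sum_mono) (auto simp: norm_mult intro: mult_left_mono)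
  also have "\<dots> = (\<Sum>w\<in>X. cmod (K v w)) * cmod (\<phi> n v)" by (simp add: sum_distrib_right)
  also have "\<dots> \<le> M * cmod (\<phi> n v)" using K[OF v(1)] pos by (intro mult_right_mono) auto
  finally show ?thesis using pos by simp
qed

text \<open>exp(-itK) given by its spectral decomposition; the agreement with the power series is
  the content of \<open>evo_series_error\<close>.\<close>

definition evo :: "real \<Rightarrow> ('v \<Rightarrow> complex) \<Rightarrow> 'v \<Rightarrow> complex" where
  "evo t x v = (\<Sum>n<card X. cis (- (t * E n)) * ip X (\<phi> n) x * \<phi> n v)"

lemma norm_evo: "(\<Sum>v\<in>X. (cmod (evo t x v))\<^sup>2) = (\<Sum>v\<in>X. (cmod (x v))\<^sup>2)"
  unfolding evo_def norm_sum_phi norm_expand[of x] by (simp add: norm_mult)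

text \<open>The iterates are only determined on X, so they enter through their recursion.\<close>

lemma iterate_expand:
  assumes it: "\<And>k v. v \<in> X \<Longrightarrow> y (Suc k) v = (\<Sum>w\<in>X. K v w * y k w)" and v: "v \<in> X"
  shows "y k v = (\<Sum>n<card X. complex_of_real (E n) ^ k * ip X (\<phi> n) (y 0) * \<phi> n v)"
proof -
  have "ip X (\<phi> n) (y k) = complex_of_real (E n) ^ k * ip X (\<phi> n) (y 0)" if "n < card X" for n
  proof (induction k)
    case (Suc k)
    have "ip X (\<phi> n) (y (Suc k)) = ip X (\<phi> n) (\<lambda>v. \<Sum>w\<in>X. K v w * y k w)"
      unfolding ip_def[of X "\<phi> n"] by (intro sum.cong refl) (simp add: it)
    then show ?case using that Suc by (simp add: ip_apply)
  qed simp
  then show ?thesis by (subst expand[OF v]) (auto intro!: sum.cong)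
qed

text \<open>In the eigenbasis the error is diagonal, with the error of the scalar exponential series
  at -itE as entries. Only the row-sum bound \<open>M\<close> enters, so the estimate is uniform
  over the torus.\<close>

lemma evo_series_error:
  assumes it: "\<And>k v. v \<in> X \<Longrightarrow> y (Suc k) v = (\<Sum>w\<in>X. K v w * y k w)"
    and K: "\<And>v. v \<in> X \<Longrightarrow> (\<Sum>w\<in>X. cmod (K v w)) \<le> M"
  shows "(\<Sum>v\<in>X. (cmod ((\<Sum>j<N. ((- \<i> * complex_of_real t) ^ j / of_nat (fact j)) * y j v) - evo t (y 0) v))\<^sup>2)
    \<le> (exp (\<bar>t\<bar> * M) - (\<Sum>j<N. (\<bar>t\<bar> * M) ^ j / fact j))\<^sup>2 * (\<Sum>v\<in>X. (cmod (y 0 v))\<^sup>2)"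
proof -
  let ?c = "\<lambda>n. ((\<Sum>j<N. (- \<i> * complex_of_real (t * E n)) ^ j / of_nat (fact j)) - exp (- \<i> * complex_of_real (t * E n)))"
  have eq: "(\<Sum>j<N. ((- \<i> * complex_of_real t) ^ j / of_nat (fact j)) * y j v) - evo t (y 0) v
      = (\<Sum>n<card X. (?c n * ip X (\<phi> n) (y 0)) * \<phi> n v)" if v: "v \<in> X" for v
  proof -
    have "(\<Sum>j<N. ((- \<i> * complex_of_real t) ^ j / of_nat (fact j)) * y j v)
      = (\<Sum>j<N. \<Sum>n<card X. ((- \<i> * complex_of_real (t * E n)) ^ j / of_nat (fact j)) * ip X (\<phi> n) (y 0) * \<phi> n v)"
    proof (intro sum.cong refl)
      fix j
      have yj: "y j v = (\<Sum>n<card X. complex_of_real (E n) ^ j * ip X (\<phi> n) (y 0) * \<phi> n v)"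
        by (rule iterate_expand[where y=y, OF _ v]) (rule it)
      show "((- \<i> * complex_of_real t) ^ j / of_nat (fact j)) * y j v
        = (\<Sum>n<card X. ((- \<i> * complex_of_real (t * E n)) ^ j / of_nat (fact j)) * ip X (\<phi> n) (y 0) * \<phi> n v)"
        unfolding yj sum_distrib_left
        by (intro sum.cong refl) (simp add: power_mult_distrib mult_ac power_minus[of "\<i> * _"])
    qed
    also have "\<dots> = (\<Sum>n<card X. (\<Sum>j<N. (- \<i> * complex_of_real (t * E n)) ^ j / of_nat (fact j))
        * ip X (\<phi> n) (y 0) * \<phi> n v)"
      by (subst sum.swap) (simp add: sum_distrib_right)
    finally show ?thesis
      by (simp add: evo_def cis_conv_exp left_diff_distrib sum_subtractf)
  qed
  have c: "cmod (?c n) \<le> exp (\<bar>t\<bar> * M) - (\<Sum>j<N. (\<bar>t\<bar> * M) ^ j / fact j)" if "n < card X" for n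
  proof -
    have "cmod (- \<i> * complex_of_real (t * E n)) \<le> \<bar>t\<bar> * M"
      using eigenvalue_bound[OF K that] by (simp add: norm_mult mult_left_mono)
    from exp_partial_sum_error[OF this, of N] show ?thesis by (simp only: norm_minus_commute)
  qed
  have "(\<Sum>v\<in>X. (cmod ((\<Sum>j<N. ((- \<i> * complex_of_real t) ^ j / of_nat (fact j)) * y j v) - evo t (y 0) v))\<^sup>2)
    = (\<Sum>v\<in>X. (cmod (\<Sum>n<card X. (?c n * ip X (\<phi> n) (y 0)) * \<phi> n v))\<^sup>2)"
    by (intro sum.cong refl) (simp only: eq)
  also have "\<dots> = (\<Sum>n<card X. (cmod (?c n * ip X (\<phi> n) (y 0)))\<^sup>2)" by (rule norm_sum_phi)
  also have "\<dots> \<le> (\<Sum>n<card X. (exp (\<bar>t\<bar> * M) - (\<Sum>j<N. (\<bar>t\<bar> * M) ^ j / fact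
      j))\<^sup>2 * (cmod (ip X (\<phi> n) (y 0)))\<^sup>2)"
    using c by (intro sum_mono) (auto simp: norm_mult power_mult_distrib intro!: mult_right_mono power_mono)
  also have "\<dots> = (exp (\<bar>t\<bar> * M) - (\<Sum>j<N. (\<bar>t\<bar> * M) ^ j / fact j))\<^sup>2 * (\<Sum>v\<in>X. (cmod (y 0 v))\<^sup>2)"
    by (simp add: norm_expand[of "y 0"] sum_distrib_left)
  finally show ?thesis .
qed

text \<open>\<open>wt n\<close> is the part of \<open>\<phi> n\<close> lying in the span of the
  first \<open>p\<close> trial vectors. It lies between 0 and 1 and totals \<open>p\<close>, and
  under these constraints the weighted sum of the eigenvalues is least when the weight fills the
  lowest \<open>p\<close> of them.\<close>

lemma ky_fan:
  assumes sorted: "\<And>n m. n \<le> m \<Longrightarrow> m < card X \<Longrightarrow> E n \<le> E m"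
    and \<omega>: "orthonormal_basis X \<omega>" and p: "p \<le> card X"
  shows "(\<Sum>n<p. E n) \<le> (\<Sum>j<p. Re (ip X (\<omega> j) (\<lambda>v. \<Sum>w\<in>X. K v w * \<omega> j w)))"
proof -
  interpret \<omega>: orthonormal_basis X \<omega> by fact
  define wt where "wt n = (\<Sum>j<p. (cmod (ip X (\<phi> n) (\<omega> j)))\<^sup>2)" for n
  have q: "Re (ip X (\<omega> j) (\<lambda>v. \<Sum>w\<in>X. K v w * \<omega> j w)) = (\<Sum>n<card X. E n * (cmod
      (ip X (\<phi> n) (\<omega> j)))\<^sup>2)" for j
  proof -
    have "ip X (\<omega> j) (\<lambda>v. \<Sum>w\<in>X. K v w * \<omega> j w) = (\<Sum>n<card X. complex_of_real
        (E n) * ip X (\<phi> n) (\<omega> j) * cnj (ip X (\<phi> n) (\<omega> j)))"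
      by (subst ip_expand) (simp add: ip_apply ip_cnj)
    also have "\<dots> = complex_of_real (\<Sum>n<card X. E n * (cmod (ip X (\<phi> n) (\<omega> j)))\<^sup>2)"
      by (simp add: complex_norm_square mult.assoc del: of_real_power)
    finally show ?thesis by simp
  qed
  have wt1: "wt n \<le> 1" if "n < card X" for n
  proof -
    have "wt n = (\<Sum>j<p. (cmod (ip X (\<omega> j) (\<phi> n)))\<^sup>2)"
      unfolding wt_def by (metis complex_mod_cnj ip_cnj)
    also have "\<dots> \<le> (\<Sum>j<card X. (cmod (ip X (\<omega> j) (\<phi> n)))\<^sup>2)" using p by (intro sum_mono2) auto
    also have "\<dots> = 1" using \<omega>.norm_expand[of "\<phi> n"] norm_phi[OF that] by simp
    finally show ?thesis .
  qed
  have wts: "(\<Sum>n<card X. wt n) = real p"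
  proof -
    have "(\<Sum>n<card X. wt n) = (\<Sum>j<p. \<Sum>n<card X. (cmod (ip X (\<phi> n) (\<omega> j)))\<^sup>2)"
      unfolding wt_def by (rule sum.swap)
    also have "\<dots> = (\<Sum>j<p. 1)" using p by (intro sum.cong refl) (simp add: \<omega>.norm_phi flip: norm_expand)
    finally show ?thesis by simp
  qed
  have "(\<Sum>j<p. Re (ip X (\<omega> j) (\<lambda>v. \<Sum>w\<in>X. K v w * \<omega> j w))) = (\<Sum>n<card X. E n * wt n)"
    unfolding q wt_def sum_distrib_left by (rule sum.swap)
  also have "\<dots> \<ge> (\<Sum>n<p. E n)"
  \<comment> \<open>If \<open>p = card X\<close>, all weights equal 1. Otherwise \<open>E p\<close>
    is an eigenvalue and serves as threshold: the weight missing below index \<open>p\<close> equals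
    the weight present from \<open>p\<close> on, and moving it across the threshold cannot raise the
    sum.\<close>
  proof (cases "p = card X")
    case True
    have "\<forall>n\<in>{..<card X}. 1 - wt n = 0"
      using wts wt1 True by (intro sum_nonneg_eq_0_iff[THEN iffD1]) (auto simp: sum_subtractf)
    then show ?thesis using True by simp
  next
    case False
    then have p': "p < card X" using p by simp
    have split: "(\<Sum>n<card X. h n) = (\<Sum>n<p. h n) + (\<Sum>n=p..<card X. h n)" for h :: "nat \<Rightarrow> real"
      using sum.atLeastLessThan_concat[of 0 p "card X" h] p by (simp add: atLeast0LessThan)
    have 1: "(\<Sum>n=p..<card X. E p * wt n) \<le> (\<Sum>n=p..<card X. E n * wt n)"
      using sorted by (intro sum_mono mult_right_mono) (auto simp: wt_def sum_nonneg)
    have 2: "(\<Sum>n<p. E n * (1 - wt n)) \<le> (\<Sum>n<p. E p * (1 - wt n))"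
      using sorted p' wt1 by (intro sum_mono mult_right_mono) auto
    have "(\<Sum>n=p..<card X. wt n) = (\<Sum>n<p. 1 - wt n)"
      using wts split[of wt] by (simp add: sum_subtractf)
    then have "(\<Sum>n=p..<card X. E p * wt n) = (\<Sum>n<p. E p * (1 - wt n))"
      by (simp flip: sum_distrib_left)
    then have "(\<Sum>n<p. E n * (1 - wt n)) \<le> (\<Sum>n=p..<card X. E n * wt n)" using 1 2 by simp
    then show ?thesis unfolding split[of "\<lambda>n. E n * wt n"] by (simp add: algebra_simps sum_subtractf)
  qed
  finally show ?thesis .
qed

end

subsection \<open>Periodic graphs and their Floquet transform\<close>

locale periodic_graph = dual_bases a b for a b :: "'d::finite \<Rightarrow> real^'d" +
  fixes V :: "(real^'d) set" and adj :: "real^'d \<Rightarrow> real^'d \<Rightarrow> bool" and Q :: "real^'d \<Rightarrow> real"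
  assumes adj_V: "\<And>u v. adj u v \<Longrightarrow> u \<in> V \<and> v \<in> V"
    and loc_fin: "\<And>v. v \<in> V \<Longrightarrow> finite {u. adj v u}"
    and V_per: "\<And>v i. v \<in> V \<longleftrightarrow> v + a i \<in> V"
    and adj_per: "\<And>u v i. adj u v \<longleftrightarrow> adj (u + a i) (v + a i)"
    and Vf_fin: "finite (V \<inter> cell a)"
    and Q_per: "\<And>v i. v \<in> V \<Longrightarrow> Q (v + a i) = Q v"
begin

abbreviation "Vf \<equiv> V \<inter> cell a"
abbreviation "nb v \<equiv> {u. adj v u}"

lemma finite_nb: "finite (nb v)"
proof (cases "v \<in> V")
  case False
  then have "nb v = {}" using adj_V by blast
  then show ?thesis by simp
qed (rule loc_fin)

lemma nb_V: "u \<in> nb v \<Longrightarrow> u \<in> V"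
  using adj_V by auto

lemma V_shift: "k \<in> \<Lambda> \<Longrightarrow> v + k \<in> V \<longleftrightarrow> v \<in> V"
proof (induction k rule: lattice_induct)
  case (2 k i)
  then show ?case using V_per[of "v + k" i] by (simp add: add.assoc)
next
  case (3 k i)
  then show ?case using V_per[of "v + (k - a i)" i] by (simp add: algebra_simps)
qed simp

lemma adj_shift: "k \<in> \<Lambda> \<Longrightarrow> adj (u + k) (v + k) \<longleftrightarrow> adj u v"
proof (induction k rule: lattice_induct)
  case (2 k i)
  then show ?case using adj_per[of "u + k" "v + k" i] by (simp add: add.assoc)
next
  case (3 k i)
  then show ?case using adj_per[of "u + (k - a i)" "v + (k - a i)" i] by (simp add: algebra_simps)
qed simp

lemma Q_shift:
  assumes "k \<in> \<Lambda>" "v \<in> V"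
  shows "Q (v + k) = Q v"
proof -
  have "v + k \<in> V \<and> Q (v + k) = Q v"
    using assms(1)
  proof (induction k rule: lattice_induct)
    case (2 k i)
    then show ?case using V_per[of "v + k" i] Q_per[of "v + k" i] by (simp add: add.assoc)
  next
    case (3 k i)
    then show ?case using V_per[of "v + (k - a i)" i] Q_per[of "v + (k - a i)" i] by (simp add: algebra_simps)
  qed (use assms in simp)
  then show ?thesis by simp
qed

lemma nb_shift: "k \<in> \<Lambda> \<Longrightarrow> nb (v + k) = (\<lambda>u. u + k) ` nb v"
proof (intro set_eqI iffI)
  fix u assume k: "k \<in> \<Lambda>" and u: "u \<in> nb (v + k)"
  then have "adj v (u - k)" using adj_shift[OF k, of v "u - k"] by simp
  then show "u \<in> (\<lambda>u. u + k) ` nb v" by (intro image_eqI[of _ _ "u - k"]) auto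
qed (auto simp: adj_shift)

lemma fr_Vf: "u \<in> V \<Longrightarrow> fr u \<in> Vf"
  using fracpart_decomp[of u] V_shift[of "u - fr u" "fr u"] by auto

lemma fr_id: "v \<in> Vf \<Longrightarrow> fr v = v"
  by (simp add: fracpart_cell)

text \<open>The matrix of the Bloch operator. Several neighbours of \<open>v\<close> may have the
  same representative in the cell, hence the inner sum.\<close>

definition kern :: "real^'d \<Rightarrow> real^'d \<Rightarrow> real^'d \<Rightarrow> complex" where
  "kern \<kappa> v w = (\<Sum>u\<in>{u\<in>nb v. fr u = w}. cis (\<kappa> \<bullet> (u - v))) + (if v = w then complex_of_real (Q v) else 0)"

lemma bloch_op_cis:
  "bloch_op a adj Q \<kappa> x v = (\<Sum>u\<in>nb v. cis (\<kappa> \<bullet> (u - v)) * x (fr u)) + complex_of_real (Q v) * x v"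
  by (simp add: bloch_op_def cis_conv_exp)

lemma bloch_op_kern:
  assumes "v \<in> Vf"
  shows "bloch_op a adj Q \<kappa> x v = (\<Sum>w\<in>Vf. kern \<kappa> v w * x w)"
proof -
  have "(\<Sum>w\<in>Vf. (\<Sum>u\<in>{u\<in>nb v. fr u = w}. cis (\<kappa> \<bullet> (u - v)) * x (fr u))) =
      (\<Sum>u\<in>nb v. cis (\<kappa> \<bullet> (u - v)) * x (fr u))"
    using finite_nb Vf_fin fr_Vf nb_V by (intro sum.group) auto
  moreover have "(\<Sum>w\<in>Vf. (\<Sum>u\<in>{u\<in>nb v. fr u = w}. cis (\<kappa> \<bullet> (u - v))) * x w)
      = (\<Sum>w\<in>Vf. (\<Sum>u\<in>{u\<in>nb v. fr u = w}. cis (\<kappa> \<bullet> (u - v)) * x (fr u)))"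
    by (intro sum.cong refl) (auto simp: sum_distrib_right intro!: sum.cong)
  moreover have "(\<Sum>w\<in>Vf. (if v = w then complex_of_real (Q v) else 0) * x w) = complex_of_real (Q v) * x v"
    using assms Vf_fin by (simp add: if_distrib[of "\<lambda>z. z * _"] cong: if_cong)
  ultimately show ?thesis by (simp add: bloch_op_cis kern_def distrib_right sum.distrib)
qed

text \<open>One constant for the row sums of every fibre and for the supremum norm of H on the
  graph. A sum instead of a maximum spares the case of an empty cell.\<close>

definition op_bound :: real where "op_bound = (\<Sum>v\<in>Vf. real (card (nb v)) + \<bar>Q v\<bar>)"

lemma op_bound_ge: "v \<in> Vf \<Longrightarrow> real (card (nb v)) + \<bar>Q v\<bar> \<le> op_bound"
  unfolding op_bound_def using Vf_fin by (intro member_le_sum) auto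

lemma kern_bound:
  assumes "v \<in> Vf"
  shows "(\<Sum>w\<in>Vf. cmod (kern \<kappa> v w)) \<le> op_bound"
proof -
  have "(\<Sum>w\<in>Vf. cmod (kern \<kappa> v w)) \<le> (\<Sum>w\<in>Vf. (\<Sum>u\<in>{u\<in>nb v. fr u = w}. 1)
      + (if v = w then \<bar>Q v\<bar> else 0))"
  proof (rule sum_mono)
    fix w
    have "cmod (kern \<kappa> v w) \<le> cmod (\<Sum>u\<in>{u\<in>nb v. fr u = w}. cis (\<kappa> \<bullet> (u -
        v))) + cmod (if v = w then complex_of_real (Q v) else 0)"
      unfolding kern_def by (rule norm_triangle_ineq)
    also have "cmod (\<Sum>u\<in>{u\<in>nb v. fr u = w}. cis (\<kappa> \<bullet> (u - v))) \<le> (\<Sum>u\<in>{u\<in>nb v. fr u = w}. 1)"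
      by (rule order_trans[OF norm_sum]) simp
    finally show "cmod (kern \<kappa> v w) \<le> (\<Sum>u\<in>{u\<in>nb v. fr u = w}. 1) + (if v = w then \<bar>Q
        v\<bar> else 0)" by (simp split: if_splits)
  qed
  also have "\<dots> = (\<Sum>u\<in>nb v. 1) + \<bar>Q v\<bar>"
    unfolding sum.distrib
    by (subst sum.group) (use finite_nb Vf_fin fr_Vf nb_V assms in auto)
  also have "\<dots> \<le> op_bound" using op_bound_ge[OF assms] by simp
  finally show ?thesis .
qed

text \<open>H conjugated by the multiplication with \<open>cis (\<eta> \<bullet> v)\<close>; only
  differences of positions survive in the phases, so this operator is again periodic and
  bounded.\<close>

definition hop :: "real^'d \<Rightarrow> (real^'d \<Rightarrow> complex) \<Rightarrow> real^'d \<Rightarrow> complex" where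
  "hop \<eta> f v = (\<Sum>u\<in>nb v. cis (- (\<eta> \<bullet> (u - v))) * f u) + complex_of_real (Q v) * f v"

lemma hop_bound:
  assumes f: "\<And>u. u \<in> V \<Longrightarrow> cmod (f u) \<le> C" and v: "v \<in> V"
  shows "cmod (hop \<eta> f v) \<le> op_bound * C"
proof -
  have C: "0 \<le> C" using f[OF v] norm_ge_zero order_trans by blast
  have k: "v - fr v \<in> \<Lambda>" by (rule fracpart_decomp)
  have c: "card (nb v) = card (nb (fr v))"
    using nb_shift[OF k, of "fr v"] by (simp add: card_image inj_on_def)
  have q: "Q v = Q (fr v)" using Q_shift[OF k, of "fr v"] fr_Vf[OF v] by simp
  have "cmod (hop \<eta> f v) \<le> (\<Sum>u\<in>nb v. cmod (cis (- (\<eta> \<bullet> (u - v))) * f u)) + cmod (complex_of_real (Q v) * f v)"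
    unfolding hop_def by (intro order_trans[OF norm_triangle_ineq] add_mono norm_sum order_refl)
  also have "\<dots> \<le> (\<Sum>u\<in>nb v. C) + \<bar>Q v\<bar> * C"
    using f v nb_V by (intro add_mono sum_mono) (auto simp: norm_mult intro!: mult_left_mono)
  also have "\<dots> = (real (card (nb (fr v))) + \<bar>Q (fr v)\<bar>) * C" using c q by (simp add: algebra_simps)
  also have "\<dots> \<le> op_bound * C" using op_bound_ge[OF fr_Vf[OF v]] C by (intro mult_right_mono)
  finally show ?thesis .
qed

lemma hop_iterate_bound:
  assumes "\<And>u. u \<in> V \<Longrightarrow> cmod (f u) \<le> C" "v \<in> V"
  shows "cmod ((hop \<eta> ^^ k) f v) \<le> op_bound ^ k * C"
  using assms(2)
proof (induction k arbitrary: v)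
  case (Suc k)
  then show ?case using hop_bound[of "(hop \<eta> ^^ k) f" "op_bound ^ k * C"] by (simp add: mult.assoc)
qed (use assms in simp)

lemma hop_cong: "(\<And>u. u \<in> V \<Longrightarrow> f u = f' u) \<Longrightarrow> v \<in> V \<Longrightarrow> hop \<eta> f v = hop \<eta> f' v"
  unfolding hop_def using nb_V by (intro arg_cong2[where f="(+)"] sum.cong) auto

lemma schr_op_twist:
  "(schr_op adj Q ^^ k) (\<lambda>u. cis (- (\<eta> \<bullet> u)) * f u) v = cis (- (\<eta> \<bullet> v)) * (hop \<eta> ^^ k) f v"
proof (induction k arbitrary: v)
  case (Suc k)
  have "(schr_op adj Q ^^ Suc k) (\<lambda>u. cis (- (\<eta> \<bullet> u)) * f u) v
      = (\<Sum>u\<in>nb v. cis (- (\<eta> \<bullet> u)) * (hop \<eta> ^^ k) f u) + complex_of_real (Q v) * (cis (-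
          (\<eta> \<bullet> v)) * (hop \<eta> ^^ k) f v)"
    by (simp add: schr_op_def Suc)
  also have "(\<Sum>u\<in>nb v. cis (- (\<eta> \<bullet> u)) * (hop \<eta> ^^ k) f u) = cis (- (\<eta> \<bullet>
      v)) * (\<Sum>u\<in>nb v. cis (- (\<eta> \<bullet> (u - v))) * (hop \<eta> ^^ k) f u)"
    unfolding sum_distrib_left by (intro sum.cong refl) (simp add: mult.assoc[symmetric] cis_mult inner_diff_right)
  also have "cis (- (\<eta> \<bullet> v)) * (\<Sum>u\<in>nb v. cis (- (\<eta> \<bullet> (u - v))) * (hop \<eta> ^^ k) f u)
      + complex_of_real (Q v) * (cis (- (\<eta> \<bullet> v)) * (hop \<eta> ^^ k) f v) = cis (- (\<eta> \<bullet>
          v)) * hop \<eta> ((hop \<eta> ^^ k) f) v"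
    unfolding hop_def[of \<eta> "(hop \<eta> ^^ k) f"] by (simp only: distrib_left mult.left_commute)
  finally show ?case by simp
qed simp

section \<open>Fields of fibre vectors and their coefficients on the graph\<close>

definition L2F :: "(real^'d \<Rightarrow> real^'d \<Rightarrow> complex) \<Rightarrow> bool" where
  "L2F W \<longleftrightarrow> (\<forall>v\<in>Vf. L2 mT (\<lambda>\<theta>. W \<theta> v))"

text \<open>The inverse Floquet transform. The frequency is the vertex \<open>v\<close> itself and
  not only its lattice part, as in the exponentials of the transform.\<close>

definition coef :: "(real^'d \<Rightarrow> real^'d \<Rightarrow> complex) \<Rightarrow> real^'d \<Rightarrow> complex" where
  "coef W v = fcoeff (\<lambda>\<theta>. W \<theta> (fr v)) v"

text \<open>The exponentials of the transform have frequencies \<open>v + k\<close>, which need not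
  lie in the lattice; the factor \<open>cis (\<tau> \<theta> \<bullet> v)\<close> removes the
  offset, so that Fourier series over the lattice apply.\<close>

definition field_approx :: "(real^'d \<Rightarrow> real^'d \<Rightarrow> complex) \<Rightarrow> bool" where
  "field_approx W \<longleftrightarrow> (\<forall>v\<in>Vf. trig_approx (\<lambda>\<theta>. cis (\<tau> \<theta> \<bullet> v) * W \<theta> v))"

lemma coef_fcoeff:
  assumes "v \<in> Vf" "k \<in> \<Lambda>"
  shows "coef W (v + k) = fcoeff (\<lambda>\<theta>. cis (\<tau> \<theta> \<bullet> v) * W \<theta> v) k"
  unfolding fcoeff_shift coef_def fracpart_add_lattice[OF assms(2)] fr_id[OF assms(1)] by (simp add: add.commute)

lemma field_approx_L2F:
  assumes "field_approx W"
  shows "L2F W"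
  unfolding L2F_def
proof
  fix v assume "v \<in> Vf"
  then have "L2 mT (\<lambda>\<theta>. cis (\<tau> \<theta> \<bullet> (- v)) * (cis (\<tau> \<theta> \<bullet> v) * W \<theta> v))"
    using assms by (intro L2_cis trig_approx_L2) (simp add: field_approx_def)
  then show "L2 mT (\<lambda>\<theta>. W \<theta> v)" by (simp add: mult.assoc[symmetric] cis_mult)
qed

text \<open>Multiplying a fibre component by the phase of an edge moves its coefficient to the other
  end of that edge, and translating the fibre by \<open>\<eta>\<close> leaves the constant factor
  \<open>cis (- (\<eta> \<bullet> (u - v)))\<close>. So translated fibres represent the conjugated
  operator.\<close>

lemma coef_bloch:
  assumes W: "L2F W" and v: "v \<in> V"
  shows "coef (\<lambda>\<theta>. bloch_op a adj Q (\<tau> \<theta> - \<eta>) (W \<theta>)) v = hop \<eta> (coef W) v"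
proof -
  define k where "k = v - fr v"
  have k: "k \<in> \<Lambda>" unfolding k_def by (rule fracpart_decomp)
  have vf: "fr v \<in> Vf" using fr_Vf[OF v] .
  have WL: "L2 mT (\<lambda>\<theta>. W \<theta> (fr u))" if "u \<in> V" for u using W fr_Vf[OF that] by (simp add: L2F_def)
  have q: "Q (fr v) = Q v" using Q_shift[OF k, of "fr v"] vf by (simp add: k_def)
  have ff: "fr (fr v) = fr v" using fr_id[OF vf] .
  have "coef (\<lambda>\<theta>. bloch_op a adj Q (\<tau> \<theta> - \<eta>) (W \<theta>)) v
    = fcoeff (\<lambda>\<theta>. (\<Sum>u\<in>nb (fr v). cis (- (\<eta> \<bullet> (u - fr v))) * (cis (\<tau>
        \<theta> \<bullet> (u - fr v)) * W \<theta> (fr u))) + complex_of_real (Q v) * W \<theta> (fr v)) v"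
    unfolding coef_def bloch_op_cis q
    by (simp add: mult.assoc[symmetric] cis_mult inner_diff_left)
  also have "\<dots> = (\<Sum>u\<in>nb (fr v). cis (- (\<eta> \<bullet> (u - fr v))) * fcoeff (\<lambda>\<theta>.
      W \<theta> (fr u)) (v + (u - fr v))) + complex_of_real (Q v) * coef W v"
  proof -
    have T: "L2 mT (\<lambda>\<theta>. cis (- (\<eta> \<bullet> (u - fr v))) * (cis (\<tau> \<theta> \<bullet> (u
        - fr v)) * W \<theta> (fr u)))" if "u \<in> nb (fr v)" for u
      using WL nb_V[OF that] by (intro L2_cmult L2_cis)
    show ?thesis
      by (subst fcoeff_add[OF L2_sum[OF T] L2_cmult[OF WL[OF v]]], assumption, subst fcoeff_sum[OF T], assumption)
        (simp only: fcoeff_cmult fcoeff_shift coef_def)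
  qed
  also have "(\<Sum>u\<in>nb (fr v). cis (- (\<eta> \<bullet> (u - fr v))) * fcoeff (\<lambda>\<theta>. W \<theta> (fr u)) (v + (u - fr v)))
    = (\<Sum>u\<in>nb v. cis (- (\<eta> \<bullet> (u - v))) * coef W u)"
  proof -
    have nbv: "nb v = (\<lambda>u. u + k) ` nb (fr v)" using nb_shift[OF k, of "fr v"] by (simp add: k_def)
    have "u - fr v = u + k - v" "v + (u - fr v) = u + k" for u by (simp_all add: k_def)
    then have "cis (- (\<eta> \<bullet> (u - fr v))) * fcoeff (\<lambda>\<theta>. W \<theta> (fr u)) (v + (u - fr
        v)) = cis (- (\<eta> \<bullet> (u + k - v))) * coef W (u + k)" for u
      by (simp only: coef_def fracpart_add_lattice[OF k])
    then show ?thesis unfolding nbv by (subst sum.reindex) (simp_all add: inj_on_def)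
  qed
  finally show ?thesis by (simp add: hop_def)
qed

lemma field_approx_bloch:
  assumes W: "field_approx W"
  shows "field_approx (\<lambda>\<theta>. bloch_op a adj Q (\<tau> \<theta> - \<eta>) (W \<theta>))"
  unfolding field_approx_def
proof
  fix v assume v: "v \<in> Vf"
  have "trig_approx (\<lambda>\<theta>. (\<Sum>u\<in>nb v. cis (- (\<eta> \<bullet> (u - v))) * (cis (\<tau>
      \<theta> \<bullet> (u - fr u)) * (cis (\<tau> \<theta> \<bullet> fr u) * W \<theta> (fr u))))
      + complex_of_real (Q v) * (cis (\<tau> \<theta> \<bullet> v) * W \<theta> v))"
  proof (rule trig_approx_add[OF trig_approx_sum])
    have T: "trig_approx (\<lambda>\<theta>. cis (\<tau> \<theta> \<bullet> w) * W \<theta> w)" if "w \<in> Vf"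
        for w using W that by (simp add: field_approx_def)
    show "trig_approx (\<lambda>\<theta>. complex_of_real (Q v) * (cis (\<tau> \<theta> \<bullet> v) * W \<theta> v))"
      by (rule trig_approx_cmult[OF T[OF v]])
    show "trig_approx (\<lambda>\<theta>. cis (- (\<eta> \<bullet> (u - v))) * (cis (\<tau> \<theta> \<bullet> (u
        - fr u)) * (cis (\<tau> \<theta> \<bullet> fr u) * W \<theta> (fr u))))"
      if "u \<in> nb v" for u
      by (rule trig_approx_cmult[OF trig_approx_shift[OF T[OF fr_Vf[OF nb_V[OF that]]] fracpart_decomp(2)]])
  qed
  moreover have "cis (\<tau> \<theta> \<bullet> v) * bloch_op a adj Q (\<tau> \<theta> - \<eta>) (W \<theta>) v
    = (\<Sum>u\<in>nb v. cis (- (\<eta> \<bullet> (u - v))) * (cis (\<tau> \<theta> \<bullet> (u - fr u)) * (cis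
        (\<tau> \<theta> \<bullet> fr u) * W \<theta> (fr u))))
      + complex_of_real (Q v) * (cis (\<tau> \<theta> \<bullet> v) * W \<theta> v)" for \<theta>
  proof -
    have e: "cis (\<tau> \<theta> \<bullet> v) * (cis ((\<tau> \<theta> - \<eta>) \<bullet> (u - v)) * z) = cis (-
        (\<eta> \<bullet> (u - v))) * (cis (\<tau> \<theta> \<bullet> (u - fr u)) * (cis (\<tau> \<theta> \<bullet> fr u) * z))" for u z
      by (simp add: mult.assoc[symmetric] cis_mult inner_diff_left inner_diff_right add.commute)
    show ?thesis unfolding bloch_op_cis distrib_left sum_distrib_left
    proof (rule arg_cong2[where f="(+)"])
      show "(\<Sum>u\<in>nb v. cis (\<tau> \<theta> \<bullet> v) * (cis ((\<tau> \<theta> - \<eta>) \<bullet> (u - v)) * W \<theta> (fr u)))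
        = (\<Sum>u\<in>nb v. cis (- (\<eta> \<bullet> (u - v))) * (cis (\<tau> \<theta> \<bullet> (u - fr u)) *
            (cis (\<tau> \<theta> \<bullet> fr u) * W \<theta> (fr u))))"
        by (rule sum.cong[OF refl]) (rule e)
    qed (rule mult.left_commute)
  qed
  ultimately show "trig_approx (\<lambda>\<theta>. cis (\<tau> \<theta> \<bullet> v) * bloch_op a adj Q (\<tau>
      \<theta> - \<eta>) (W \<theta>) v)" by simp
qed

lemma V_decomp: "V = (\<Union>v\<in>Vf. (\<lambda>k. v + k) ` \<Lambda>)"
proof (intro set_eqI iffI)
  fix u assume "u \<in> V"
  then show "u \<in> (\<Union>v\<in>Vf. (\<lambda>k. v + k) ` \<Lambda>)"
    using fr_Vf[of u] fracpart_decomp(2)[of u] by (intro UN_I[of "fr u"] image_eqI[of _ _ "u - fr u"]) auto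
qed (auto simp: V_shift)

lemma has_sum_V:
  fixes f :: "real^'d \<Rightarrow> 'b::{topological_ab_group_add,t2_space}"
  assumes "\<And>v. v \<in> Vf \<Longrightarrow> ((\<lambda>k. f (v + k)) has_sum s v) \<Lambda>"
  shows "(f has_sum (\<Sum>v\<in>Vf. s v)) V"
proof -
  have "(f has_sum (\<Sum>v\<in>S. s v)) (\<Union>v\<in>S. (\<lambda>k. v + k) ` \<Lambda>)" if "finite S" "S \<subseteq> Vf" for S
    using that
  proof induction
    case (insert v S)
    have "(f has_sum s v) ((\<lambda>k. v + k) ` \<Lambda>)"
      using assms[of v] insert.prems by (subst has_sum_reindex) (auto simp: o_def)
    moreover have "(f has_sum (\<Sum>v\<in>S. s v)) (\<Union>v\<in>S. (\<lambda>k. v + k) ` \<Lambda>)" using insert by auto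
    moreover have "(\<lambda>k. v + k) ` \<Lambda> \<inter> (\<Union>v\<in>S. (\<lambda>k. v + k) ` \<Lambda>) = {}"
    proof (rule ccontr)
      assume "\<not> ?thesis"
      then obtain k v' k' where *: "k \<in> \<Lambda>" "v' \<in> S" "k' \<in> \<Lambda>" "v + k = v' + k'" by auto
      have "fr (v + k) = v" "fr (v' + k') = v'"
        unfolding fracpart_add_lattice[OF *(1)] fracpart_add_lattice[OF *(3)]
        using * insert.prems by (intro fr_id; blast)+
      then show False using * insert.hyps by auto
    qed
    ultimately have "(f has_sum (s v + (\<Sum>v\<in>S. s v))) ((\<lambda>k. v + k) ` \<Lambda> \<union>
        (\<Union>v\<in>S. (\<lambda>k. v + k) ` \<Lambda>))"
      by (rule has_sum_Un_disjoint)
    then show ?case using insert by simp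
  qed simp
  from this[OF Vf_fin order_refl] show ?thesis by (simp flip: V_decomp)
qed

text \<open>The graph is a disjoint union of lattice translates, one for each vertex of the cell.
  Parseval holds on each, and the phases that removed the offset cancel in the products.\<close>

lemma parseval_V:
  assumes W: "field_approx W" "field_approx W'"
  shows "((\<lambda>v. cnj (coef W v) * coef W' v) has_sum (LINT \<theta>|mT. ip Vf (W \<theta>) (W' \<theta>))) V"
proof -
  have "((\<lambda>v. cnj (coef W v) * coef W' v) has_sum (\<Sum>v\<in>Vf. LINT \<theta>|mT. cnj (cis (\<tau>
      \<theta> \<bullet> v) * W \<theta> v) * (cis (\<tau> \<theta> \<bullet> v) * W' \<theta> v))) V"
  proof (rule has_sum_V)
    fix v assume v: "v \<in> Vf"
    show "((\<lambda>k. cnj (coef W (v + k)) * coef W' (v + k)) has_sum (LINT \<theta>|mT. cnj (cis (\<tau>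
        \<theta> \<bullet> v) * W \<theta> v) * (cis (\<tau> \<theta> \<bullet> v) * W' \<theta> v))) \<Lambda>"
      using parseval[of "\<lambda>\<theta>. cis (\<tau> \<theta> \<bullet> v) * W \<theta> v" "\<lambda>\<theta>.
          cis (\<tau> \<theta> \<bullet> v) * W' \<theta> v"] W v
      by (subst has_sum_cong[where g="\<lambda>k. cnj (fcoeff (\<lambda>\<theta>. cis (\<tau> \<theta> \<bullet>
          v) * W \<theta> v) k) * fcoeff (\<lambda>\<theta>. cis (\<tau> \<theta> \<bullet> v) * W' \<theta> v) k"])
        (auto simp: coef_fcoeff field_approx_def)
  qed
  moreover have "cnj (cis (\<tau> \<theta> \<bullet> v) * W \<theta> v) * (cis (\<tau> \<theta> \<bullet> v) * W'
      \<theta> v) = cnj (W \<theta> v) * W' \<theta> v" for \<theta> v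
    by (simp add: cis_cnj mult.assoc mult.left_commute[of "cis _" "cnj (W \<theta> v)"]) (simp add: mult.assoc[symmetric] cis_mult)
  moreover have "(LINT \<theta>|mT. ip Vf (W \<theta>) (W' \<theta>)) = (\<Sum>v\<in>Vf. LINT \<theta>|mT. cnj (W \<theta> v) * W' \<theta> v)"
    unfolding ip_def using field_approx_L2F[OF W(1)] field_approx_L2F[OF W(2)]
    by (intro Bochner_Integration.integral_sum L2_mult_integrable L2_cnj) (auto simp: L2F_def)
  ultimately show ?thesis by (simp only:)
qed

end

section \<open>The given transform, finitely supported functions and locality of the power
  series\<close>

context periodic_graph
begin

lemma field_approx_of_lattice_sums:
  assumes m: "\<And>v. v \<in> Vf \<Longrightarrow> (\<lambda>\<theta>. g \<theta> v) \<in> borel_measurable lebesgue"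
    and lim: "\<And>v. v \<in> Vf \<Longrightarrow>
       ((\<lambda>F. \<integral>\<^sup>+ \<theta>\<in>torus. ennreal ((cmod ((\<Sum>k\<in>F.
            exp (- \<i> * complex_of_real (\<tau> \<theta> \<bullet> (v + k))) * \<psi> (v + k)) - g \<theta> v))\<^sup>2) \<partial>lebesgue)
        \<longlongrightarrow> 0) (finite_subsets_at_top \<Lambda>)"
  shows "field_approx g" and "v \<in> V \<Longrightarrow> coef g v = \<psi> v"
proof -
  have *: "trig_approx (\<lambda>\<theta>. cis (\<tau> \<theta> \<bullet> v) * g \<theta> v)"
    "k \<in> \<Lambda> \<Longrightarrow> fcoeff (\<lambda>\<theta>. cis (\<tau> \<theta> \<bullet> v) * g \<theta>
        v) k = \<psi> (v + k)" if v: "v \<in> Vf" for v k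
  proof -
    have gm: "(\<lambda>\<theta>. g \<theta> v) \<in> borel_measurable mT" using m[OF v] by (rule measurable_restrict_space1)
    then have hm: "(\<lambda>\<theta>. cis (\<tau> \<theta> \<bullet> v) * g \<theta> v) \<in> borel_measurable mT"
      by (intro borel_measurable_times measurable_mT)
    have "cmod ((\<Sum>k\<in>F. exp (- \<i> * complex_of_real (\<tau> \<theta> \<bullet> (v + k))) * \<psi> (v + k)) - g \<theta> v)
       = cmod (cis (\<tau> \<theta> \<bullet> v) * g \<theta> v - tpol F (\<lambda>k. \<psi> (v + k)) \<theta>)" for F \<theta>
    proof -
      have "exp (- \<i> * complex_of_real (\<tau> \<theta> \<bullet> (v + k))) = cis (- (\<tau> \<theta> \<bullet>
          v)) * cis (- (\<tau> \<theta> \<bullet> k))" for k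
        unfolding cis_mult by (simp add: cis_conv_exp inner_add_right algebra_simps)
      then have "(\<Sum>k\<in>F. exp (- \<i> * complex_of_real (\<tau> \<theta> \<bullet> (v + k))) * \<psi> (v +
          k)) = cis (- (\<tau> \<theta> \<bullet> v)) * tpol F (\<lambda>k. \<psi> (v + k)) \<theta>"
        unfolding tpol_def sum_distrib_left by (intro sum.cong refl) (simp only: mult_ac)
      moreover have "g \<theta> v = cis (- (\<tau> \<theta> \<bullet> v)) * (cis (\<tau> \<theta> \<bullet> v) * g \<theta> v)"
        by (simp add: mult.assoc[symmetric] cis_mult)
      ultimately have "(\<Sum>k\<in>F. exp (- \<i> * complex_of_real (\<tau> \<theta> \<bullet> (v + k))) * \<psi> (v + k)) - g \<theta> v
        = cis (- (\<tau> \<theta> \<bullet> v)) * (tpol F (\<lambda>k. \<psi> (v + k)) \<theta> - cis (\<tau> \<theta> \<bullet> v) * g \<theta> v)"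
        by (simp only: right_diff_distrib)
      then show ?thesis by (simp only: norm_mult norm_cis mult_1 norm_minus_commute)
    qed
    then have "((\<lambda>F. \<integral>\<^sup>+\<theta>. ennreal ((cmod (cis (\<tau> \<theta> \<bullet> v) * g
        \<theta> v - tpol F (\<lambda>k. \<psi> (v + k)) \<theta>))\<^sup>2) \<partial>mT) \<longlongrightarrow> 0) (finite_subsets_at_top \<Lambda>)"
      using lim[OF v] by (simp add: nn_integral_restrict_space torus_lebesgue)
    from trig_approx_of_lattice_sums[OF hm this]
    show "trig_approx (\<lambda>\<theta>. cis (\<tau> \<theta> \<bullet> v) * g \<theta> v)"
      "k \<in> \<Lambda> \<Longrightarrow> fcoeff (\<lambda>\<theta>. cis (\<tau> \<theta> \<bullet> v) * g \<theta> v) k = \<psi> (v + k)" by auto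
  qed
  show "field_approx g" using *(1) by (simp add: field_approx_def)
  assume v: "v \<in> V"
  show "coef g v = \<psi> v"
    using coef_fcoeff[OF fr_Vf[OF v] fracpart_decomp(2)[of v], of g] *(2)[OF fr_Vf[OF v] fracpart_decomp(2)[of v]] by simp
qed

lemma trig_approx_tpol:
  assumes "finite F" "F \<subseteq> \<Lambda>"
  shows "trig_approx (tpol F c)"
  unfolding trig_approx_def using assms
  by (auto simp: L2_tpol norm_sq_def intro!: exI[of _ F] exI[of _ c])

text \<open>The Floquet transform of a finitely supported function is a finite sum. Such functions
  are the starting point for the contraction property of the evolution.\<close>

lemma finite_support_field_approx:
  assumes "finite F" "F \<subseteq> V"
  shows "\<exists>W. field_approx W \<and> (\<forall>v\<in>V. coef W v = (if v \<in> F then w v else 0))"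
proof -
  define K where "K v = {k \<in> \<Lambda>. v + k \<in> F}" for v
  have K: "finite (K v)" "K v \<subseteq> \<Lambda>" for v
  proof -
    have "K v \<subseteq> (\<lambda>u. u - v) ` F" unfolding K_def by (auto intro!: image_eqI[of _ _ "v + _"])
    then show "finite (K v)" using assms(1) finite_surj by blast
  qed (auto simp: K_def)
  define W where "W \<theta> v = cis (- (\<tau> \<theta> \<bullet> v)) * tpol (K v) (\<lambda>k. w (v + k)) \<theta>" for \<theta> v
  have W: "(\<lambda>\<theta>. cis (\<tau> \<theta> \<bullet> v) * W \<theta> v) = tpol (K v) (\<lambda>k. w (v + k))" for v
    by (auto simp: W_def mult.assoc[symmetric] cis_mult)
  show ?thesis
  proof (intro exI[of _ W] conjI ballI)
    show "field_approx W" unfolding field_approx_def W by (intro ballI trig_approx_tpol K)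
    fix v assume v: "v \<in> V"
    have "coef W v = fcoeff (tpol (K (fr v)) (\<lambda>k. w (fr v + k))) (v - fr v)"
      using coef_fcoeff[OF fr_Vf[OF v] fracpart_decomp(2)[of v], of W] by (simp add: W)
    also have "\<dots> = (if v \<in> F then w v else 0)"
      unfolding fcoeff_tpol[OF K fracpart_decomp(2)] using fracpart_decomp(2)[of v] by (simp add: K_def)
    finally show "coef W v = (if v \<in> F then w v else 0)" .
  qed
qed

lemma hop_iterate_cong:
  assumes "\<And>u. u \<in> V \<Longrightarrow> f u = f' u" "v \<in> V"
  shows "(hop \<eta> ^^ k) f v = (hop \<eta> ^^ k) f' v"
  using assms(2)
proof (induction k arbitrary: v)
  case (Suc k)
  then show ?case using hop_cong[of "(hop \<eta> ^^ k) f" "(hop \<eta> ^^ k) f'"] by simp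
qed (use assms in simp)

lemma schr_op_hop: "(schr_op adj Q ^^ k) f v = (hop 0 ^^ k) f v"
  using schr_op_twist[of k 0 f v] by simp

text \<open>The k-th iterate sees only vertices within graph distance k, and by local finiteness
  there are finitely many of them.\<close>

lemma hop_iterate_local:
  assumes "v \<in> V"
  shows "\<exists>D. finite D \<and> D \<subseteq> V \<and> (\<forall>f f'. (\<forall>u\<in>D. f u = f' u)
      \<longrightarrow> (hop \<eta> ^^ k) f v = (hop \<eta> ^^ k) f' v)"
  using assms
proof (induction k arbitrary: v)
  case 0
  then show ?case by (intro exI[of _ "{v}"]) auto
next
  case (Suc k)
  then have "\<forall>u\<in>V. \<exists>D. finite D \<and> D \<subseteq> V \<and> (\<forall>f f'.
      (\<forall>u\<in>D. f u = f' u) \<longrightarrow> (hop \<eta> ^^ k) f u = (hop \<eta> ^^ k) f' u)" by blast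
  then obtain D where D: "\<And>u. u \<in> V \<Longrightarrow> finite (D u)" "\<And>u. u \<in> V \<Longrightarrow> D u \<subseteq> V"
    "\<And>u f f'. u \<in> V \<Longrightarrow> (\<And>x. x \<in> D u \<Longrightarrow> f x = f' x)
        \<Longrightarrow> (hop \<eta> ^^ k) f u = (hop \<eta> ^^ k) f' u"
    by (metis (mono_tags, lifting))
  have sub: "insert v (nb v) \<subseteq> V" using Suc.prems nb_V by blast
  show ?case
  proof (intro exI[of _ "\<Union>u\<in>insert v (nb v). D u"] conjI allI impI)
    show "finite (\<Union>u\<in>insert v (nb v). D u)" using D(1) sub finite_nb by (intro finite_UN_I) auto
    show "(\<Union>u\<in>insert v (nb v). D u) \<subseteq> V" using D(2) sub by blast
    fix f f' :: "real^'d \<Rightarrow> complex" assume "\<forall>u\<in>\<Union>u\<in>insert v (nb v). D u. f u = f' u"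
    then have "(hop \<eta> ^^ k) f u = (hop \<eta> ^^ k) f' u" if "u \<in> insert v (nb v)" for u
      using D(3)[of u f f'] sub that by blast
    then show "(hop \<eta> ^^ Suc k) f v = (hop \<eta> ^^ Suc k) f' v"
      unfolding funpow.simps o_apply hop_def[of \<eta> "(hop \<eta> ^^ k) _"] by simp
  qed
qed

text \<open>By locality each term of the series is eventually constant as the cutoff grows, and an
  exponential series dominates all terms, so Tannery's theorem exchanges the two limits.\<close>

lemma schr_evol_cutoff_tendsto:
  assumes w: "\<And>u. u \<in> V \<Longrightarrow> cmod (w u) \<le> C" and v: "v \<in> V"
  shows "((\<lambda>F. schr_evol adj Q t (\<lambda>u. if u \<in> F then w u else 0) v) \<longlongrightarrow>
      schr_evol adj Q t w v) (finite_subsets_at_top V)"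
proof -
  let ?c = "\<lambda>k. (- \<i> * complex_of_real t) ^ k / of_nat (fact k)"
  have C: "0 \<le> C" using w[OF v] norm_ge_zero order_trans by blast
  have cn: "cmod (?c k) = \<bar>t\<bar> ^ k / fact k" for k by (simp add: norm_divide norm_mult norm_power)
  have sm: "summable (\<lambda>k. \<bar>t\<bar> ^ k / fact k * (op_bound ^ k * C))"
  proof -
    have "summable (\<lambda>k. ((\<bar>t\<bar> * op_bound) ^ k / fact k) * C)"
      using sums_summable[OF exp_converges[of "\<bar>t\<bar> * op_bound"]] by (intro summable_mult2) (simp add: field_simps)
    then show ?thesis by (simp add: power_mult_distrib mult_ac)
  qed
  have "((\<lambda>F. suminf (\<lambda>k. ?c k * (schr_op adj Q ^^ k) (\<lambda>u. if u \<in> F then w u else 0) v)) \<longlongrightarrow>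
      suminf (\<lambda>k. ?c k * (schr_op adj Q ^^ k) w v)) (finite_subsets_at_top V)"
  proof (rule tannerys_theorem[THEN conjunct2, THEN conjunct2, OF _ _ sm])
    show "((\<lambda>F. ?c k * (schr_op adj Q ^^ k) (\<lambda>u. if u \<in> F then w u else 0) v)
        \<longlongrightarrow> ?c k * (schr_op adj Q ^^ k) w v) (finite_subsets_at_top V)" for k
    proof (rule tendsto_eventually)
      obtain D where D: "finite D" "D \<subseteq> V" "\<And>f f'. (\<forall>u\<in>D. f u = f' u) \<longrightarrow>
          (hop 0 ^^ k) f v = (hop 0 ^^ k) f' v"
        using hop_iterate_local[OF v, where \<eta>=0 and k=k] by blast
      show "\<forall>\<^sub>F F in finite_subsets_at_top V. ?c k * (schr_op adj Q ^^ k) (\<lambda>u. if u \<in> F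
          then w u else 0) v = ?c k * (schr_op adj Q ^^ k) w v"
        unfolding eventually_finite_subsets_at_top schr_op_hop
      proof (intro exI[of _ D] conjI D allI impI)
        fix F assume "finite F \<and> D \<subseteq> F \<and> F \<subseteq> V"
        then have "(hop 0 ^^ k) (\<lambda>u. if u \<in> F then w u else 0) v = (hop 0 ^^ k) w v"
          by (intro D(3)[rule_format]) auto
        then show "?c k * (hop 0 ^^ k) (\<lambda>u. if u \<in> F then w u else 0) v = ?c k * (hop 0 ^^ k) w v" by simp
      qed
    qed
    have "cmod (?c k * (schr_op adj Q ^^ k) (\<lambda>u. if u \<in> F then w u else 0) v) \<le> \<bar>t\<bar> ^ k
        / fact k * (op_bound ^ k * C)" for k F
    proof -
      have "cmod ((hop 0 ^^ k) (\<lambda>u. if u \<in> F then w u else 0) v) \<le> op_bound ^ k * C"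
        using w C by (intro hop_iterate_bound v) auto
      then show ?thesis unfolding schr_op_hop norm_mult cn by (intro mult_left_mono) auto
    qed
    then show "\<forall>\<^sub>F (k, F) in sequentially \<times>\<^sub>F finite_subsets_at_top V.
       cmod (?c k * (schr_op adj Q ^^ k) (\<lambda>u. if u \<in> F then w u else 0) v) \<le> \<bar>t\<bar> ^ k / fact k * (op_bound ^ k * C)"
      by (intro always_eventually) auto
  qed simp
  then show ?thesis by (simp add: schr_evol_def)
qed

end

section \<open>Evolution in the fibres and its transfer to the graph\<close>

locale floquet = periodic_graph a b V adj Q for a b :: "'d::finite \<Rightarrow> real^'d" and V adj Q +
  fixes \<phi> :: "real^'d \<Rightarrow> nat \<Rightarrow> real^'d \<Rightarrow> complex" and Ev :: "real^'d \<Rightarrow> nat \<Rightarrow> real"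
  assumes eigenbasis: "eigenbasis Vf (\<phi> \<theta>) (kern (\<tau> \<theta>)) (Ev \<theta>)"
    and sorted: "n \<le> m \<Longrightarrow> m < card Vf \<Longrightarrow> Ev \<theta> n \<le> Ev \<theta> m"
begin

sublocale fibre: eigenbasis Vf "\<phi> \<theta>" "kern (\<tau> \<theta>)" "Ev \<theta>" for \<theta>
  by (rule eigenbasis)

text \<open>The vector at \<theta> evolves under the fibre at \<open>\<theta> - \<eta>\<close>. That
  point may lie outside the unit cube; the eigenbases are given on the whole space, so nothing has
  to be wrapped around.\<close>

definition evolve :: "real^'d \<Rightarrow> real \<Rightarrow> (real^'d \<Rightarrow> real^'d \<Rightarrow>
    complex) \<Rightarrow> real^'d \<Rightarrow> real^'d \<Rightarrow> complex" where
  "evolve \<eta> t W \<theta> = fibre.evo (\<theta> - \<eta>) t (W \<theta>)"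

definition exp_tail :: "real \<Rightarrow> nat \<Rightarrow> real" where
  "exp_tail t N = exp (\<bar>t\<bar> * op_bound) - (\<Sum>j<N. (\<bar>t\<bar> * op_bound) ^ j / fact j)"

lemma exp_tail_tendsto: "exp_tail t \<longlonglongrightarrow> 0"
proof -
  have "(\<lambda>j. (\<bar>t\<bar> * op_bound) ^ j / fact j) sums exp (\<bar>t\<bar> * op_bound)"
    using exp_converges[of "\<bar>t\<bar> * op_bound"] by (simp add: field_simps)
  then have "(\<lambda>N. exp (\<bar>t\<bar> * op_bound) - (\<Sum>j<N. (\<bar>t\<bar> * op_bound) ^ j / fact j))
      \<longlonglongrightarrow> exp (\<bar>t\<bar> * op_bound) - exp (\<bar>t\<bar> * op_bound)"
    unfolding sums_def by (intro tendsto_diff tendsto_const)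
  then show ?thesis by (simp add: exp_tail_def[abs_def])
qed

lemma evolve_norm: "(\<Sum>v\<in>Vf. (cmod (evolve \<eta> t W \<theta> v))\<^sup>2) = (\<Sum>v\<in>Vf. (cmod (W \<theta> v))\<^sup>2)"
  unfolding evolve_def by (rule fibre.norm_evo)

context
  fixes W and \<eta> :: "real^'d" and t :: real
  assumes W: "field_approx W"
begin

definition iter :: "nat \<Rightarrow> real^'d \<Rightarrow> real^'d \<Rightarrow> complex" where
  "iter j \<theta> = (bloch_op a adj Q (\<tau> \<theta> - \<tau> \<eta>) ^^ j) (W \<theta>)"

definition psum :: "nat \<Rightarrow> real^'d \<Rightarrow> real^'d \<Rightarrow> complex" where
  "psum N \<theta> v = (\<Sum>j<N. ((- \<i> * complex_of_real t) ^ j / of_nat (fact j)) * iter j \<theta> v)"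

lemma field_approx_iter: "field_approx (iter j)"
proof (induction j)
  case 0
  then show ?case using W by (simp add: iter_def[abs_def])
next
  case (Suc j)
  from field_approx_bloch[OF this, of "\<tau> \<eta>"] show ?case by (simp add: iter_def[abs_def])
qed

lemma coef_iter: "v \<in> V \<Longrightarrow> coef (iter j) v = (hop (\<tau> \<eta>) ^^ j) (coef W) v"
proof (induction j arbitrary: v)
  case 0
  then show ?case by (simp add: iter_def[abs_def])
next
  case (Suc j)
  have "coef (iter (Suc j)) v = hop (\<tau> \<eta>) (coef (iter j)) v"
    using coef_bloch[OF field_approx_L2F[OF field_approx_iter] Suc.prems, of "\<tau> \<eta>" j] by (simp add: iter_def[abs_def])
  then show ?case using hop_cong[OF Suc.IH Suc.prems] by simp
qed

lemma psum_error:
  "(\<Sum>v\<in>Vf. (cmod (psum N \<theta> v - evolve \<eta> t W \<theta> v))\<^sup>2) \<le> (exp_tail t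
      N)\<^sup>2 * (\<Sum>v\<in>Vf. (cmod (W \<theta> v))\<^sup>2)"
proof -
  have 0: "iter 0 \<theta> = W \<theta>" by (simp add: iter_def)
  have "(\<Sum>v\<in>Vf. (cmod ((\<Sum>j<N. ((- \<i> * complex_of_real t) ^ j / of_nat (fact j)) * iter j \<theta>
      v) - fibre.evo (\<theta> - \<eta>) t (iter 0 \<theta>) v))\<^sup>2)
    \<le> (exp (\<bar>t\<bar> * op_bound) - (\<Sum>j<N. (\<bar>t\<bar> * op_bound) ^ j / fact j))\<^sup>2 *
        (\<Sum>v\<in>Vf. (cmod (iter 0 \<theta> v))\<^sup>2)"
  proof (rule fibre.evo_series_error[where y="\<lambda>j. iter j \<theta>" and M=op_bound])
    show "iter (Suc k) \<theta> v = (\<Sum>w\<in>Vf. kern (\<tau> (\<theta> - \<eta>)) v w * iter k \<theta> w)" if "v \<in> Vf" for k v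
      using bloch_op_kern[OF that, of "\<tau> \<theta> - \<tau> \<eta>"] by (simp add: iter_def theta_b_diff)
  qed (rule kern_bound)
  then show ?thesis by (simp add: psum_def evolve_def exp_tail_def 0)
qed

lemma psum_error1:
  assumes "v \<in> Vf"
  shows "(cmod (psum N \<theta> v - evolve \<eta> t W \<theta> v))\<^sup>2 \<le> (exp_tail t N)\<^sup>2 *
      (\<Sum>v\<in>Vf. (cmod (W \<theta> v))\<^sup>2)"
  using psum_error[of N \<theta>] member_le_sum[OF assms, of "\<lambda>v. (cmod (psum N \<theta> v - evolve \<eta> t W \<theta> v))\<^sup>2"] Vf_fin
  by simp

lemma field_approx_psum: "field_approx (psum N)"
proof -
  have "trig_approx (\<lambda>\<theta>. \<Sum>j<N. ((- \<i> * complex_of_real t) ^ j / of_nat (fact j)) * (cis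
      (\<tau> \<theta> \<bullet> v) * iter j \<theta> v))" if "v \<in> Vf" for v
    using field_approx_iter that by (intro trig_approx_sum trig_approx_cmult) (simp add: field_approx_def)
  then show ?thesis by (simp add: field_approx_def psum_def sum_distrib_left mult.left_commute)
qed

lemma integrable_W: "integrable mT (\<lambda>\<theta>. \<Sum>v\<in>Vf. (cmod (W \<theta> v))\<^sup>2)"
  using field_approx_L2F[OF W] by (intro Bochner_Integration.integrable_sum) (auto simp: L2F_def L2_def)

text \<open>Measurability is inherited from the partial sums of the series, which converge at every
  quasimomentum; integrability follows from the preserved fibre norm.\<close>

lemma L2_evolve:
  assumes v: "v \<in> Vf"
  shows "L2 mT (\<lambda>\<theta>. evolve \<eta> t W \<theta> v)"
  unfolding L2_def
proof
  show m: "(\<lambda>\<theta>. evolve \<eta> t W \<theta> v) \<in> borel_measurable mT"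
  proof (rule borel_measurable_LIMSEQ_metric)
    show "(\<lambda>\<theta>. psum N \<theta> v) \<in> borel_measurable mT" for N
      using field_approx_L2F[OF field_approx_psum[of N]] v by (auto simp: L2F_def L2_def)
    fix \<theta>
    have "(\<lambda>N. (exp_tail t N)\<^sup>2 * (\<Sum>v\<in>Vf. (cmod (W \<theta> v))\<^sup>2))
        \<longlonglongrightarrow> 0\<^sup>2 * (\<Sum>v\<in>Vf. (cmod (W \<theta> v))\<^sup>2)"
      by (intro tendsto_intros exp_tail_tendsto)
    then have z: "(\<lambda>N. (exp_tail t N)\<^sup>2 * (\<Sum>v\<in>Vf. (cmod (W \<theta> v))\<^sup>2)) \<longlonglongrightarrow> 0" by simp
    have "(\<lambda>N. (cmod (psum N \<theta> v - evolve \<eta> t W \<theta> v))\<^sup>2) \<longlonglongrightarrow> 0"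
      by (rule tendsto_sandwich[OF _ _ tendsto_const z]) (use psum_error1[OF v] in auto)
    then have "(\<lambda>N. cmod (psum N \<theta> v - evolve \<eta> t W \<theta> v)) \<longlonglongrightarrow> 0" using tendsto_real_sqrt by fastforce
    then show "(\<lambda>N. psum N \<theta> v) \<longlonglongrightarrow> evolve \<eta> t W \<theta> v" using Lim_null tendsto_norm_zero_iff by blast
  qed
  show "integrable mT (\<lambda>\<theta>. (cmod (evolve \<eta> t W \<theta> v))\<^sup>2)"
  proof (rule Bochner_Integration.integrable_bound[OF integrable_W])
    show "(\<lambda>\<theta>. (cmod (evolve \<eta> t W \<theta> v))\<^sup>2) \<in> borel_measurable mT" using m by measurable
    have "(cmod (evolve \<eta> t W \<theta> v))\<^sup>2 \<le> (\<Sum>v\<in>Vf. (cmod (W \<theta> v))\<^sup>2)" for \<theta>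
      using member_le_sum[OF v, of "\<lambda>v. (cmod (evolve \<eta> t W \<theta> v))\<^sup>2"] Vf_fin by (simp add: evolve_norm)
    then show "AE \<theta> in mT. norm ((cmod (evolve \<eta> t W \<theta> v))\<^sup>2) \<le> norm (\<Sum>v\<in>Vf. (cmod (W \<theta> v))\<^sup>2)"
      by (auto simp: sum_nonneg)
  qed
qed

lemma psum_tendsto_L2:
  assumes v: "v \<in> Vf"
  shows "(\<lambda>N. norm_sq mT (\<lambda>\<theta>. cis (\<tau> \<theta> \<bullet> v) * psum N \<theta> v - cis
      (\<tau> \<theta> \<bullet> v) * evolve \<eta> t W \<theta> v)) \<longlonglongrightarrow> 0"
proof -
  define A where "A = (LINT \<theta>|mT. (\<Sum>v\<in>Vf. (cmod (W \<theta> v))\<^sup>2))"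
  have "(\<lambda>N. (exp_tail t N)\<^sup>2 * A) \<longlonglongrightarrow> 0\<^sup>2 * A" by (intro tendsto_intros exp_tail_tendsto)
  then have z: "(\<lambda>N. (exp_tail t N)\<^sup>2 * A) \<longlonglongrightarrow> 0" by simp
  have le: "norm_sq mT (\<lambda>\<theta>. cis (\<tau> \<theta> \<bullet> v) * psum N \<theta> v - cis (\<tau>
      \<theta> \<bullet> v) * evolve \<eta> t W \<theta> v) \<le> (exp_tail t N)\<^sup>2 * A" for N
  proof -
    have "norm_sq mT (\<lambda>\<theta>. cis (\<tau> \<theta> \<bullet> v) * psum N \<theta> v - cis (\<tau>
        \<theta> \<bullet> v) * evolve \<eta> t W \<theta> v) = (LINT \<theta>|mT. (cmod (psum N \<theta> v - evolve \<eta> t W \<theta> v))\<^sup>2)"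
      by (simp add: norm_sq_def norm_mult flip: right_diff_distrib)
    also have "\<dots> \<le> (LINT \<theta>|mT. (exp_tail t N)\<^sup>2 * (\<Sum>v\<in>Vf. (cmod (W \<theta> v))\<^sup>2))"
    proof (rule integral_mono)
      show "integrable mT (\<lambda>\<theta>. (cmod (psum N \<theta> v - evolve \<eta> t W \<theta> v))\<^sup>2)"
        using field_approx_L2F[OF field_approx_psum[of N]] v by (intro L2_integrable_sq L2_diff L2_evolve) (auto simp: L2F_def)
    qed (use integrable_W psum_error1[OF v] in auto)
    finally show ?thesis by (simp add: A_def)
  qed
  show ?thesis by (rule tendsto_sandwich[OF _ _ tendsto_const z]) (use le in auto)
qed

lemma field_approx_evolve: "field_approx (evolve \<eta> t W)"
  unfolding field_approx_def
proof
  fix v assume v: "v \<in> Vf"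
  show "trig_approx (\<lambda>\<theta>. cis (\<tau> \<theta> \<bullet> v) * evolve \<eta> t W \<theta> v)"
  proof (rule trig_approx_limit)
    show "trig_approx (\<lambda>\<theta>. cis (\<tau> \<theta> \<bullet> v) * psum N \<theta> v)" for N using
        field_approx_psum v by (simp add: field_approx_def)
  qed (use L2_evolve[OF v] psum_tendsto_L2[OF v] in \<open>auto intro: L2_cis\<close>)
qed

text \<open>Coefficients are continuous in mean square, so the partial sums in the fibres turn into
  the partial sums on the graph. Here the spectral evolution meets the pointwise power
  series.\<close>

lemma coef_evolve_sums:
  assumes v: "v \<in> V"
  shows "(\<lambda>j. ((- \<i> * complex_of_real t) ^ j / of_nat (fact j)) * (hop (\<tau> \<eta>) ^^ j) (coef W) v) sums coef (evolve \<eta> t W) v"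
proof -
  have f: "fr v \<in> Vf" using fr_Vf[OF v] .
  have k: "v - fr v \<in> \<Lambda>" by (rule fracpart_decomp)
  have cf: "coef Y v = fcoeff (\<lambda>\<theta>. cis (\<tau> \<theta> \<bullet> fr v) * Y \<theta> (fr v)) (v - fr v)" for Y
    using coef_fcoeff[OF f k, of Y] by simp
  have "(\<lambda>N. coef (psum N) v) \<longlonglongrightarrow> coef (evolve \<eta> t W) v"
    unfolding cf
  proof (rule fcoeff_tendsto[OF k])
    show "L2 mT (\<lambda>\<theta>. cis (\<tau> \<theta> \<bullet> fr v) * psum N \<theta> (fr v))" for N
      using field_approx_psum[of N] f by (auto simp: field_approx_def intro: trig_approx_L2)
    show "L2 mT (\<lambda>\<theta>. cis (\<tau> \<theta> \<bullet> fr v) * evolve \<eta> t W \<theta> (fr v))"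
      by (intro L2_cis L2_evolve f)
  qed (rule psum_tendsto_L2[OF f])
  moreover have "coef (psum N) v = (\<Sum>j<N. ((- \<i> * complex_of_real t) ^ j / of_nat (fact j)) * (hop (\<tau> \<eta>) ^^ j) (coef W) v)" for N
  proof -
    have L: "L2 mT (\<lambda>\<theta>. iter j \<theta> (fr v))" for j using field_approx_L2F[OF field_approx_iter[of j]] f by (auto simp: L2F_def)
    have "coef (psum N) v = (\<Sum>j<N. fcoeff (\<lambda>\<theta>. ((- \<i> * complex_of_real t) ^ j / of_nat (fact j)) * iter j \<theta> (fr v)) v)"
      unfolding coef_def psum_def by (rule fcoeff_sum) (intro L2_cmult L)
    also have "\<dots> = (\<Sum>j<N. ((- \<i> * complex_of_real t) ^ j / of_nat (fact j)) * coef (iter j) v)"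
      unfolding fcoeff_cmult coef_def ..
    finally show ?thesis using v by (simp add: coef_iter)
  qed
  ultimately show ?thesis unfolding sums_def by simp
qed

text \<open>With \<open>\<eta> = 0\<close> this is the diagonalisation of the evolution; in general
  a phase on the initial state comes out in front and translates the fibres.\<close>

lemma schr_evol_coef:
  assumes w: "\<And>u. u \<in> V \<Longrightarrow> w u = coef W u" and v: "v \<in> V"
  shows "schr_evol adj Q t (\<lambda>u. cis (- (\<tau> \<eta> \<bullet> u)) * w u) v = cis (- (\<tau> \<eta>
      \<bullet> v)) * coef (evolve \<eta> t W) v"
proof -
  have "(\<lambda>j. cis (- (\<tau> \<eta> \<bullet> v)) * (((- \<i> * complex_of_real t) ^ j / of_nat (fact j)) *
      (hop (\<tau> \<eta>) ^^ j) (coef W) v))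
     sums (cis (- (\<tau> \<eta> \<bullet> v)) * coef (evolve \<eta> t W) v)"
    by (rule sums_mult[OF coef_evolve_sums[OF v]])
  moreover have "(hop (\<tau> \<eta>) ^^ j) (coef W) v = (hop (\<tau> \<eta>) ^^ j) w v" for j
    by (rule hop_iterate_cong) (auto simp: w v)
  ultimately show ?thesis unfolding schr_evol_def schr_op_twist
    by (simp add: sums_unique[symmetric] mult.left_commute)
qed

lemma coef_evolve_norm: "((\<lambda>v. (cmod (coef (evolve \<eta> t W) v))\<^sup>2) has_sum (LINT \<theta>|mT.
    (\<Sum>v\<in>Vf. (cmod (W \<theta> v))\<^sup>2))) V"
proof -
  have "((\<lambda>v. cnj (coef (evolve \<eta> t W) v) * coef (evolve \<eta> t W) v) has_sum (LINT \<theta>|mT. ip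
      Vf (evolve \<eta> t W \<theta>) (evolve \<eta> t W \<theta>))) V"
    by (rule parseval_V[OF field_approx_evolve field_approx_evolve])
  then have "((\<lambda>v. complex_of_real ((cmod (coef (evolve \<eta> t W) v))\<^sup>2)) has_sum complex_of_real
      (LINT \<theta>|mT. (\<Sum>v\<in>Vf. (cmod (W \<theta> v))\<^sup>2))) V"
    unfolding ip_self evolve_norm by (simp add: complex_norm_square mult.commute flip: integral_complex_of_real del: of_real_power)
  then show ?thesis by (simp only: has_sum_of_real_iff)
qed

lemma coef_norm: "((\<lambda>v. (cmod (coef W v))\<^sup>2) has_sum (LINT \<theta>|mT. (\<Sum>v\<in>Vf. (cmod (W \<theta> v))\<^sup>2))) V"
proof -
  have "((\<lambda>v. cnj (coef W v) * coef W v) has_sum (LINT \<theta>|mT. ip Vf (W \<theta>) (W \<theta>))) V"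
    by (rule parseval_V[OF W W])
  then have "((\<lambda>v. complex_of_real ((cmod (coef W v))\<^sup>2)) has_sum complex_of_real (LINT \<theta>|mT.
      (\<Sum>v\<in>Vf. (cmod (W \<theta> v))\<^sup>2))) V"
    unfolding ip_self by (simp add: complex_norm_square mult.commute flip: integral_complex_of_real del: of_real_power)
  then show ?thesis by (simp only: has_sum_of_real_iff)
qed

end

text \<open>Cutoffs of \<open>w\<close> are coefficients of an explicit field, and unitarity of the
  fibres bounds their evolution. On a finite set \<open>S\<close> the bound survives the pointwise
  limit of the cutoffs.\<close>

lemma schr_evol_contraction:
  assumes w: "((\<lambda>v. (cmod (w v))\<^sup>2) has_sum s) V" and S: "finite S" "S \<subseteq> V"
  shows "(\<Sum>v\<in>S. (cmod (schr_evol adj Q t w v))\<^sup>2) \<le> s"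
proof -
  have le_s: "(\<Sum>v\<in>F. (cmod (w v))\<^sup>2) \<le> s" if "finite F" "F \<subseteq> V" for F
    using has_sum_mono2[OF has_sum_finite[OF that(1)] w that(2)] by simp
  have C: "cmod (w u) \<le> sqrt s" if "u \<in> V" for u
    using le_s[of "{u}"] that by (simp add: real_le_rsqrt)
  have fin: "(\<Sum>v\<in>S. (cmod (schr_evol adj Q t (\<lambda>u. if u \<in> F then w u else 0) v))\<^sup>2)
      \<le> s" if F: "finite F" "F \<subseteq> V" for F
  proof -
    obtain W where W: "field_approx W" "\<And>v. v \<in> V \<Longrightarrow> coef W v = (if v \<in> F then w v else 0)"
      using finite_support_field_approx[OF F, of w] by blast
    let ?A = "LINT \<theta>|mT. (\<Sum>v\<in>Vf. (cmod (W \<theta> v))\<^sup>2)"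
    have "((\<lambda>v. (cmod (coef W v))\<^sup>2) has_sum (\<Sum>v\<in>F. (cmod (w v))\<^sup>2)) V"
      using F W(2) by (intro has_sum_finite_neutralI) (auto simp: subset_iff intro!: sum.cong)
    then have A: "?A = (\<Sum>v\<in>F. (cmod (w v))\<^sup>2)" using has_sum_unique coef_norm[OF W(1)] by blast
    have e: "schr_evol adj Q t (\<lambda>u. if u \<in> F then w u else 0) v = coef (evolve 0 t W) v" if "v \<in> V" for v
      using schr_evol_coef[OF W(1) _ that, of "\<lambda>u. if u \<in> F then w u else 0" t 0] W(2) by simp
    have "(\<Sum>v\<in>S. (cmod (schr_evol adj Q t (\<lambda>u. if u \<in> F then w u else 0) v))\<^sup>2) =
        (\<Sum>v\<in>S. (cmod (coef (evolve 0 t W) v))\<^sup>2)"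
      using S e by (intro sum.cong refl) auto
    also have "\<dots> \<le> ?A"
      using has_sum_mono2[OF has_sum_finite[OF S(1)] coef_evolve_norm[OF W(1)] S(2)] by simp
    also have "\<dots> \<le> s" using A le_s[OF F] by simp
    finally show ?thesis .
  qed
  have lim: "((\<lambda>F. \<Sum>v\<in>S. (cmod (schr_evol adj Q t (\<lambda>u. if u \<in> F then w u else 0)
      v))\<^sup>2) \<longlongrightarrow> (\<Sum>v\<in>S. (cmod (schr_evol adj Q t w v))\<^sup>2)) (finite_subsets_at_top V)"
    using S by (intro tendsto_sum tendsto_power tendsto_norm schr_evol_cutoff_tendsto[where C="sqrt s"] C) auto
  have ev: "\<forall>\<^sub>F F in finite_subsets_at_top V. (\<Sum>v\<in>S. (cmod (schr_evol adj Q t (\<lambda>u.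
      if u \<in> F then w u else 0) v))\<^sup>2) \<le> s"
    unfolding eventually_finite_subsets_at_top using fin by (intro exI[of _ "{}"]) auto
  show ?thesis by (rule tendsto_upperbound[OF lim ev finite_subsets_at_top_neq_bot])
qed

end

subsection \<open>Regularity of the band functions\<close>

lemma cis_approx:
  "cmod (cis x - 1) \<le> \<bar>x\<bar>" "cmod (cis x - 1 - \<i> * complex_of_real x) \<le> x\<^sup>2"
proof -
  show "cmod (cis x - 1) \<le> \<bar>x\<bar>"
    using iexp_approx1[of x 0] by (simp add: cis_conv_exp)
  have "cmod (cis x - 1 - \<i> * complex_of_real x) \<le> x\<^sup>2 / 2"
    using iexp_approx1[of x 1] by (simp add: cis_conv_exp diff_diff_eq power2_eq_square)
  then show "cmod (cis x - 1 - \<i> * complex_of_real x) \<le> x\<^sup>2" using zero_le_power2[of x] by linarith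
qed

lemma AE_torus:
  assumes "AE x in lborel. P (x :: real^'d::finite)"
  shows "AE x in torus_measure. P x"
  using AE_completion[OF assms] by (auto simp: AE_restrict_space_iff torus_lebesgue elim: eventually_mono)

context floquet
begin

text \<open>The adjoint of \<open>\<tau>\<close>, which makes the phases linear forms in the torus
  variable.\<close>

definition dvec :: "real^'d \<Rightarrow> real^'d" where "dvec z = (\<chi> i. b i \<bullet> z)"

lemma theta_b_dvec: "\<tau> y \<bullet> z = y \<bullet> dvec z"
  by (simp add: theta_b_def dvec_def inner_sum_left inner_vec_def[of y])

definition band_sum :: "nat \<Rightarrow> real^'d \<Rightarrow> real" where "band_sum p \<theta> = (\<Sum>n<p. Ev \<theta> n)"

text \<open>The Rayleigh sum of the fibre at \<theta> with the eigenvectors frozen at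
  \<open>\<theta>0\<close>: a smooth function that lies above the band sum and touches it at
  \<open>\<theta>0\<close>.\<close>

definition trial :: "nat \<Rightarrow> real^'d \<Rightarrow> real^'d \<Rightarrow> real" where
  "trial p \<theta>0 \<theta> = (\<Sum>j<p. Re (ip Vf (\<phi> \<theta>0 j) (\<lambda>v. \<Sum>w\<in>Vf. kern
      (\<tau> \<theta>) v w * \<phi> \<theta>0 j w)))"

lemma band_sum_le_trial: "p \<le> card Vf \<Longrightarrow> band_sum p \<theta> \<le> trial p \<theta>0 \<theta>"
  unfolding band_sum_def trial_def
  by (intro fibre.ky_fan sorted fibre.orthonormal_basis_axioms)

lemma trial_self: "p \<le> card Vf \<Longrightarrow> trial p \<theta>0 \<theta>0 = band_sum p \<theta>0"
  unfolding band_sum_def trial_def by (intro sum.cong refl) (simp add: fibre.ip_apply fibre.orth)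

text \<open>Coefficients of \<open>trial\<close> as a trigonometric polynomial in the displacement
  from \<open>\<theta>0\<close>, with frequencies \<open>dvec (u - v)\<close>. The potential cancels
  in differences.\<close>

definition amplitude :: "real^'d \<Rightarrow> nat \<Rightarrow> real^'d \<Rightarrow> real^'d \<Rightarrow> complex" where
  "amplitude \<theta>0 j v u = cnj (\<phi> \<theta>0 j v) * cis (\<tau> \<theta>0 \<bullet> (u - v)) * \<phi> \<theta>0 j (fr u)"

lemma amplitude_le_1:
  assumes "j < card Vf" "v \<in> Vf" "u \<in> nb v"
  shows "cmod (amplitude \<theta>0 j v u) \<le> 1"
proof -
  have "cmod (\<phi> \<theta>0 j v) \<le> 1" "cmod (\<phi> \<theta>0 j (fr u)) \<le> 1"
    using fibre.phi_le_1[OF assms(1,2)] fibre.phi_le_1[OF assms(1) fr_Vf[OF nb_V[OF assms(3)]]] by auto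
  then show ?thesis by (simp add: amplitude_def norm_mult mult_le_one)
qed

lemma trial_diff:
  "trial p \<theta>0 (\<theta>0 + y) - trial p \<theta>0 \<theta>0
    = (\<Sum>j<p. \<Sum>v\<in>Vf. \<Sum>u\<in>nb v. Re (amplitude \<theta>0 j v u * (cis (y \<bullet> dvec (u - v)) - 1)))"
proof -
  have t: "trial p \<theta>0 \<theta> = (\<Sum>j<p. \<Sum>v\<in>Vf. Re (cnj (\<phi> \<theta>0 j v) * bloch_op a
      adj Q (\<tau> \<theta>) (\<phi> \<theta>0 j) v))" for \<theta>
    unfolding trial_def ip_def Re_sum by (intro sum.cong refl) (simp only: bloch_op_kern)
  have eq: "cnj (\<phi> \<theta>0 j v) * bloch_op a adj Q (\<tau> (\<theta>0 + y)) (\<phi> \<theta>0 j) v - cnj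
      (\<phi> \<theta>0 j v) * bloch_op a adj Q (\<tau> \<theta>0) (\<phi> \<theta>0 j) v
     = (\<Sum>u\<in>nb v. amplitude \<theta>0 j v u * (cis (y \<bullet> dvec (u - v)) - 1))" for j v
  proof -
    have "cnj (\<phi> \<theta>0 j v) * (cis (\<tau> (\<theta>0 + y) \<bullet> (u - v)) * \<phi> \<theta>0 j (fr
        u)) - cnj (\<phi> \<theta>0 j v) * (cis (\<tau> \<theta>0 \<bullet> (u - v)) * \<phi> \<theta>0 j (fr u))
      = amplitude \<theta>0 j v u * (cis (y \<bullet> dvec (u - v)) - 1)" for u
    proof -
      have "cis (\<tau> (\<theta>0 + y) \<bullet> (u - v)) = cis (\<tau> \<theta>0 \<bullet> (u - v)) * cis (y \<bullet> dvec (u - v))"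
        by (simp add: theta_b_add inner_add_left cis_mult theta_b_dvec)
      then show ?thesis by (simp add: amplitude_def algebra_simps)
    qed
    then show ?thesis
      unfolding bloch_op_cis distrib_left add_diff_add sum_distrib_left sum_subtractf[symmetric] by simp
  qed
  show ?thesis
    unfolding t sum_subtractf[symmetric] minus_complex.sel(1)[symmetric] eq Re_sum ..
qed

text \<open>At most \<open>card Vf\<close> frozen vectors contribute, each with amplitude at most 1
  per edge leaving the cell; what remains is the first power of the frequencies, and the second
  power in the next constant.\<close>

definition lip_const :: real where "lip_const = real (card Vf) * (\<Sum>v\<in>Vf. \<Sum>u\<in>nb v. norm (dvec (u - v)))"
definition semiconcave_const :: real where "semiconcave_const = real (card Vf) * (\<Sum>v\<in>Vf. \<Sum>u\<in>nb v. (norm (dvec (u - v)))\<^sup>2)"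

lemma lip_const_nonneg: "0 \<le> lip_const"
  unfolding lip_const_def by (intro mult_nonneg_nonneg sum_nonneg) auto

lemma triple_sum_bound:
  assumes p: "p \<le> card Vf" and c: "\<And>v u. 0 \<le> c v u"
    and f: "\<And>j v u. j < p \<Longrightarrow> v \<in> Vf \<Longrightarrow> u \<in> nb v \<Longrightarrow> f j v
        u \<le> c v u * z" and z: "0 \<le> z"
  shows "(\<Sum>j<p. \<Sum>v\<in>Vf. \<Sum>u\<in>nb v. f j v u) \<le> real (card Vf) * (\<Sum>v\<in>Vf. \<Sum>u\<in>nb v. c v u) * z"
proof -
  have "(\<Sum>j<p. \<Sum>v\<in>Vf. \<Sum>u\<in>nb v. f j v u) \<le> (\<Sum>j<p. \<Sum>v\<in>Vf. \<Sum>u\<in>nb v. c v u * z)"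
    using f by (intro sum_mono) auto
  also have "\<dots> = real p * ((\<Sum>v\<in>Vf. \<Sum>u\<in>nb v. c v u) * z)" by (simp add: sum_distrib_right)
  also have "\<dots> \<le> real (card Vf) * ((\<Sum>v\<in>Vf. \<Sum>u\<in>nb v. c v u) * z)"
    using p c z by (intro mult_right_mono mult_nonneg_nonneg sum_nonneg) auto
  finally show ?thesis by (simp add: mult.assoc)
qed

text \<open>The upper barrier through \<open>\<theta>0\<close> gives a one-sided estimate with a
  constant independent of \<open>\<theta>0\<close>; exchanging the two points supplies the other
  side.\<close>

lemma band_sum_lipschitz1:
  assumes "p \<le> card Vf"
  shows "band_sum p (\<theta>0 + y) - band_sum p \<theta>0 \<le> lip_const * norm y"
proof -
  have "band_sum p (\<theta>0 + y) - band_sum p \<theta>0 \<le> trial p \<theta>0 (\<theta>0 + y) - trial p \<theta>0 \<theta>0"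
    using band_sum_le_trial[OF assms, of "\<theta>0 + y" \<theta>0] trial_self[OF assms] by simp
  also have "\<dots> \<le> lip_const * norm y"
    unfolding trial_diff lip_const_def
  proof (rule triple_sum_bound[OF assms])
    fix j v u assume j: "j < p" and v: "v \<in> Vf" and u: "u \<in> nb v"
    have "Re (amplitude \<theta>0 j v u * (cis (y \<bullet> dvec (u - v)) - 1)) \<le> cmod (amplitude \<theta>0 j
        v u) * cmod (cis (y \<bullet> dvec (u - v)) - 1)"
      by (metis complex_Re_le_cmod norm_mult)
    also have "\<dots> \<le> 1 * \<bar>y \<bullet> dvec (u - v)\<bar>"
      using amplitude_le_1[OF _ v u] j assms cis_approx(1) by (intro mult_mono) auto
    also have "\<dots> \<le> norm (dvec (u - v)) * norm y"
      using Cauchy_Schwarz_ineq2[of y "dvec (u - v)"] by (simp add: mult.commute)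
    finally show "Re (amplitude \<theta>0 j v u * (cis (y \<bullet> dvec (u - v)) - 1)) \<le> norm (dvec (u - v)) * norm y" .
  qed auto
  finally show ?thesis .
qed

lemma band_sum_lipschitz:
  assumes "p \<le> card Vf"
  shows "\<bar>band_sum p \<theta> - band_sum p \<theta>'\<bar> \<le> lip_const * norm (\<theta> - \<theta>')"
  using band_sum_lipschitz1[OF assms, of \<theta> "\<theta>' - \<theta>"] band_sum_lipschitz1[OF assms, of \<theta>' "\<theta> - \<theta>'"]
  by (simp add: norm_minus_commute)

lemma Ev_band_sum: "Ev \<theta> n = band_sum (Suc n) \<theta> - band_sum n \<theta>"
  by (simp add: band_sum_def)

text \<open>A band is the difference of two consecutive band sums, hence the factor 2.\<close>

lemma Ev_lipschitz:
  assumes "n < card Vf"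
  shows "\<bar>Ev \<theta> n - Ev \<theta>' n\<bar> \<le> 2 * lip_const * norm (\<theta> - \<theta>')"
  using band_sum_lipschitz[of n \<theta> \<theta>'] band_sum_lipschitz[of "Suc n" \<theta> \<theta>'] assms by (simp add: Ev_band_sum)

text \<open>Second-order Taylor expansion of the barrier at \<open>\<theta>0\<close>; its quadratic
  error is bounded independently of \<open>\<theta>0\<close> because the frequencies do not depend
  on it.\<close>

lemma band_sum_semiconcave:
  assumes p: "p \<le> card Vf"
  shows "\<exists>P. \<forall>y. band_sum p (\<theta>0 + y) \<le> band_sum p \<theta>0 + P \<bullet> y + semiconcave_const * (norm y)\<^sup>2"
proof (intro exI allI)
  fix y
  \<comment> \<open>The gradient of \<open>trial p \<theta>0\<close> at \<open>\<theta>0\<close>: to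
    first order \<open>cis x - 1\<close> is ix, and the real part of a product with i is minus the
    imaginary part.\<close>
  let ?P = "\<Sum>j<p. \<Sum>v\<in>Vf. \<Sum>u\<in>nb v. (- Im (amplitude \<theta>0 j v u)) *\<^sub>R dvec (u - v)"
  have "trial p \<theta>0 (\<theta>0 + y) - trial p \<theta>0 \<theta>0 - ?P \<bullet> y
      = (\<Sum>j<p. \<Sum>v\<in>Vf. \<Sum>u\<in>nb v. Re (amplitude \<theta>0 j v u * (cis (y \<bullet> dvec (u -
          v)) - 1)) + Im (amplitude \<theta>0 j v u) * (y \<bullet> dvec (u - v)))"
    unfolding trial_diff inner_sum_left by (simp add: inner_commute[of _ y] sum.distrib sum_negf)
  also have "\<dots> \<le> semiconcave_const * (norm y)\<^sup>2"
    unfolding semiconcave_const_def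
  proof (rule triple_sum_bound[OF p])
    fix j v u assume j: "j < p" and v: "v \<in> Vf" and u: "u \<in> nb v"
    let ?x = "y \<bullet> dvec (u - v)"
    have "Re (amplitude \<theta>0 j v u * (cis ?x - 1)) + Im (amplitude \<theta>0 j v u) * ?x = Re (amplitude
        \<theta>0 j v u * (cis ?x - 1 - \<i> * complex_of_real ?x))"
      by (simp add: algebra_simps)
    also have "\<dots> \<le> cmod (amplitude \<theta>0 j v u) * cmod (cis ?x - 1 - \<i> * complex_of_real ?x)"
      by (metis complex_Re_le_cmod norm_mult)
    also have "\<dots> \<le> 1 * ?x\<^sup>2"
      using amplitude_le_1[OF _ v u] j p cis_approx(2) by (intro mult_mono) auto
    also have "\<dots> \<le> (norm (dvec (u - v)))\<^sup>2 * (norm y)\<^sup>2"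
      using power_mono[OF Cauchy_Schwarz_ineq2[of y "dvec (u - v)"], of 2] by (simp add: power_mult_distrib mult.commute)
    finally show "Re (amplitude \<theta>0 j v u * (cis ?x - 1)) + Im (amplitude \<theta>0 j v u) * ?x \<le> (norm
        (dvec (u - v)))\<^sup>2 * (norm y)\<^sup>2" .
  qed auto
  finally show "band_sum p (\<theta>0 + y) \<le> band_sum p \<theta>0 + ?P \<bullet> y + semiconcave_const * (norm y)\<^sup>2"
    using band_sum_le_trial[OF p, of "\<theta>0 + y" \<theta>0] trial_self[OF p, of \<theta>0] by linarith
qed

lemma band_sum_AE_differentiable:
  assumes p: "p \<le> card Vf"
  shows "AE \<theta> in lborel. band_sum p differentiable (at \<theta>)"
proof -
  obtain P where P: "\<And>\<theta> y. band_sum p (\<theta> + y) \<le> band_sum p \<theta> + P \<theta> \<bullet>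
      y + semiconcave_const * (norm y)\<^sup>2"
    using band_sum_semiconcave[OF p] by metis
  \<comment> \<open>Because \<open>y \<bullet> y\<close> exceeds its tangent at \<open>x\<close> by
    exactly the squared distance, the quadratic error of the barrier is absorbed and twice the
    constant times \<open>x\<close>, minus \<open>P x\<close>, is a subgradient.\<close>
  define f where "f \<theta> = semiconcave_const * (\<theta> \<bullet> \<theta>) - band_sum p \<theta>" for \<theta>
  have "AE \<theta> in lborel. f differentiable (at \<theta>)"
  proof (rule convex_AE_differentiable[where p="\<lambda>\<theta>. (2 * semiconcave_const) *\<^sub>R \<theta> - P \<theta>"])
    fix x y
    show "f x + ((2 * semiconcave_const) *\<^sub>R x - P x) \<bullet> (y - x) \<le> f y"
      using P[of x "y - x"]
      by (simp add: f_def dot_square_norm[symmetric] inner_diff_left inner_diff_right inner_commute[of y x] algebra_simps)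
  qed
  then show ?thesis
  proof eventually_elim
    case (elim \<theta>)
    have "(\<lambda>\<theta>. semiconcave_const * (\<theta> \<bullet> \<theta>) - f \<theta>) differentiable (at \<theta>)"
      using elim by (intro differentiable_diff differentiable_mult differentiable_const
        differentiable_inner differentiable_ident)
    then show ?case by (simp add: f_def[abs_def])
  qed
qed

section \<open>Derivatives of the bands and the group velocity\<close>

definition regular :: "real^'d \<Rightarrow> bool" where
  "regular \<theta> \<longleftrightarrow> (\<forall>n<card Vf. (\<lambda>\<theta>. Ev \<theta> n) differentiable (at \<theta>))"

lemma AE_regular: "AE \<theta> in lborel. regular \<theta>"
proof -
  have "AE \<theta> in lborel. \<forall>p\<in>{..card Vf}. band_sum p differentiable (at \<theta>)"
    by (subst AE_finite_all) (auto intro: band_sum_AE_differentiable)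
  then show ?thesis
  proof eventually_elim
    case (elim \<theta>)
    show ?case unfolding regular_def
    proof (intro allI impI)
      fix n assume "n < card Vf"
      then have "(\<lambda>\<theta>. band_sum (Suc n) \<theta> - band_sum n \<theta>) differentiable (at \<theta>)"
        using elim by (intro differentiable_diff) auto
      then show "(\<lambda>\<theta>. Ev \<theta> n) differentiable (at \<theta>)" by (simp only: Ev_band_sum)
    qed
  qed
qed

definition dE :: "nat \<Rightarrow> real^'d \<Rightarrow> real^'d \<Rightarrow> real" where
  "dE n \<theta> = frechet_derivative (\<lambda>\<theta>. Ev \<theta> n) (at \<theta>)"

lemma dE_works: "regular \<theta> \<Longrightarrow> n < card Vf \<Longrightarrow> ((\<lambda>\<theta>. Ev \<theta>
    n) has_derivative dE n \<theta>) (at \<theta>)"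
  unfolding regular_def dE_def frechet_derivative_works by simp

lemma Ev_line_deriv:
  assumes "regular \<theta>" "n < card Vf"
  shows "((\<lambda>s. Ev (\<theta> + s *\<^sub>R x) n) has_real_derivative dE n \<theta> x) (at 0)"
proof -
  have l: "linear (dE n \<theta>)" using dE_works[OF assms] has_derivative_linear by blast
  have E: "((\<lambda>\<theta>. Ev \<theta> n) has_derivative dE n \<theta>) (at (\<theta> + 0 *\<^sub>R x))"
    using dE_works[OF assms] by simp
  have "((\<lambda>s. \<theta> + s *\<^sub>R x) has_derivative (\<lambda>s. s *\<^sub>R x)) (at 0)"
    by (auto intro!: derivative_eq_intros)
  from has_derivative_compose[OF this E]
  show ?thesis unfolding has_field_derivative_def
    by (simp add: linear_scale[OF l] mult_commute_abs)
qed

lemma band_partial_dE: "regular \<theta> \<Longrightarrow> n < card Vf \<Longrightarrow> band_partial Ev n \<theta> i = dE n \<theta> (axis i 1)"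
  unfolding band_partial_def by (rule DERIV_imp_deriv[OF Ev_line_deriv])

lemma dE_expand:
  assumes "regular \<theta>" "n < card Vf"
  shows "dE n \<theta> x = (\<Sum>i\<in>UNIV. x $ i * band_partial Ev n \<theta> i)"
proof -
  have l: "linear (dE n \<theta>)" using dE_works[OF assms] has_derivative_linear by blast
  have "dE n \<theta> x = dE n \<theta> (\<Sum>i\<in>UNIV. x $ i *\<^sub>R axis i 1)"
    using basis_expansion[of x] by (simp add: scalar_mult_eq_scaleR)
  then show ?thesis by (simp add: linear_sum[OF l] linear_scale[OF l] band_partial_dE[OF assms])
qed

text \<open>The difference of the two ordered bands is nonnegative and 0 at \<theta>, so it has a
  minimum there and its derivative vanishes. Hence the group velocity belongs to the eigenvalue and
  not to the choice of eigenvectors.\<close>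

lemma dE_cluster:
  assumes r: "regular \<theta>" and nm: "n \<le> m" "m < card Vf" and eq: "Ev \<theta> n = Ev \<theta> m"
  shows "dE n \<theta> = dE m \<theta>"
proof -
  have n: "n < card Vf" using nm by simp
  have "((\<lambda>\<theta>. Ev \<theta> m - Ev \<theta> n) has_derivative (\<lambda>y. dE m \<theta> y - dE n \<theta> y)) (at \<theta>)"
    by (intro has_derivative_diff dE_works r n nm)
  then have "(\<lambda>y. dE m \<theta> y - dE n \<theta> y) = (\<lambda>v. 0)"
    by (rule differential_zero_maxmin[where S=UNIV, rotated 2]) (use eq sorted[OF nm] in auto)
  then have "dE m \<theta> y - dE n \<theta> y = 0" for y by (rule fun_cong)
  then show ?thesis by (intro ext) simp
qed

text \<open>The normalisation of \<open>group_vel\<close> cancels the factor 2 pi of the dual basis,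
  so pairing with \<open>\<tau> \<xi>\<close> yields the derivative in direction
  \<open>\<xi>\<close>.\<close>

lemma group_vel_inner:
  assumes "regular \<theta>" "n < card Vf"
  shows "\<tau> \<xi> \<bullet> group_vel a Ev (\<theta>, n) = dE n \<theta> \<xi>"
  unfolding dE_expand[OF assms] group_vel_def
  by (simp add: inner_sum_right theta_b_inner_a sum_distrib_left mult_ac)

lemma band_partial_bound:
  assumes "regular \<theta>" "n < card Vf"
  shows "\<bar>band_partial Ev n \<theta> i\<bar> \<le> 2 * lip_const"
proof -
  have "((\<lambda>s. (Ev (\<theta> + (0 + s) *\<^sub>R axis i 1) n - Ev (\<theta> + 0 *\<^sub>R axis i 1) n) / s)
      \<longlongrightarrow> dE n \<theta> (axis i 1)) (at 0)"
    using Ev_line_deriv[OF assms, of "axis i 1"] unfolding DERIV_def .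
  then have lim: "((\<lambda>s. \<bar>(Ev (\<theta> + s *\<^sub>R axis i 1) n - Ev \<theta> n) / s\<bar>)
      \<longlongrightarrow> \<bar>dE n \<theta> (axis i 1)\<bar>) (at 0)"
    by (intro tendsto_rabs) simp
  have "\<bar>dE n \<theta> (axis i 1)\<bar> \<le> 2 * lip_const"
  proof (rule tendsto_upperbound[OF lim])
    show "\<forall>\<^sub>F s in at 0. \<bar>(Ev (\<theta> + s *\<^sub>R axis i 1) n - Ev \<theta> n) / s\<bar> \<le> 2 * lip_const"
      unfolding eventually_at
    proof (intro exI[of _ 1] conjI ballI impI)
      fix s :: real assume "s \<noteq> 0 \<and> dist s 0 < 1"
      then show "\<bar>(Ev (\<theta> + s *\<^sub>R axis i 1) n - Ev \<theta> n) / s\<bar> \<le> 2 * lip_const"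
        using Ev_lipschitz[OF assms(2), of "\<theta> + s *\<^sub>R axis i 1" \<theta>] by (simp add: pos_divide_le_eq)
    qed simp
  qed simp
  then show ?thesis by (simp add: band_partial_dE[OF assms])
qed

definition max_speed :: real where "max_speed = (1 / (2 * pi)) * (\<Sum>i\<in>UNIV. 2 * lip_const * norm (a i))"

lemma group_vel_bound:
  assumes "regular \<theta>" "n < card Vf"
  shows "norm (group_vel a Ev (\<theta>, n)) \<le> max_speed"
proof -
  have "norm (\<Sum>i\<in>UNIV. band_partial Ev n \<theta> i *\<^sub>R a i) \<le> (\<Sum>i\<in>UNIV. 2 * lip_const * norm (a i))"
    using band_partial_bound[OF assms] by (intro order_trans[OF norm_sum] sum_mono) (auto intro!: mult_right_mono)
  then show ?thesis unfolding group_vel_def max_speed_def by (simp add: divide_right_mono)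
qed

lemma Ev_quotient_tendsto:
  assumes "regular \<theta>" "n < card Vf"
  shows "((\<lambda>t. t * (Ev \<theta> n - Ev (\<theta> - (1 / t) *\<^sub>R \<xi>) n)) \<longlongrightarrow> dE n \<theta> \<xi>) at_top"
proof -
  have l: "linear (dE n \<theta>)" using dE_works[OF assms] has_derivative_linear by blast
  have "((\<lambda>s. (Ev (\<theta> + s *\<^sub>R (- \<xi>)) n - Ev \<theta> n) / s) \<longlongrightarrow> dE n \<theta> (- \<xi>)) (at 0)"
    using Ev_line_deriv[OF assms, of "- \<xi>"] unfolding DERIV_def by simp
  then have "((\<lambda>s. (Ev (\<theta> + s *\<^sub>R (- \<xi>)) n - Ev \<theta> n) / s) \<longlongrightarrow> - dE n \<theta> \<xi>) (at_right 0)"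
    by (simp add: linear_neg[OF l] filterlim_at_split)
  from filterlim_compose[OF this filterlim_inverse_at_right_top]
  have "((\<lambda>t. - ((Ev (\<theta> + inverse t *\<^sub>R (- \<xi>)) n - Ev \<theta> n) / inverse t))
      \<longlongrightarrow> - (- dE n \<theta> \<xi>)) at_top"
    by (rule tendsto_minus)
  then show ?thesis by (simp add: field_simps)
qed

end

subsection \<open>Convergence of the characteristic functions\<close>

lemma tendsto_cis_compose: "(f \<longlongrightarrow> l) F \<Longrightarrow> ((\<lambda>x. cis (f x)) \<longlongrightarrow> cis l) F"
  by (rule continuous_on_tendsto_compose[of UNIV cis]) (auto intro!: continuous_intros)

context floquet
begin

lemma shift_tendsto: "((\<lambda>t::real. \<theta> - (1 / t) *\<^sub>R \<xi>) \<longlongrightarrow> (\<theta>::real^'d)) at_top"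
proof -
  have "((\<lambda>t::real. 1 / t) \<longlongrightarrow> 0) at_top"
    using tendsto_inverse_0_at_top[OF filterlim_ident] by (simp add: inverse_eq_divide)
  then have "((\<lambda>t::real. \<theta> - (1 / t) *\<^sub>R \<xi>) \<longlongrightarrow> \<theta> - 0 *\<^sub>R
      \<xi>) at_top" by (intro tendsto_intros)
  then show ?thesis by simp
qed

lemma kern_tendsto: "((\<lambda>t. kern (\<tau> (\<theta> - (1 / t) *\<^sub>R \<xi>)) v w) \<longlongrightarrow> kern (\<tau> \<theta>) v w) at_top"
proof -
  have "((\<lambda>t. \<tau> (\<theta> - (1 / t) *\<^sub>R \<xi>)) \<longlongrightarrow> \<tau> \<theta>) at_top"
    using linear_theta_b by (intro bounded_linear.tendsto[OF _ shift_tendsto]) (simp add: linear_conv_bounded_linear)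
  then have "((\<lambda>t. cis (\<tau> (\<theta> - (1 / t) *\<^sub>R \<xi>) \<bullet> (u - v)))
      \<longlongrightarrow> cis (\<tau> \<theta> \<bullet> (u - v))) at_top" for u
    by (intro tendsto_cis_compose tendsto_intros)
  then show ?thesis unfolding kern_def by (intro tendsto_add tendsto_sum tendsto_const)
qed

lemma Ev_tendsto:
  assumes "n < card Vf"
  shows "((\<lambda>t. Ev (\<theta> - (1 / t) *\<^sub>R \<xi>) n) \<longlongrightarrow> Ev \<theta> n) at_top"
proof -
  have "((\<lambda>t. 2 * lip_const * norm (\<theta> - (1 / t) *\<^sub>R \<xi> - \<theta>)) \<longlongrightarrow>
      2 * lip_const * norm (\<theta> - \<theta>)) at_top"
    by (intro tendsto_intros shift_tendsto)
  then have z: "((\<lambda>t. 2 * lip_const * norm (\<theta> - (1 / t) *\<^sub>R \<xi> - \<theta>)) \<longlongrightarrow> 0) at_top" by simp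
  have "((\<lambda>t. Ev (\<theta> - (1 / t) *\<^sub>R \<xi>) n - Ev \<theta> n) \<longlongrightarrow> 0) at_top"
    by (rule Lim_null_comparison[OF always_eventually[OF allI] z], unfold real_norm_def, rule Ev_lipschitz[OF assms])
  then show ?thesis using Lim_null by blast
qed

lemma overlap_le_1:
  assumes "n < card Vf" "m < card Vf"
  shows "cmod (ip Vf (\<phi> \<theta> n) (\<phi> \<theta>' m)) \<le> 1"
  using ip_bound[of Vf "\<phi> \<theta> n" "\<phi> \<theta>' m"] by (simp add: fibre.norm_phi assms)

text \<open>Off-diagonal overlaps vanish because the difference of the eigenvalues times the overlap
  is a matrix element of the difference of the two fibres.\<close>

lemma overlap_tendsto:
  assumes n: "n < card Vf" and m: "m < card Vf" and ne: "Ev \<theta> n \<noteq> Ev \<theta> m"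
  shows "((\<lambda>t. ip Vf (\<phi> \<theta> n) (\<phi> (\<theta> - (1 / t) *\<^sub>R \<xi>) m)) \<longlongrightarrow> 0) at_top"
proof -
  define \<theta>' where "\<theta>' t = \<theta> - (1 / t) *\<^sub>R \<xi>" for t
  define o' where "o' t = ip Vf (\<phi> \<theta> n) (\<phi> (\<theta>' t) m)" for t
  define d where "d t = Ev (\<theta>' t) m - Ev \<theta> n" for t
  have eq: "complex_of_real (d t) * o' t = (\<Sum>v\<in>Vf. \<Sum>w\<in>Vf. cnj (\<phi> \<theta> n v) * (kern
      (\<tau> (\<theta>' t)) v w - kern (\<tau> \<theta>) v w) * \<phi> (\<theta>' t) m w)" for t
  proof -
    have 1: "complex_of_real (Ev \<theta> n) * o' t = (\<Sum>v\<in>Vf. cnj (\<phi> \<theta> n v) *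
        (\<Sum>w\<in>Vf. kern (\<tau> \<theta>) v w * \<phi> (\<theta>' t) m w))"
      unfolding o'_def using fibre.ip_apply[OF n, of \<theta> "\<phi> (\<theta>' t) m"] by (simp add: ip_def)
    have 2: "complex_of_real (Ev (\<theta>' t) m) * o' t = (\<Sum>v\<in>Vf. cnj (\<phi> \<theta> n v) *
        (\<Sum>w\<in>Vf. kern (\<tau> (\<theta>' t)) v w * \<phi> (\<theta>' t) m w))"
      unfolding o'_def ip_def sum_distrib_left[of "complex_of_real _"]
      by (intro sum.cong refl) (simp add: fibre.eig[OF m])
    show ?thesis unfolding d_def of_real_diff left_diff_distrib 1 2
      by (simp add: sum_distrib_left algebra_simps sum_subtractf)
  qed
  have "((\<lambda>t. complex_of_real (d t) * o' t) \<longlongrightarrow> 0) at_top"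
  proof (rule Lim_null_comparison)
    have "cmod (cnj (\<phi> \<theta> n v) * z * \<phi> (\<theta>' t) m w) \<le> cmod z" if "v \<in> Vf" "w \<in> Vf" for v w z t
    proof -
      have "cmod (\<phi> \<theta> n v) * cmod z * cmod (\<phi> (\<theta>' t) m w) \<le> 1 * cmod z * 1"
        using fibre.phi_le_1[OF n that(1)] fibre.phi_le_1[OF m that(2)] by (intro mult_mono) auto
      then show ?thesis by (simp add: norm_mult)
    qed
    then have "cmod (complex_of_real (d t) * o' t) \<le> (\<Sum>v\<in>Vf. \<Sum>w\<in>Vf. cmod (kern (\<tau>
        (\<theta>' t)) v w - kern (\<tau> \<theta>) v w))" for t
      unfolding eq by (intro sum_norm_le) auto
    then show "\<forall>\<^sub>F t in at_top. cmod (complex_of_real (d t) * o' t) \<le> (\<Sum>v\<in>Vf.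
        \<Sum>w\<in>Vf. cmod (kern (\<tau> (\<theta>' t)) v w - kern (\<tau> \<theta>) v w))"
      by (intro always_eventually allI)
    have "((\<lambda>t. \<Sum>v\<in>Vf. \<Sum>w\<in>Vf. cmod (kern (\<tau> (\<theta>' t)) v w - kern (\<tau>
        \<theta>) v w)) \<longlongrightarrow> (\<Sum>v\<in>Vf. \<Sum>w\<in>Vf. cmod (kern (\<tau> \<theta>) v w -
        kern (\<tau> \<theta>) v w))) at_top"
      unfolding \<theta>'_def by (intro tendsto_intros kern_tendsto)
    then show "((\<lambda>t. \<Sum>v\<in>Vf. \<Sum>w\<in>Vf. cmod (kern (\<tau> (\<theta>' t)) v w - kern (\<tau>
        \<theta>) v w)) \<longlongrightarrow> 0) at_top" by simp
  qed
  moreover have d_lim: "(d \<longlongrightarrow> Ev \<theta> m - Ev \<theta> n) at_top"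
    unfolding d_def[abs_def] \<theta>'_def by (intro tendsto_intros Ev_tendsto m)
  ultimately have "((\<lambda>t. (complex_of_real (d t) * o' t) / complex_of_real (d t)) \<longlongrightarrow> 0 /
      complex_of_real (Ev \<theta> m - Ev \<theta> n)) at_top"
    using ne by (intro tendsto_divide tendsto_of_real) auto
  moreover have "\<forall>\<^sub>F t in at_top. (complex_of_real (d t) * o' t) / complex_of_real (d t) = o' t"
    using tendsto_imp_eventually_ne[OF d_lim, of 0] ne by (auto elim: eventually_mono)
  ultimately have "(o' \<longlongrightarrow> 0) at_top" by (simp add: tendsto_cong)
  then show ?thesis by (simp add: o'_def[abs_def] \<theta>'_def)
qed

text \<open>Both sides become double sums with the same overlaps, so their difference can be treated
  termwise. For equal eigenvalues the phases converge and the overlaps are merely bounded; for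
  different eigenvalues the overlaps vanish and the phases are merely bounded.\<close>

lemma evo_overlap_tendsto:
  assumes r: "regular \<theta>"
  shows "((\<lambda>t. ip Vf (fibre.evo \<theta> t x) (fibre.evo (\<theta> - (1 / t) *\<^sub>R \<xi>) t x)) \<longlongrightarrow>
    (\<Sum>n<card Vf. complex_of_real ((cmod (ip Vf (\<phi> \<theta> n) x))\<^sup>2) * cis (dE n \<theta> \<xi>))) at_top"
proof -
  define \<theta>' where "\<theta>' t = \<theta> - (1 / t) *\<^sub>R \<xi>" for t
  let ?o = "\<lambda>t n m. ip Vf (\<phi> \<theta> n) (\<phi> (\<theta>' t) m)"
  let ?x = "\<lambda>n. ip Vf (\<phi> \<theta> n) x"
  let ?x' = "\<lambda>t m. ip Vf (\<phi> (\<theta>' t) m) x"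
  have lhs: "ip Vf (fibre.evo \<theta> t x) (fibre.evo (\<theta>' t) t x)
      = (\<Sum>n<card Vf. \<Sum>m<card Vf. cis (t * (Ev \<theta> n - Ev (\<theta>' t) m)) * cnj (?x n) * ?x' t m * ?o t n m)" for t
  proof -
    have 1: "ip Vf (fibre.evo \<theta> t x) (\<phi> \<theta> n) = cis (t * Ev \<theta> n) * cnj (?x n)" if "n < card Vf" for n
    proof -
      have "ip Vf (\<phi> \<theta> n) (fibre.evo \<theta> t x) = cis (- (t * Ev \<theta> n)) * ?x n"
        unfolding fibre.evo_def[abs_def] using fibre.ip_phi_sum[OF that, of \<theta> "\<lambda>n. cis (- (t * Ev \<theta> n)) * ?x n"] by simp
      then have "cnj (ip Vf (\<phi> \<theta> n) (fibre.evo \<theta> t x)) = cnj (cis (- (t * Ev \<theta> n)) * ?x n)" by simp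
      then show ?thesis by (simp add: ip_cnj cis_cnj)
    qed
    have 2: "ip Vf (\<phi> \<theta> n) (fibre.evo (\<theta>' t) t x) = (\<Sum>m<card Vf. cis (- (t * Ev (\<theta>' t) m)) * ?x' t m * ?o t n m)" for n
      unfolding fibre.evo_def[abs_def] by (rule fibre.ip_sum_right)
    have "ip Vf (fibre.evo \<theta> t x) (fibre.evo (\<theta>' t) t x) = (\<Sum>n<card Vf. ip Vf (\<phi> \<theta>
        n) (fibre.evo (\<theta>' t) t x) * ip Vf (fibre.evo \<theta> t x) (\<phi> \<theta> n))"
      by (rule fibre.ip_expand)
    also have "\<dots> = (\<Sum>n<card Vf. \<Sum>m<card Vf. cis (t * (Ev \<theta> n - Ev (\<theta>' t) m)) * cnj (?x n) * ?x' t m * ?o t n m)"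
    proof (intro sum.cong refl)
      fix n assume "n \<in> {..<card Vf}"
      then have n: "n < card Vf" by simp
      show "ip Vf (\<phi> \<theta> n) (fibre.evo (\<theta>' t) t x) * ip Vf (fibre.evo \<theta> t x) (\<phi> \<theta> n)
          = (\<Sum>m<card Vf. cis (t * (Ev \<theta> n - Ev (\<theta>' t) m)) * cnj (?x n) * ?x' t m * ?o t n m)"
        unfolding 1[OF n] 2 sum_distrib_right
      proof (intro sum.cong refl)
        fix m
        have "cis (t * (Ev \<theta> n - Ev (\<theta>' t) m)) = cis (- (t * Ev (\<theta>' t) m)) * cis (t * Ev \<theta> n)"
          by (simp add: cis_mult algebra_simps)
        then show "cis (- (t * Ev (\<theta>' t) m)) * ?x' t m * ?o t n m * (cis (t * Ev \<theta> n) * cnj (?x n))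
            = cis (t * (Ev \<theta> n - Ev (\<theta>' t) m)) * cnj (?x n) * ?x' t m * ?o t n m" by (simp only: mult_ac)
      qed
    qed
    finally show ?thesis .
  qed
  \<comment> \<open>The limit is deliberately expanded in the eigenbasis at
    \<open>\<theta>' t\<close>; by completeness the value does not depend on \<open>t\<close>,
    although every term does.\<close>
  have rhs: "(\<Sum>n<card Vf. complex_of_real ((cmod (?x n))\<^sup>2) * cis (dE n \<theta> \<xi>))
      = (\<Sum>n<card Vf. \<Sum>m<card Vf. cis (dE n \<theta> \<xi>) * cnj (?x n) * ?x' t m * ?o t n m)" for t
  proof (intro sum.cong refl)
    fix n
    have "complex_of_real ((cmod (?x n))\<^sup>2) * cis (dE n \<theta> \<xi>) = cis (dE n \<theta> \<xi>) * cnj (?x n) * ?x n"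
      by (simp add: complex_norm_square mult_ac del: of_real_power)
    also have "\<dots> = cis (dE n \<theta> \<xi>) * cnj (?x n) * (\<Sum>m<card Vf. ?x' t m * ?o t n m)"
      by (rule arg_cong[OF fibre.ip_expand])
    finally show "complex_of_real ((cmod (?x n))\<^sup>2) * cis (dE n \<theta> \<xi>) = (\<Sum>m<card Vf. cis (dE
        n \<theta> \<xi>) * cnj (?x n) * ?x' t m * ?o t n m)"
      by (simp add: sum_distrib_left mult.assoc)
  qed
  have trm: "((\<lambda>t. (cis (t * (Ev \<theta> n - Ev (\<theta>' t) m)) - cis (dE n \<theta> \<xi>)) * cnj (?x
      n) * ?x' t m * ?o t n m) \<longlongrightarrow> 0) at_top"
    if n: "n < card Vf" and m: "m < card Vf" for n m
  proof -
    \<comment> \<open>A bound for the coefficients of \<open>x\<close> that holds for every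
      eigenbasis, since the eigenvectors at \<open>\<theta>' t\<close> may behave erratically in
      \<open>t\<close>.\<close>
    define B where "B = (\<Sum>v\<in>Vf. cmod (x v))"
    have xb: "cmod (?x' t m) \<le> B" for t
      unfolding ip_def B_def using fibre.phi_le_1[OF m]
      by (intro sum_norm_le) (auto simp: norm_mult intro!: mult_left_le_one_le)
    have B0: "0 \<le> B" unfolding B_def by (intro sum_nonneg) auto
    show ?thesis
    proof (cases "Ev \<theta> n = Ev \<theta> m")
      case True
      have "dE n \<theta> = dE m \<theta>"
      proof (cases "n \<le> m")
        case le: True
        show ?thesis by (rule dE_cluster[OF r le m True])
      next
        case False
        then have "m \<le> n" by simp
        from dE_cluster[OF r this n True[symmetric]] show ?thesis by (rule sym)
      qed
      then have L: "((\<lambda>t. t * (Ev \<theta> n - Ev (\<theta>' t) m)) \<longlongrightarrow> dE n \<theta> \<xi>) at_top"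
        unfolding True \<theta>'_def using Ev_quotient_tendsto[OF r m, of \<xi>] by (simp only:)
      have "((\<lambda>t. cmod (cis (t * (Ev \<theta> n - Ev (\<theta>' t) m)) - cis (dE n \<theta> \<xi>)) * cmod
          (?x n) * B) \<longlongrightarrow> cmod (cis (dE n \<theta> \<xi>) - cis (dE n \<theta> \<xi>)) * cmod (?x n) * B) at_top"
        by (intro L tendsto_cis_compose tendsto_norm tendsto_diff tendsto_mult tendsto_const)
      then have z: "((\<lambda>t. cmod (cis (t * (Ev \<theta> n - Ev (\<theta>' t) m)) - cis (dE n \<theta>
          \<xi>)) * cmod (?x n) * B) \<longlongrightarrow> 0) at_top" by simp
      show ?thesis
      proof (rule Lim_null_comparison[OF always_eventually[OF allI] z])
        fix t
        have "cmod (cis (t * (Ev \<theta> n - Ev (\<theta>' t) m)) - cis (dE n \<theta> \<xi>)) * cmod (?x n) * cmod (?x' t m) * cmod (?o t n m)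
          \<le> cmod (cis (t * (Ev \<theta> n - Ev (\<theta>' t) m)) - cis (dE n \<theta> \<xi>)) * cmod (?x n) * B * 1"
          using xb overlap_le_1[OF n m] B0 by (intro mult_mono) auto
        then show "cmod ((cis (t * (Ev \<theta> n - Ev (\<theta>' t) m)) - cis (dE n \<theta> \<xi>)) * cnj (?x n) * ?x' t m * ?o t n m)
           \<le> cmod (cis (t * (Ev \<theta> n - Ev (\<theta>' t) m)) - cis (dE n \<theta> \<xi>)) * cmod (?x n) * B" by (simp add: norm_mult)
      qed
    next
      case False
      have "((\<lambda>t. 2 * cmod (?x n) * B * cmod (?o t n m)) \<longlongrightarrow> 2 * cmod (?x n) * B * cmod 0) at_top"
        unfolding \<theta>'_def by (intro tendsto_intros overlap_tendsto n m False)
      then have z: "((\<lambda>t. 2 * cmod (?x n) * B * cmod (?o t n m)) \<longlongrightarrow> 0) at_top" by simp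
      show ?thesis
      proof (rule Lim_null_comparison[OF always_eventually[OF allI] z])
        fix t
        have "cmod (cis (t * (Ev \<theta> n - Ev (\<theta>' t) m)) - cis (dE n \<theta> \<xi>)) \<le> 2"
          using norm_triangle_ineq4[of "cis (t * (Ev \<theta> n - Ev (\<theta>' t) m))" "cis (dE n \<theta> \<xi>)"] by simp
        then have "cmod (cis (t * (Ev \<theta> n - Ev (\<theta>' t) m)) - cis (dE n \<theta> \<xi>)) * cmod (?x n) * cmod (?x' t m) * cmod (?o t n m)
          \<le> 2 * cmod (?x n) * B * cmod (?o t n m)"
          using xb B0 by (intro mult_mono) auto
        then show "cmod ((cis (t * (Ev \<theta> n - Ev (\<theta>' t) m)) - cis (dE n \<theta> \<xi>)) * cnj (?x n) * ?x' t m * ?o t n m)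
           \<le> 2 * cmod (?x n) * B * cmod (?o t n m)" by (simp add: norm_mult)
      qed
    qed
  qed
  have "((\<lambda>t. \<Sum>n<card Vf. \<Sum>m<card Vf. (cis (t * (Ev \<theta> n - Ev (\<theta>' t) m)) - cis (dE
      n \<theta> \<xi>)) * cnj (?x n) * ?x' t m * ?o t n m) \<longlongrightarrow> (\<Sum>n<card Vf. \<Sum>m<card Vf. 0)) at_top"
    by (intro tendsto_sum trm) auto
  moreover have "(\<Sum>n<card Vf. \<Sum>m<card Vf. (cis (t * (Ev \<theta> n - Ev (\<theta>' t) m)) - cis (dE n
      \<theta> \<xi>)) * cnj (?x n) * ?x' t m * ?o t n m)
      = ip Vf (fibre.evo \<theta> t x) (fibre.evo (\<theta>' t) t x) - (\<Sum>n<card Vf. complex_of_real ((cmod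
          (?x n))\<^sup>2) * cis (dE n \<theta> \<xi>))" for t
    unfolding lhs rhs[of t] by (simp add: left_diff_distrib sum_subtractf)
  ultimately have "((\<lambda>t. ip Vf (fibre.evo \<theta> t x) (fibre.evo (\<theta>' t) t x) - (\<Sum>n<card Vf.
      complex_of_real ((cmod (?x n))\<^sup>2) * cis (dE n \<theta> \<xi>))) \<longlongrightarrow> 0) at_top"
    by simp
  then show ?thesis unfolding \<theta>'_def using Lim_null by blast
qed

end

text \<open>Sums over the vertices become integrals, which gives access to dominated convergence and
  to image measures.\<close>

lemma integral_count_space_infsum:
  fixes f :: "'a \<Rightarrow> 'b::{banach, second_countable_topology}"
  assumes "(\<lambda>v. norm (f v)) summable_on V"
  shows "integrable (count_space V) f" "integral\<^sup>L (count_space V) f = infsum f V"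
proof -
  have *: "Infinite_Set_Sum.abs_summable_on f V" using assms abs_summable_equivalent by blast
  then show "integrable (count_space V) f" by (simp add: abs_summable_on_def)
  show "integral\<^sup>L (count_space V) f = infsum f V"
    using infsetsum_infsum[OF *] by (simp add: infsetsum_def)
qed

lemma has_sum_norm_le:
  fixes f :: "'a \<Rightarrow> 'b::real_normed_vector"
  assumes f: "(f has_sum s) V" and le: "\<And>S. finite S \<Longrightarrow> S \<subseteq> V \<Longrightarrow> norm (sum f S) \<le> B"
  shows "norm s \<le> B"
proof -
  have lim: "((\<lambda>S. norm (sum f S)) \<longlongrightarrow> norm s) (finite_subsets_at_top V)"
    using f unfolding has_sum_def by (rule tendsto_norm)
  have ev: "\<forall>\<^sub>F S in finite_subsets_at_top V. norm (sum f S) \<le> B"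
    unfolding eventually_finite_subsets_at_top using le by (intro exI[of _ "{}"]) auto
  show ?thesis by (rule tendsto_upperbound[OF lim ev finite_subsets_at_top_neq_bot])
qed

context periodic_graph
begin

lemma schr_evol_summable:
  assumes w: "\<And>u. u \<in> V \<Longrightarrow> cmod (w u) \<le> C" and v: "v \<in> V"
  shows "summable (\<lambda>k. ((- \<i> * complex_of_real t) ^ k / of_nat (fact k)) * (schr_op adj Q ^^ k) w v)"
proof (rule summable_comparison_test')
  have "summable (\<lambda>k. ((\<bar>t\<bar> * op_bound) ^ k / fact k) * C)"
    using sums_summable[OF exp_converges[of "\<bar>t\<bar> * op_bound"]] by (intro summable_mult2) (simp add: field_simps)
  then show "summable (\<lambda>k. \<bar>t\<bar> ^ k / fact k * (op_bound ^ k * C))" by (simp add: power_mult_distrib mult_ac)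
  fix k
  have "cmod ((hop 0 ^^ k) w v) \<le> op_bound ^ k * C" by (rule hop_iterate_bound[OF w v])
  then show "norm (((- \<i> * complex_of_real t) ^ k / of_nat (fact k)) * (schr_op adj Q ^^ k) w v) \<le>
      \<bar>t\<bar> ^ k / fact k * (op_bound ^ k * C)"
    unfolding schr_op_hop norm_mult by (intro mult_mono) (auto simp: norm_divide norm_mult norm_power)
qed

lemma schr_op_diff: "(schr_op adj Q ^^ k) (\<lambda>u. f u - f' u) v = (schr_op adj Q ^^ k) f v - (schr_op adj Q ^^ k) f' v"
proof (induction k arbitrary: v)
  case (Suc k)
  have "(schr_op adj Q ^^ k) (\<lambda>u. f u - f' u) = (\<lambda>v. (schr_op adj Q ^^ k) f v - (schr_op adj Q ^^ k) f' v)"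
    using Suc by (intro ext)
  moreover have "schr_op adj Q (\<lambda>u. h u - h' u) v = schr_op adj Q h v - schr_op adj Q h' v" for h h'
    by (simp add: schr_op_def sum_subtractf right_diff_distrib)
  ultimately show ?case by simp
qed simp

lemma schr_evol_diff:
  assumes f: "\<And>u. u \<in> V \<Longrightarrow> cmod (f u) \<le> C" and f': "\<And>u. u \<in> V
      \<Longrightarrow> cmod (f' u) \<le> C" and v: "v \<in> V"
  shows "schr_evol adj Q t (\<lambda>u. f u - f' u) v = schr_evol adj Q t f v - schr_evol adj Q t f' v"
  unfolding schr_evol_def schr_op_diff right_diff_distrib
  by (rule suminf_diff[symmetric, OF schr_evol_summable[OF f v] schr_evol_summable[OF f' v]])

end

section \<open>The initial state and its characteristic function\<close>

locale floquet_state = floquet a b V adj Q \<phi> Ev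
  for a b :: "'d::finite \<Rightarrow> real^'d" and V adj Q \<phi> Ev +
  fixes \<psi> :: "real^'d \<Rightarrow> complex" and g :: "real^'d \<Rightarrow> real^'d \<Rightarrow> complex"
  assumes psi_norm: "((\<lambda>v. (cmod (\<psi> v))\<^sup>2) has_sum 1) V"
    and g_field_approx: "field_approx g" and g_coef: "v \<in> V \<Longrightarrow> coef g v = \<psi> v"
    and phi_meas: "n < card Vf \<Longrightarrow> v \<in> Vf \<Longrightarrow> (\<lambda>\<theta>. \<phi> \<theta>
        n v) \<in> borel_measurable lebesgue"
begin

definition pdf :: "real \<Rightarrow> real^'d \<Rightarrow> real" where "pdf t v = (cmod (schr_evol adj Q t \<psi> v))\<^sup>2"

lemma total_mass: "(LINT \<theta>|mT. (\<Sum>v\<in>Vf. (cmod (g \<theta> v))\<^sup>2)) = 1"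
proof -
  have "((\<lambda>v. (cmod (\<psi> v))\<^sup>2) has_sum (LINT \<theta>|mT. (\<Sum>v\<in>Vf. (cmod (g \<theta> v))\<^sup>2))) V"
    using coef_norm[OF g_field_approx] by (subst has_sum_cong[where g="\<lambda>v. (cmod (coef g v))\<^sup>2"]) (auto simp: g_coef)
  then show ?thesis using psi_norm has_sum_unique by blast
qed

lemma evol_coef: "v \<in> V \<Longrightarrow> schr_evol adj Q t \<psi> v = coef (evolve 0 t g) v"
  using schr_evol_coef[OF g_field_approx, of \<psi> v t 0] by (simp add: g_coef)

lemma pdf_has_sum: "(pdf t has_sum 1) V"
  using coef_evolve_norm[OF g_field_approx, of 0 t] unfolding total_mass
  by (subst has_sum_cong[where g="\<lambda>v. (cmod (coef (evolve 0 t g) v))\<^sup>2"]) (auto simp: pdf_def evol_coef)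

lemma psi_le_1: "u \<in> V \<Longrightarrow> cmod (\<psi> u) \<le> 1"
proof -
  assume "u \<in> V"
  then have "(cmod (\<psi> u))\<^sup>2 \<le> 1"
    using has_sum_mono2[OF has_sum_finite[of "{u}"] psi_norm] by simp
  then show ?thesis by (simp add: abs_square_le_1)
qed

definition defect :: "real^'d \<Rightarrow> real \<Rightarrow> real^'d \<Rightarrow> real" where
  "defect \<xi> t v = (cmod ((1 - cis (- (\<xi> \<bullet> v / t))) * \<psi> v))\<^sup>2"

lemma defect_le: "defect \<xi> t v \<le> 4 * (cmod (\<psi> v))\<^sup>2"
proof -
  have "cmod (1 - cis (- (\<xi> \<bullet> v / t))) \<le> 2" using norm_triangle_ineq4[of 1 "cis (- (\<xi> \<bullet> v / t))"] by simp
  then have "(cmod (1 - cis (- (\<xi> \<bullet> v / t))))\<^sup>2 \<le> 2\<^sup>2" by (intro power_mono) auto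
  then show ?thesis unfolding defect_def norm_mult power_mult_distrib by (intro mult_right_mono) auto
qed

lemma psi_sq_summable: "(\<lambda>v. 4 * (cmod (\<psi> v))\<^sup>2) summable_on V"
  using psi_norm by (intro summable_on_cmult_right) (rule has_sum_imp_summable)

lemma defect_summable: "defect \<xi> t summable_on V"
  by (rule summable_on_comparison_test[OF psi_sq_summable]) (auto simp: defect_le, auto simp: defect_def)

text \<open>The phase tends to 1 at each vertex, and four times the square of \<psi> is a summable
  majorant; no rate and no decay of \<psi> beyond square summability is involved.\<close>

lemma defect_tendsto: "((\<lambda>t. infsum (defect \<xi> t) V) \<longlongrightarrow> 0) at_top"
proof -
  have "((\<lambda>t. integral\<^sup>L (count_space V) (defect \<xi> t)) \<longlongrightarrow> integral\<^sup>L
      (count_space V) (\<lambda>v. 0)) at_top"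
  proof (rule integral_dominated_convergence_at_top[where w="\<lambda>v. 4 * (cmod (\<psi> v))\<^sup>2"])
    show "integrable (count_space V) (\<lambda>v. 4 * (cmod (\<psi> v))\<^sup>2)"
      using psi_sq_summable by (intro integral_count_space_infsum) simp
    show "AE v in count_space V. ((\<lambda>t. defect \<xi> t v) \<longlongrightarrow> 0) at_top"
    proof (rule AE_I2)
      fix v
      have "((\<lambda>t. \<xi> \<bullet> v / t) \<longlongrightarrow> 0) at_top"
        by (rule tendsto_divide_0[OF tendsto_const]) (simp add: filterlim_at_top_imp_at_infinity filterlim_ident)
      then have "((\<lambda>t. (cmod ((1 - cis (- (\<xi> \<bullet> v / t))) * \<psi> v))\<^sup>2)
          \<longlongrightarrow> (cmod ((1 - cis (- 0)) * \<psi> v))\<^sup>2) at_top"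
        by (intro tendsto_power tendsto_norm tendsto_mult tendsto_diff tendsto_const tendsto_cis_compose tendsto_minus)
      then show "((\<lambda>t. defect \<xi> t v) \<longlongrightarrow> 0) at_top" by (simp add: defect_def)
    qed
    show "\<forall>\<^sub>F t in at_top. AE v in count_space V. norm (defect \<xi> t v) \<le> 4 * (cmod (\<psi> v))\<^sup>2"
      using defect_le by (auto intro!: always_eventually simp: defect_def)
  qed auto
  moreover have "integral\<^sup>L (count_space V) (defect \<xi> t) = infsum (defect \<xi> t) V" for t
  proof (rule integral_count_space_infsum)
    have "norm (defect \<xi> t v) = defect \<xi> t v" for v by (simp add: defect_def)
    then show "(\<lambda>v. norm (defect \<xi> t v)) summable_on V" by (simp only: defect_summable)
  qed
  ultimately show ?thesis by simp
qed

text \<open>The difference is, up to a factor of modulus 1, the evolution of \<open>w\<close>, the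
  part of \<psi> lost by applying the phase to it. Contractivity bounds it by the squared norm of
  \<open>w\<close>, which is the total defect.\<close>

lemma twist_error:
  assumes S: "finite S" "S \<subseteq> V" and \<xi>: "\<tau> \<zeta> = \<xi>" 
  shows "(\<Sum>v\<in>S. (cmod (cis (\<xi> \<bullet> v / t) * schr_evol adj Q t \<psi> v - coef (evolve ((1 / t)
      *\<^sub>R \<zeta>) t g) v))\<^sup>2) \<le> infsum (defect \<xi> t) V"
proof -
  have \<eta>: "\<tau> ((1 / t) *\<^sub>R \<zeta>) \<bullet> v = \<xi> \<bullet> v / t" for v by (simp add: theta_b_scaleR \<xi>)
  define w where "w u = \<psi> u - cis (- (\<xi> \<bullet> u / t)) * \<psi> u" for u
  have eq: "cmod (cis (\<xi> \<bullet> v / t) * schr_evol adj Q t \<psi> v - coef (evolve ((1 / t) *\<^sub>R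
      \<zeta>) t g) v) = cmod (schr_evol adj Q t w v)" if v: "v \<in> V" for v
  proof -
    have "schr_evol adj Q t w v = schr_evol adj Q t \<psi> v - schr_evol adj Q t (\<lambda>u. cis (- (\<xi> \<bullet> u / t)) * \<psi> u) v"
      unfolding w_def by (rule schr_evol_diff[where C=1, OF _ _ v]) (auto simp: psi_le_1 norm_mult)
    also have "schr_evol adj Q t (\<lambda>u. cis (- (\<xi> \<bullet> u / t)) * \<psi> u) v = cis (- (\<xi>
        \<bullet> v / t)) * coef (evolve ((1 / t) *\<^sub>R \<zeta>) t g) v"
      using schr_evol_coef[OF g_field_approx _ v, of \<psi> t "(1 / t) *\<^sub>R \<zeta>"] unfolding \<eta> by (simp add: g_coef)
    finally have "cis (\<xi> \<bullet> v / t) * schr_evol adj Q t w v = cis (\<xi> \<bullet> v / t) * schr_evol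
        adj Q t \<psi> v - coef (evolve ((1 / t) *\<^sub>R \<zeta>) t g) v"
      by (simp add: right_diff_distrib mult.assoc[symmetric] cis_mult)
    then have "cmod (cis (\<xi> \<bullet> v / t) * schr_evol adj Q t \<psi> v - coef (evolve ((1 / t) *\<^sub>R
        \<zeta>) t g) v) = cmod (cis (\<xi> \<bullet> v / t) * schr_evol adj Q t w v)" by simp
    then show ?thesis by (simp add: norm_mult)
  qed
  have w_defect: "(cmod (w v))\<^sup>2 = defect \<xi> t v" for v by (simp add: w_def defect_def left_diff_distrib)
  have "((\<lambda>v. (cmod (w v))\<^sup>2) has_sum infsum (defect \<xi> t) V) V"
    unfolding w_defect by (rule has_sum_infsum[OF defect_summable])
  from schr_evol_contraction[OF this S, of t]
  have "(\<Sum>v\<in>S. (cmod (schr_evol adj Q t w v))\<^sup>2) \<le> infsum (defect \<xi> t) V" .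
  moreover have "(\<Sum>v\<in>S. (cmod (cis (\<xi> \<bullet> v / t) * schr_evol adj Q t \<psi> v - coef (evolve
      ((1 / t) *\<^sub>R \<zeta>) t g) v))\<^sup>2) = (\<Sum>v\<in>S. (cmod (schr_evol adj Q t w v))\<^sup>2)"
    using S eq by (intro sum.cong refl) auto
  ultimately show ?thesis by simp
qed

lemma pdf_summable: "(\<lambda>v. norm (pdf t v *\<^sub>R z v)) summable_on V" if "\<And>v. norm (z v) \<le> B"
    for z :: "real^'d \<Rightarrow> 'c::real_normed_vector"
proof (rule summable_on_comparison_test[where f="\<lambda>v. pdf t v * B"])
  show "(\<lambda>v. pdf t v * B) summable_on V"
    using pdf_has_sum[of t] by (intro summable_on_cmult_left) (rule has_sum_imp_summable)
  show "norm (pdf t v *\<^sub>R z v) \<le> pdf t v * B" for v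
    using that by (simp add: pdf_def mult_left_mono)
qed simp

text \<open>The characteristic function is the inner product of the evolved state with its phase
  multiple. Replacing the second factor by the translated evolution costs the twist error by
  Cauchy-Schwarz, and Parseval turns what results into the torus integral.\<close>

lemma char_error:
  assumes \<xi>: "\<tau> \<zeta> = \<xi>"
  shows "cmod (infsum (\<lambda>v. pdf t v *\<^sub>R cis (\<xi> \<bullet> v / t)) V - (LINT \<theta>|mT. ip Vf
      (evolve 0 t g \<theta>) (evolve ((1 / t) *\<^sub>R \<zeta>) t g \<theta>)))
     \<le> sqrt (infsum (defect \<xi> t) V)"
proof -
  define A where "A v = schr_evol adj Q t \<psi> v" for v
  define B where "B v = coef (evolve ((1 / t) *\<^sub>R \<zeta>) t g) v" for v
  have "((\<lambda>v. pdf t v *\<^sub>R cis (\<xi> \<bullet> v / t)) has_sum infsum (\<lambda>v. pdf t v *\<^sub>R cis (\<xi> \<bullet> v / t)) V) V"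
    by (rule has_sum_infsum[OF abs_summable_summable[OF pdf_summable[where B=1]]]) simp
  moreover have "((\<lambda>v. cnj (A v) * B v) has_sum (LINT \<theta>|mT. ip Vf (evolve 0 t g \<theta>) (evolve
      ((1 / t) *\<^sub>R \<zeta>) t g \<theta>))) V"
    using parseval_V[OF field_approx_evolve[OF g_field_approx] field_approx_evolve[OF g_field_approx], of 0 t "(1 / t) *\<^sub>R \<zeta>" t]
    by (subst has_sum_cong[where g="\<lambda>v. cnj (coef (evolve 0 t g) v) * coef (evolve ((1 / t) *\<^sub>R
        \<zeta>) t g) v"]) (auto simp: A_def B_def evol_coef)
  ultimately have hs: "((\<lambda>v. pdf t v *\<^sub>R cis (\<xi> \<bullet> v / t) - cnj (A v) * B v) has_sum
     (infsum (\<lambda>v. pdf t v *\<^sub>R cis (\<xi> \<bullet> v / t)) V - (LINT \<theta>|mT. ip Vf (evolve 0 t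
         g \<theta>) (evolve ((1 / t) *\<^sub>R \<zeta>) t g \<theta>)))) V"
    unfolding has_sum_def sum_subtractf by (rule tendsto_diff)
  show ?thesis
  proof (rule has_sum_norm_le[OF hs])
    fix S assume S: "finite S" "S \<subseteq> V"
    have "pdf t v *\<^sub>R cis (\<xi> \<bullet> v / t) - cnj (A v) * B v = cnj (A v) * (cis (\<xi> \<bullet> v / t) * A v - B v)" for v
      by (simp add: pdf_def A_def scaleR_conv_of_real complex_norm_square algebra_simps del: of_real_power)
    then have "(\<Sum>v\<in>S. pdf t v *\<^sub>R cis (\<xi> \<bullet> v / t) - cnj (A v) * B v) = ip S A
        (\<lambda>v. cis (\<xi> \<bullet> v / t) * A v - B v)"
      by (simp add: ip_def)
    also have "cmod \<dots> \<le> sqrt (\<Sum>v\<in>S. (cmod (A v))\<^sup>2) * sqrt (\<Sum>v\<in>S. (cmod (cis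
        (\<xi> \<bullet> v / t) * A v - B v))\<^sup>2)"
      by (rule ip_cauchy_schwarz)
    also have "\<dots> \<le> 1 * sqrt (infsum (defect \<xi> t) V)"
    proof (intro mult_mono)
      have "(\<Sum>v\<in>S. (cmod (A v))\<^sup>2) \<le> 1"
        using has_sum_mono2[OF has_sum_finite[OF S(1)] pdf_has_sum[of t] S(2)] by (simp add: pdf_def A_def)
      then show "sqrt (\<Sum>v\<in>S. (cmod (A v))\<^sup>2) \<le> 1" by simp
      show "sqrt (\<Sum>v\<in>S. (cmod (cis (\<xi> \<bullet> v / t) * A v - B v))\<^sup>2) \<le> sqrt (infsum (defect \<xi> t) V)"
        using twist_error[OF S \<xi>, of t] by (simp add: A_def B_def)
    qed (auto simp: sum_nonneg)
    finally show "cmod (\<Sum>v\<in>S. pdf t v *\<^sub>R cis (\<xi> \<bullet> v / t) - cnj (A v) * B v) \<le> sqrt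
        (infsum (defect \<xi> t) V)" by simp
  qed
qed

definition weight :: "real^'d \<Rightarrow> nat \<Rightarrow> real" where "weight \<theta> n = (cmod (ip Vf
    (\<phi> \<theta> n) (g \<theta>)))\<^sup>2"

lemma sum_weight: "(\<Sum>n<card Vf. weight \<theta> n) = (\<Sum>v\<in>Vf. (cmod (g \<theta> v))\<^sup>2)"
  unfolding weight_def by (rule fibre.norm_expand[symmetric])

lemma g_measurable: "v \<in> Vf \<Longrightarrow> (\<lambda>\<theta>. g \<theta> v) \<in> borel_measurable mT"
  using field_approx_L2F[OF g_field_approx] by (auto simp: L2F_def L2_def)

lemma weight_measurable:
  assumes "n < card Vf"
  shows "(\<lambda>\<theta>. weight \<theta> n) \<in> borel_measurable mT"
proof -
  have "(\<lambda>\<theta>. cnj (\<phi> \<theta> n v) * g \<theta> v) \<in> borel_measurable mT" if "v \<in> Vf" for v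
    using measurable_compose[OF measurable_restrict_space1[OF phi_meas[OF assms that]] borel_measurable_cnj]
      g_measurable[OF that] by (intro borel_measurable_times)
  then have "(\<lambda>\<theta>. ip Vf (\<phi> \<theta> n) (g \<theta>)) \<in> borel_measurable mT"
    unfolding ip_def by (intro borel_measurable_sum)
  then show ?thesis unfolding weight_def by measurable
qed

text \<open>At regular points the derivative is the limit of difference quotients of a continuous
  function along the steps 1/(k+1). Elsewhere \<open>deriv\<close> may take any value, but these
  points are null and the completed measure absorbs them.\<close>

lemma band_partial_measurable:
  assumes n: "n < card Vf"
  shows "(\<lambda>\<theta>. band_partial Ev n \<theta> i) \<in> borel_measurable lebesgue"
proof -
  have cont: "continuous_on UNIV (\<lambda>\<theta>. Ev \<theta> n)"
    by (rule lipschitz_on_continuous_on[of "2 * lip_const"], rule lipschitz_onI)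
      (use Ev_lipschitz[OF n] lip_const_nonneg in \<open>auto simp: dist_norm\<close>)
  have E_meas [measurable]: "(\<lambda>\<theta>. Ev \<theta> n) \<in> borel_measurable borel"
    using cont by (rule borel_measurable_continuous_onI)
  have reg: "{\<theta>. regular \<theta>} \<in> sets lebesgue"
  proof -
    have "Measurable.pred lebesgue (\<lambda>\<theta>. \<not> regular \<theta>)"
      by (rule sets_completion_AE) (use AE_regular in simp)
    then have "Measurable.pred lebesgue (\<lambda>\<theta>. \<not> \<not> regular \<theta>)" by (rule pred_intros_logic)
    then show ?thesis by (simp add: pred_def)
  qed
  define q where "q k \<theta> = (if regular \<theta> then (Ev (\<theta> + inverse (real (Suc k)) *\<^sub>R axis i
      1) n - Ev \<theta> n) / inverse (real (Suc k)) else 0)" for k \<theta>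
  have "(\<lambda>\<theta>. if regular \<theta> then band_partial Ev n \<theta> i else 0) \<in> borel_measurable lebesgue"
  proof (rule borel_measurable_LIMSEQ_metric)
    show "q k \<in> borel_measurable lebesgue" for k
      unfolding q_def using reg
      by (intro measurable_If measurable_completion) (auto simp: space_lborel, measurable)
    fix \<theta>
    show "(\<lambda>k. q k \<theta>) \<longlonglongrightarrow> (if regular \<theta> then band_partial Ev n \<theta> i else 0)"
    proof (cases "regular \<theta>")
      case True
      have "((\<lambda>s. (Ev (\<theta> + s *\<^sub>R axis i 1) n - Ev \<theta> n) / s) \<longlongrightarrow> band_partial Ev n \<theta> i) (at 0)"
        using Ev_line_deriv[OF True n, of "axis i 1"] unfolding DERIV_def band_partial_dE[OF True n] by simp
      moreover have "filterlim (\<lambda>k. inverse (real (Suc k))) (at 0) sequentially"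
        unfolding filterlim_at using LIMSEQ_inverse_real_of_nat by auto
      ultimately have "(\<lambda>k. (Ev (\<theta> + inverse (real (Suc k)) *\<^sub>R axis i 1) n - Ev \<theta> n)
          / inverse (real (Suc k))) \<longlonglongrightarrow> band_partial Ev n \<theta> i"
        by (rule filterlim_compose)
      then show ?thesis using True by (simp add: q_def)
    qed (simp add: q_def)
  qed
  moreover have "AE \<theta> in lebesgue. (if regular \<theta> then band_partial Ev n \<theta> i else 0) = band_partial Ev n \<theta> i"
    using AE_completion[OF AE_regular] by eventually_elim simp
  ultimately show ?thesis by (rule borel_measurable_AE)
qed

lemma group_vel_measurable:
  assumes "n < card Vf"
  shows "(\<lambda>\<theta>. group_vel a Ev (\<theta>, n)) \<in> borel_measurable mT"
  using measurable_restrict_space1[OF band_partial_measurable[OF assms]]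
  unfolding group_vel_def by simp

definition limit_char :: "real^'d \<Rightarrow> complex" where
  "limit_char \<xi> = (LINT \<theta>|mT. (\<Sum>n<card Vf. weight \<theta> n *\<^sub>R cis (\<xi> \<bullet> group_vel a Ev (\<theta>, n))))"

text \<open>Fibre evolution preserves norms, so the squared fibre norm of \<open>g\<close> dominates
  the integrand for all \<open>t\<close>; pointwise convergence holds at regular
  quasimomenta.\<close>

lemma char_tendsto:
  "((\<lambda>t. infsum (\<lambda>v. pdf t v *\<^sub>R cis (\<xi> \<bullet> v / t)) V) \<longlongrightarrow> limit_char \<xi>) at_top"
proof -
  obtain \<zeta> where \<zeta>: "\<tau> \<zeta> = \<xi>" using theta_b_surj .
  define I where "I t = (LINT \<theta>|mT. ip Vf (evolve 0 t g \<theta>) (evolve ((1 / t) *\<^sub>R \<zeta>) t g \<theta>))" for t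
  have I: "(I \<longlongrightarrow> limit_char \<xi>) at_top"
    unfolding I_def[abs_def] limit_char_def
  proof (rule integral_dominated_convergence_at_top[where w="\<lambda>\<theta>. \<Sum>v\<in>Vf. (cmod (g \<theta> v))\<^sup>2"])
    show "(\<lambda>\<theta>. \<Sum>n<card Vf. weight \<theta> n *\<^sub>R cis (\<xi> \<bullet> group_vel a Ev
        (\<theta>, n))) \<in> borel_measurable mT"
      using group_vel_measurable weight_measurable
      by (intro borel_measurable_sum borel_measurable_scaleR measurable_compose[OF _ borel_measurable_cis] borel_measurable_inner) auto
    show "(\<lambda>\<theta>. ip Vf (evolve 0 t g \<theta>) (evolve ((1 / t) *\<^sub>R \<zeta>) t g \<theta>)) \<in> borel_measurable mT" for t
      unfolding ip_def
      by (intro borel_measurable_sum borel_measurable_times measurable_compose[OF _ borel_measurable_cnj]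
          L2_measurable[OF L2_evolve[OF g_field_approx]])
    show "integrable mT (\<lambda>\<theta>. \<Sum>v\<in>Vf. (cmod (g \<theta> v))\<^sup>2)" by (rule integrable_W[OF g_field_approx])
    show "AE \<theta> in mT. ((\<lambda>t. ip Vf (evolve 0 t g \<theta>) (evolve ((1 / t) *\<^sub>R \<zeta>) t g
        \<theta>)) \<longlongrightarrow> (\<Sum>n<card Vf. weight \<theta> n *\<^sub>R cis (\<xi> \<bullet> group_vel a Ev (\<theta>, n)))) at_top"
      using AE_torus[OF AE_regular]
    proof eventually_elim
      case (elim \<theta>)
      have "(\<Sum>n<card Vf. weight \<theta> n *\<^sub>R cis (\<xi> \<bullet> group_vel a Ev (\<theta>, n))) =
          (\<Sum>n<card Vf. complex_of_real ((cmod (ip Vf (\<phi> \<theta> n) (g \<theta>)))\<^sup>2) * cis (dE n \<theta> \<zeta>))"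
        using elim by (intro sum.cong refl) (simp add: weight_def scaleR_conv_of_real \<zeta>[symmetric] group_vel_inner)
      then show ?case using evo_overlap_tendsto[OF elim, of "g \<theta>" \<zeta>] by (simp add: evolve_def)
    qed
    have "cmod (ip Vf (evolve 0 t g \<theta>) (evolve ((1 / t) *\<^sub>R \<zeta>) t g \<theta>)) \<le>
        (\<Sum>v\<in>Vf. (cmod (g \<theta> v))\<^sup>2)" for t \<theta>
      using ip_bound[of Vf "evolve 0 t g \<theta>" "evolve ((1 / t) *\<^sub>R \<zeta>) t g \<theta>"] unfolding evolve_norm by simp
    then show "\<forall>\<^sub>F t in at_top. AE \<theta> in mT. cmod (ip Vf (evolve 0 t g \<theta>) (evolve ((1 /
        t) *\<^sub>R \<zeta>) t g \<theta>)) \<le> (\<Sum>v\<in>Vf. (cmod (g \<theta> v))\<^sup>2)"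
      by (intro always_eventually allI AE_I2)
  qed
  have "((\<lambda>t. sqrt (infsum (defect \<xi> t) V)) \<longlongrightarrow> sqrt 0) at_top" by (intro tendsto_real_sqrt defect_tendsto)
  then have z: "((\<lambda>t. sqrt (infsum (defect \<xi> t) V)) \<longlongrightarrow> 0) at_top" by simp
  have "((\<lambda>t. infsum (\<lambda>v. pdf t v *\<^sub>R cis (\<xi> \<bullet> v / t)) V - I t) \<longlongrightarrow> 0) at_top"
    by (rule Lim_null_comparison[OF always_eventually[OF allI] z]) (unfold I_def, rule char_error[OF \<zeta>])
  from tendsto_add[OF this I] show ?thesis by simp
qed

end

subsection \<open>Weak convergence of the laws\<close>

lemma measurable_pair_count_space:
  assumes "countable A" and "\<And>n. n \<in> A \<Longrightarrow> (\<lambda>x. f (x, n)) \<in> measurable M K"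
  shows "f \<in> measurable (M \<Otimes>\<^sub>M count_space A) K"
proof -
  have "(\<lambda>p. f (fst p, n)) \<in> measurable (M \<Otimes>\<^sub>M count_space A) K" if "n \<in> A" for n
    using measurable_compose[OF measurable_fst assms(2)[OF that]] .
  from measurable_compose_countable'[where f="\<lambda>n p. f (fst p, n)", OF this measurable_snd assms(1)]
  show ?thesis by simp
qed

lemma prob_space_densityI:
  assumes [measurable]: "f \<in> borel_measurable M" and "(\<integral>\<^sup>+x. f x \<partial>M) = 1"
  shows "prob_space (density M f)"
proof (rule prob_spaceI)
  have "(\<integral>\<^sup>+x. f x * indicator (space M) x \<partial>M) = (\<integral>\<^sup>+x. f x \<partial>M)" by (intro nn_integral_cong) simp
  then show "emeasure (density M f) (space (density M f)) = 1" using assms by (simp add: emeasure_density)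
qed

context floquet_state
begin

text \<open>The distribution of the rescaled position, realised as a Borel measure so that the
  continuity theorem can be applied.\<close>

definition law :: "real \<Rightarrow> (real^'d) measure" where
  "law t = distr (density (count_space V) (\<lambda>v. ennreal (pdf t v))) borel (\<lambda>v. (1 / t) *\<^sub>R v)"

lemma sets_law: "sets (law t) = sets borel"
  by (simp add: law_def)

lemma prob_space_law: "prob_space (law t)"
proof -
  have p: "integrable (count_space V) (pdf t)" "integral\<^sup>L (count_space V) (pdf t) = 1"
  proof -
    have "norm (pdf t v) = pdf t v" for v by (simp add: pdf_def)
    then have "(\<lambda>v. norm (pdf t v)) summable_on V" using has_sum_imp_summable[OF pdf_has_sum] by (simp only:)
    from integral_count_space_infsum[OF this]
    show "integrable (count_space V) (pdf t)" "integral\<^sup>L (count_space V) (pdf t) = 1"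
      using infsumI[OF pdf_has_sum[of t]] by auto
  qed
  have "(\<integral>\<^sup>+v. ennreal (pdf t v) \<partial>count_space V) = 1"
    using nn_integral_eq_integral[OF p(1)] p(2) by (simp add: pdf_def)
  then have "prob_space (density (count_space V) (\<lambda>v. ennreal (pdf t v)))"
    by (intro prob_space_densityI) auto
  then show ?thesis unfolding law_def by (rule prob_space.prob_space_distr) simp
qed

lemma integral_law:
  fixes F :: "real^'d \<Rightarrow> 'c::{banach, second_countable_topology}"
  assumes F: "F \<in> borel_measurable borel" and B: "\<And>x. norm (F x) \<le> B"
  shows "integral\<^sup>L (law t) F = infsum (\<lambda>v. pdf t v *\<^sub>R F ((1 / t) *\<^sub>R v)) V"
proof -
  have "integral\<^sup>L (law t) F = (LINT v|density (count_space V) (\<lambda>v. ennreal (pdf t v)). F ((1 / t) *\<^sub>R v))"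
    unfolding law_def by (rule integral_distr[OF _ F]) simp
  also have "\<dots> = (LINT v|count_space V. pdf t v *\<^sub>R F ((1 / t) *\<^sub>R v))"
    by (rule integral_density) (auto simp: pdf_def)
  also have "\<dots> = infsum (\<lambda>v. pdf t v *\<^sub>R F ((1 / t) *\<^sub>R v)) V"
    by (rule integral_count_space_infsum(2)[OF pdf_summable]) (rule B)
  finally show ?thesis .
qed

abbreviation "bands \<equiv> count_space {..<card Vf}"
abbreviation "band_space \<equiv> mT \<Otimes>\<^sub>M bands"
abbreviation "lim_law \<equiv> limit_measure a (card Vf) Vf Ev \<phi> g"

lemma pair_sigma_finite_bands: "pair_sigma_finite mT bands"
  by (intro pair_sigma_finite.intro finite_measure.sigma_finite_measure[OF finite_mT]
    sigma_finite_measure_count_space_finite) simp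

lemma spec_weight_weight: "spec_weight Vf \<phi> g (\<theta>, n) = weight \<theta> n"
  by (simp add: spec_weight_def weight_def ip_def)

lemma spec_weight_measurable: "spec_weight Vf \<phi> g \<in> borel_measurable band_space"
  using weight_measurable by (intro measurable_pair_count_space) (auto simp: spec_weight_weight)

lemma spec_weight_nonneg: "0 \<le> spec_weight Vf \<phi> g x"
  by (cases x) (simp add: spec_weight_weight weight_def)

lemma group_vel_pair_measurable: "group_vel a Ev \<in> borel_measurable band_space"
  using group_vel_measurable by (intro measurable_pair_count_space) auto

text \<open>The weights of all bands add up to the squared fibre norm of \<open>g\<close>, which
  gives an integrable majorant for Fubini. With constant \<open>F\<close> the identity also yields
  the total mass 1 of the limit law.\<close>

lemma weighted_pair_integral:
  fixes F :: "real^'d \<Rightarrow> 'c::{banach, second_countable_topology}"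
  assumes F: "F \<in> borel_measurable borel" and B: "\<And>x. norm (F x) \<le> B"
  shows "integrable band_space (\<lambda>x. spec_weight Vf \<phi> g x *\<^sub>R F (group_vel a Ev x))"
    and "(LINT x|band_space. spec_weight Vf \<phi> g x *\<^sub>R F (group_vel a Ev x))
      = (LINT \<theta>|mT. (\<Sum>n<card Vf. weight \<theta> n *\<^sub>R F (group_vel a Ev (\<theta>, n))))"
proof -
  interpret pair_sigma_finite mT bands by (rule pair_sigma_finite_bands)
  let ?f = "\<lambda>x. spec_weight Vf \<phi> g x *\<^sub>R F (group_vel a Ev x)"
  have m: "?f \<in> borel_measurable band_space"
    by (intro borel_measurable_scaleR spec_weight_measurable measurable_compose[OF group_vel_pair_measurable F])
  show i: "integrable band_space ?f"
  proof (rule Fubini_integrable[OF m])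
    show "integrable mT (\<lambda>\<theta>. LINT n|bands. norm (?f (\<theta>, n)))"
    proof (rule Bochner_Integration.integrable_bound)
      have fin: "(LINT n|bands. norm (?f (\<theta>, n))) = (\<Sum>n<card Vf. weight \<theta> n * norm (F
          (group_vel a Ev (\<theta>, n))))" for \<theta>
        by (subst lebesgue_integral_count_space_finite) (auto simp: spec_weight_weight weight_def)
      show "integrable mT (\<lambda>\<theta>. B * (\<Sum>v\<in>Vf. (cmod (g \<theta> v))\<^sup>2))"
        by (intro integrable_mult_right integrable_W[OF g_field_approx])
      show "(\<lambda>\<theta>. LINT n|bands. norm (?f (\<theta>, n))) \<in> borel_measurable mT"
        unfolding fin
        by (intro borel_measurable_sum borel_measurable_times weight_measurable
          measurable_compose[OF measurable_compose[OF group_vel_measurable F] borel_measurable_norm]) auto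
      have "norm (LINT n|bands. norm (?f (\<theta>, n))) \<le> norm (B * (\<Sum>v\<in>Vf. (cmod (g \<theta> v))\<^sup>2))" for \<theta>
      proof -
        note fin[of \<theta>]
        also have "(\<Sum>n<card Vf. weight \<theta> n * norm (F (group_vel a Ev (\<theta>, n)))) \<le> (\<Sum>n<card Vf. weight \<theta> n * B)"
          by (intro sum_mono mult_left_mono B) (simp add: weight_def)
        also have "\<dots> = B * (\<Sum>v\<in>Vf. (cmod (g \<theta> v))\<^sup>2)" by (simp add: sum_weight[symmetric] sum_distrib_left mult.commute)
        finally have "(LINT n|bands. norm (?f (\<theta>, n))) \<le> B * (\<Sum>v\<in>Vf. (cmod (g \<theta> v))\<^sup>2)" .
        moreover have "0 \<le> (LINT n|bands. norm (?f (\<theta>, n)))" by simp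
        ultimately show ?thesis by simp
      qed
      then show "AE \<theta> in mT. norm (LINT n|bands. norm (?f (\<theta>, n))) \<le> norm (B * (\<Sum>v\<in>Vf.
          (cmod (g \<theta> v))\<^sup>2))" by simp
    qed
    show "AE \<theta> in mT. integrable bands (\<lambda>n. ?f (\<theta>, n))"
      by (intro AE_I2 integrable_count_space) simp
  qed
  have "(LINT x|band_space. ?f x) = (LINT \<theta>|mT. LINT n|bands. ?f (\<theta>, n))"
    by (rule integral_fst'[OF i, symmetric])
  also have "\<dots> = (LINT \<theta>|mT. (\<Sum>n<card Vf. weight \<theta> n *\<^sub>R F (group_vel a Ev (\<theta>, n))))"
    by (simp add: lebesgue_integral_count_space_finite spec_weight_weight)
  finally show "(LINT x|band_space. ?f x) = (LINT \<theta>|mT. (\<Sum>n<card Vf. weight \<theta> n *\<^sub>R F (group_vel a Ev (\<theta>, n))))" .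
qed

lemma spec_measure_eq:
  "spec_measure (card Vf) Vf \<phi> g = density band_space (\<lambda>x. ennreal (spec_weight Vf \<phi> g x))"
  by (simp add: spec_measure_def)

lemma group_vel_spec_measurable: "group_vel a Ev \<in> borel_measurable (spec_measure (card Vf) Vf \<phi> g)"
  using group_vel_pair_measurable by (simp add: spec_measure_eq)

lemma integral_lim_law:
  fixes F :: "real^'d \<Rightarrow> 'c::{banach, second_countable_topology}"
  assumes F: "F \<in> borel_measurable borel" and B: "\<And>x. norm (F x) \<le> B"
  shows "integral\<^sup>L lim_law F = (LINT \<theta>|mT. (\<Sum>n<card Vf. weight \<theta> n *\<^sub>R F (group_vel a Ev (\<theta>, n))))"
proof -
  have "integral\<^sup>L lim_law F = (LINT x|spec_measure (card Vf) Vf \<phi> g. F (group_vel a Ev x))"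
    unfolding limit_measure_def by (rule integral_distr[OF group_vel_spec_measurable F])
  also have "\<dots> = (LINT x|band_space. spec_weight Vf \<phi> g x *\<^sub>R F (group_vel a Ev x))"
    unfolding spec_measure_eq
    by (rule integral_density[OF measurable_compose[OF group_vel_pair_measurable F] spec_weight_measurable])
      (simp add: spec_weight_nonneg)
  finally show ?thesis by (simp only: weighted_pair_integral(2)[OF F B])
qed

lemma prob_space_lim_law: "prob_space lim_law"
proof -
  have i: "integrable band_space (spec_weight Vf \<phi> g)" "integral\<^sup>L band_space (spec_weight Vf \<phi> g) = 1"
    using weighted_pair_integral[of "\<lambda>_. 1::real" 1] by (simp_all add: sum_weight total_mass)
  have "(\<integral>\<^sup>+x. ennreal (spec_weight Vf \<phi> g x) \<partial>band_space) = 1"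
    using nn_integral_eq_integral[OF i(1)] i(2) by (simp add: spec_weight_nonneg)
  then have "prob_space (spec_measure (card Vf) Vf \<phi> g)"
    unfolding spec_measure_eq using spec_weight_measurable
    by (intro prob_space_densityI) auto
  then show ?thesis unfolding limit_measure_def
    by (rule prob_space.prob_space_distr[OF _ group_vel_spec_measurable])
qed

lemma AE_lim_law: "AE x in lim_law. norm x \<le> max_speed"
proof -
  interpret pair_sigma_finite mT bands by (rule pair_sigma_finite_bands)
  have "AE x in band_space. norm (group_vel a Ev x) \<le> max_speed"
  proof (rule AE_pair_measure)
    show "{x \<in> space band_space. norm (group_vel a Ev x) \<le> max_speed} \<in> sets band_space"
      using group_vel_pair_measurable by measurable
    show "AE \<theta> in mT. AE n in bands. norm (group_vel a Ev (\<theta>, n)) \<le> max_speed"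
      using AE_torus[OF AE_regular] by eventually_elim (auto intro!: AE_I2 group_vel_bound)
  qed
  then have "AE x in spec_measure (card Vf) Vf \<phi> g. norm (group_vel a Ev x) \<le> max_speed"
    unfolding spec_measure_eq using spec_weight_measurable by (subst AE_density) auto
  then show ?thesis unfolding limit_measure_def
    by (subst AE_distr_iff[OF group_vel_spec_measurable]) auto
qed

theorem weak_limit:
  assumes f: "continuous_on UNIV f" "bounded (range f)"
  shows "((\<lambda>t. expect_scaled adj Q V \<psi> f t) \<longlongrightarrow> integral\<^sup>L lim_law f) at_top"
proof -
  have fm: "f \<in> borel_measurable borel" using f(1) by (rule borel_measurable_continuous_onI)
  obtain B where B: "\<And>x. norm (f x) \<le> B" using f(2) by (auto simp: bounded_iff)
  have e: "expect_scaled adj Q V \<psi> f t = integral\<^sup>L (law t) f" for t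
    unfolding expect_scaled_def integral_law[OF fm B] by (simp add: pdf_def)
  have im: "(\<lambda>x. iexp (\<xi> \<bullet> x)) \<in> borel_measurable borel" for \<xi> :: "real^'d" by measurable
  show ?thesis unfolding e
  \<comment> \<open>The continuity theorem concerns sequences of measures. Any sequence of times may
    be taken, since \<open>law t\<close> is a probability measure for every real \<open>t\<close>;
    at 0 the quotient \<open>1 / t\<close> is 0.\<close>
  proof (rule tendsto_at_topI_sequentially)
    fix X :: "nat \<Rightarrow> real" assume X: "filterlim X at_top sequentially"
    show "(\<lambda>n. integral\<^sup>L (law (X n)) f) \<longlonglongrightarrow> integral\<^sup>L lim_law f"
    proof (rule levy_continuity_bounded[OF prob_space_law sets_law prob_space_lim_law _ _ AE_lim_law f])
      show "sets lim_law = sets borel" by (simp add: limit_measure_def)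
      fix \<xi> :: "real^'d"
      have l: "(CLINT x|law t. iexp (\<xi> \<bullet> x)) = infsum (\<lambda>v. pdf t v *\<^sub>R cis (\<xi> \<bullet> v / t)) V" for t
        by (subst integral_law[OF im, where B=1]) (simp_all add: cis_conv_exp)
      have "(CLINT x|lim_law. iexp (\<xi> \<bullet> x)) = limit_char \<xi>"
        by (subst integral_lim_law[OF im, where B=1]) (simp_all add: limit_char_def cis_conv_exp)
      then show "(\<lambda>n. CLINT x|law (X n). iexp (\<xi> \<bullet> x)) \<longlonglongrightarrow> (CLINT x|lim_law. iexp (\<xi> \<bullet> x))"
        unfolding l using filterlim_compose[OF char_tendsto[of \<xi>] X] by simp
    qed
  qed
qed

end

text \<open>Convergence in distribution is expressed by bounded continuous test functions. The
  projections are the rank-one projections onto the listed eigenvectors: at a degenerate eigenvalue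
  another choice moves weight only between bands of equal energy, which almost everywhere have the
  same group velocity, so the image measure is unaffected.\<close>

theorem theorem5p4:
  fixes a b :: "'d::finite \<Rightarrow> real^'d"
    and V :: "(real^'d) set"
    and adj :: "real^'d \<Rightarrow> real^'d \<Rightarrow> bool"
    and Q :: "real^'d \<Rightarrow> real"
    and \<psi> :: "real^'d \<Rightarrow> complex"
    and Ev :: "real^'d \<Rightarrow> nat \<Rightarrow> real"
    and \<phi> :: "real^'d \<Rightarrow> nat \<Rightarrow> real^'d \<Rightarrow> complex"
    and g :: "real^'d \<Rightarrow> real^'d \<Rightarrow> complex"
  assumes basis: "inj a" "independent (range a)" "span (range a) = UNIV"
    and dual: "\<And>i j. a i \<bullet> b j = (if i = j then 2 * pi else 0)"
    and adj_V: "\<And>u v. adj u v \<Longrightarrow> u \<in> V \<and> v \<in> V"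
    and adj_sym: "\<And>u v. adj u v \<Longrightarrow> adj v u"
    and loc_fin: "\<And>v. v \<in> V \<Longrightarrow> finite {u. adj v u}"
    and V_inf: "infinite V"
    and V_per: "\<And>v i. v \<in> V \<longleftrightarrow> v + a i \<in> V"
    and adj_per: "\<And>u v i. adj u v \<longleftrightarrow> adj (u + a i) (v + a i)"
    and Vf_fin: "finite (V \<inter> cell a)"
    and Q_per: "\<And>v i. v \<in> V \<Longrightarrow> Q (v + a i) = Q v"
    and psi_supp: "\<And>v. v \<notin> V \<Longrightarrow> \<psi> v = 0"
    and psi_norm: "((\<lambda>v. (cmod (\<psi> v))\<^sup>2) has_sum 1) V"
    \<comment> \<open>(U psi): for each v_n in V_f, the L^2(T^d_*)-limit of the lattice sums\<close>
    and U_meas: "\<And>v. v \<in> V \<inter> cell a \<Longrightarrow> (\<lambda>\<theta>. g \<theta> v) \<in> borel_measurable lebesgue"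
    and U_lim: "\<And>v. v \<in> V \<inter> cell a \<Longrightarrow>
       ((\<lambda>F. \<integral>\<^sup>+ \<theta>\<in>torus. ennreal ((cmod ((\<Sum>k\<in>F.
            exp (- \<i> * complex_of_real (theta_b b \<theta> \<bullet> (v + k))) * \<psi> (v + k)) - g \<theta> v))\<^sup>2) \<partial>lebesgue)
        \<longlongrightarrow> 0) (finite_subsets_at_top (lattice a))"
    \<comment> \<open>eigen-decomposition of H(theta_b): orthonormal eigenbasis, increasing eigenvalues\<close>
    and eig_vec: "\<And>\<theta> n v. n < card (V \<inter> cell a) \<Longrightarrow> v \<in> V \<inter> cell a \<Longrightarrow>
       bloch_op a adj Q (theta_b b \<theta>) (\<phi> \<theta> n) v = complex_of_real (Ev \<theta> n) * \<phi> \<theta> n v"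
    and eig_orth: "\<And>\<theta> n m. n < card (V \<inter> cell a) \<Longrightarrow> m < card (V \<inter> cell a) \<Longrightarrow>
       (\<Sum>v\<in>V \<inter> cell a. cnj (\<phi> \<theta> n v) * \<phi> \<theta> m v) = (if n = m then 1 else 0)"
    and eig_sorted: "\<And>\<theta> n m. n \<le> m \<Longrightarrow> m < card (V \<inter> cell a) \<Longrightarrow> Ev \<theta> n \<le> Ev \<theta> m"
    and eig_meas: "\<And>n v. n < card (V \<inter> cell a) \<Longrightarrow> v \<in> V \<inter> cell a \<Longrightarrow>
       (\<lambda>\<theta>. \<phi> \<theta> n v) \<in> borel_measurable lebesgue"
  shows "\<forall>f :: real^'d \<Rightarrow> real. continuous_on UNIV f \<and> bounded (range f) \<longrightarrow>
     ((\<lambda>t. expect_scaled adj Q V \<psi> f t) \<longlongrightarrow>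
        integral\<^sup>L (limit_measure a (card (V \<inter> cell a)) (V \<inter> cell a) Ev \<phi> g) f) at_top"
proof -
  interpret periodic_graph a b V adj Q
    using basis dual adj_V loc_fin V_per adj_per Vf_fin Q_per by unfold_locales auto
  have "eigenbasis (V \<inter> cell a) (\<phi> \<theta>) (kern (theta_b b \<theta>)) (Ev \<theta>)" for \<theta>
  proof
    show "finite (V \<inter> cell a)" by (rule Vf_fin)
    show "ip (V \<inter> cell a) (\<phi> \<theta> n) (\<phi> \<theta> m) = (if n = m then 1 else 0)"
      if "n < card (V \<inter> cell a)" "m < card (V \<inter> cell a)" for n m
      unfolding ip_def by (rule eig_orth[OF that])
    show "(\<Sum>w\<in>V \<inter> cell a. kern (theta_b b \<theta>) v w * \<phi> \<theta> n w) = complex_of_real (Ev \<theta> n) * \<phi> \<theta> n v"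
      if "n < card (V \<inter> cell a)" "v \<in> V \<inter> cell a" for n v
      unfolding bloch_op_kern[OF that(2), symmetric] by (rule eig_vec[OF that])
  qed
  then have "floquet a b V adj Q \<phi> Ev"
    by (intro floquet.intro periodic_graph_axioms floquet_axioms.intro eig_sorted)
  then interpret floquet a b V adj Q \<phi> Ev .
  interpret floquet_state a b V adj Q \<phi> Ev \<psi> g
    using psi_norm field_approx_of_lattice_sums[OF U_meas U_lim] eig_meas by unfold_locales
  show ?thesis using weak_limit by blast
qed

end
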